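(* Let $\{V_j\}_{j\in\mathbb{Z}}$ be a multiresolution analysis of $L^2(\mathbb{R})$ with scaling function $\phi\in V_0$, let $W_0$ be the orthogonal complement of $V_0$ in $V_1$, and let $\phi_0 = P_{W_0}D\phi$ and $\phi_1 = P_{W_0}DT\phi$, where $P_{W_0}$ is the orthogonal projection of $L^2(\mathbb{R})$ onto $W_0$. Let \[ E = \{\xi\in\mathbb{R} : |\vec{\hat\phi}_0(\xi)|^2 \ge \tfrac12\}, \qquad F = \{\xi\in\mathbb{R} : |\vec{\hat\phi}_1(\xi)|^2 > \tfrac12\}, \] and define functions $f$ and $g$ by \[ f(\xi) = \frac{\chi_E(\xi)}{|\vec{\hat\phi}_0(\xi)|}, \qquad g(\xi) = \frac{\chi_F(\xi)}{|\vec{\hat\phi}_1(\xi)|}. \] Then the function $\psi$ defined by \[ \hat\psi(\xi) = f(\xi)\hat\phi_0(\xi) + g(\xi)\hat\phi_1(\xi) \] is an orthonormal wavelet for $L^2(\mathbb{R})$ associated with the given multiresolution analysis, i.e. $\psi\in W_0$.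
   Context: Define unitary operators on $L^2(\mathbb{R})$ by $Df(x)=\sqrt2\, f(2x)$ and $Tf(x)=f(x-1)$. An (orthonormal) wavelet is a function $\psi\in L^2(\mathbb{R})$ such that $\{D^nT^l\psi : n,l\in\mathbb{Z}\}$ is an orthonormal basis of $L^2(\mathbb{R})$. A multiresolution analysis (MRA) is a sequence $\{V_j\}_{j\in\mathbb{Z}}$ of closed subspaces of $L^2(\mathbb{R})$ such that: (1) $V_j\subset V_{j+1}$; (2) $DV_j=V_{j+1}$; (3) $\bigcap_{j\in\mathbb{Z}}V_j=\{0\}$ and $\bigcup_{j\in\mathbb{Z}}V_j$ has dense span in $L^2(\mathbb{R})$; (4) there is a scaling function $\phi\in V_0$, i.e. $\{T^l\phi : l\in\mathbb{Z}\}$ is an orthonormal basis of $V_0$. The Fourier transform is normalized by $\hat f(\xi)=\int_{\mathbb{R}}f(x)e^{-2\pi i x\xi}\,dx$ for $f\in L^1(\mathbb{R})\cap L^2(\mathbb{R})$ and extended to $L^2(\mathbb{R})$. For $h\in L^2(\mathbb{R})$, write $|\vec{\hat h}(\xi)|^2=\sum_{l\in\mathbb{Z}}|\hat h(\xi+l)|^2$, and $|\vec{\hat h}(\xi)|$ for its nonnegative square root. $\chi_S$ denotes the indicator function of $S$; $f$ is understood to be $0$ off $E$ and $g$ to be $0$ off $F$. *)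

theory Defs
  imports "HOL-Analysis.Analysis"
begin

section \<open>Square-integrable functions on the real line\<close>

text \<open>
  The Hilbert space $L^2$ is represented by Borel-measurable functions; its elements are the classes
  of these under almost-everywhere equality. Equality of elements is therefore written with
  \<open>AE x in lborel\<close>. A closed subspace in the sense of \<open>l2_closed_subspace\<close> is automatically saturated
  under almost-everywhere equality, so it corresponds to exactly one closed subspace of the quotient.
\<close>

definition L2 :: "(real \<Rightarrow> complex) set" where
  "L2 = {f \<in> borel_measurable lborel. integrable lborel (\<lambda>x. (cmod (f x))\<^sup>2)}"

definition l2_inner :: "(real \<Rightarrow> complex) \<Rightarrow> (real \<Rightarrow> complex) \<Rightarrow> complex" where
  "l2_inner f g = (LINT x|lborel. f x * cnj (g x))"

definition l2_norm :: "(real \<Rightarrow> complex) \<Rightarrow> real" where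
  "l2_norm f = sqrt (LINT x|lborel. (cmod (f x))\<^sup>2)"

text \<open>
  Membership in \<open>L2\<close> is part of convergence: the Bochner integral in \<open>l2_norm\<close> is \<open>0\<close> on functions
  that are not square integrable.
\<close>

definition l2_tendsto :: "(nat \<Rightarrow> real \<Rightarrow> complex) \<Rightarrow> (real \<Rightarrow> complex) \<Rightarrow> bool" where
  "l2_tendsto X f \<longleftrightarrow>
     (\<forall>n. X n \<in> L2) \<and> f \<in> L2 \<and> (\<lambda>n. l2_norm (\<lambda>x. X n x - f x)) \<longlonglongrightarrow> 0"

definition l2_closed_subspace :: "(real \<Rightarrow> complex) set \<Rightarrow> bool" where
  "l2_closed_subspace S \<longleftrightarrow>
     S \<subseteq> L2 \<and> (\<lambda>x. 0) \<in> S \<and>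
     (\<forall>f\<in>S. \<forall>g\<in>S. (\<lambda>x. f x + g x) \<in> S) \<and>
     (\<forall>c. \<forall>f\<in>S. (\<lambda>x. c * f x) \<in> S) \<and>
     (\<forall>X f. (\<forall>n. X n \<in> S) \<and> l2_tendsto X f \<longrightarrow> f \<in> S)"

definition l2_span :: "(real \<Rightarrow> complex) set \<Rightarrow> (real \<Rightarrow> complex) set" where
  "l2_span S = {\<lambda>x. \<Sum>i<n. c i * s i x | (n::nat) (c :: nat \<Rightarrow> complex) s. \<forall>i<n. s i \<in> S}"

definition l2_closed_span :: "(real \<Rightarrow> complex) set \<Rightarrow> (real \<Rightarrow> complex) set" where
  "l2_closed_span S = {f. \<exists>X. (\<forall>n. X n \<in> l2_span S) \<and> l2_tendsto X f}"

definition orthonormal_basis_of :: "('i \<Rightarrow> real \<Rightarrow> complex) \<Rightarrow> (real \<Rightarrow> complex) set \<Rightarrow> bool" where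
  "orthonormal_basis_of e S \<longleftrightarrow>
     (\<forall>i. e i \<in> S) \<and>
     (\<forall>i j. l2_inner (e i) (e j) = (if i = j then 1 else 0)) \<and>
     l2_closed_span (range e) = S"

definition orth_complement_in ::
  "(real \<Rightarrow> complex) set \<Rightarrow> (real \<Rightarrow> complex) set \<Rightarrow> (real \<Rightarrow> complex) set" where
  "orth_complement_in U S = {f \<in> U. \<forall>g\<in>S. l2_inner f g = 0}"

text \<open>The choice below is only that of a representative: the projection is unique almost everywhere.\<close>

definition orth_proj :: "(real \<Rightarrow> complex) set \<Rightarrow> (real \<Rightarrow> complex) \<Rightarrow> (real \<Rightarrow> complex)" where
  "orth_proj S h = (SOME p. p \<in> S \<and> (\<forall>w\<in>S. l2_inner (\<lambda>x. h x - p x) w = 0))"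


section \<open>Dilation and translation\<close>

definition dilation :: "(real \<Rightarrow> complex) \<Rightarrow> (real \<Rightarrow> complex)" where
  "dilation f = (\<lambda>x. complex_of_real (sqrt 2) * f (2 * x))"

definition translation :: "(real \<Rightarrow> complex) \<Rightarrow> (real \<Rightarrow> complex)" where
  "translation f = (\<lambda>x. f (x - 1))"

definition op_powi :: "('a \<Rightarrow> 'a) \<Rightarrow> int \<Rightarrow> 'a \<Rightarrow> 'a" where
  "op_powi A n = (if 0 \<le> n then A ^^ nat n else inv A ^^ nat (- n))"

lemma inv_dilation: "inv dilation = (\<lambda>f x. f (x / 2) / complex_of_real (sqrt 2))"
  by (rule inv_unique_comp) (auto simp: fun_eq_iff dilation_def simp flip: of_real_mult)

lemma inv_translation: "inv translation = (\<lambda>f x. f (x + 1))"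
  by (rule inv_unique_comp) (auto simp: fun_eq_iff translation_def)

lemma op_powi_translation: "op_powi translation l f = (\<lambda>x. f (x - of_int l))"
proof -
  have a: "(translation ^^ n) f = (\<lambda>x. f (x - of_nat n))" for n
    by (induction n) (auto simp: translation_def algebra_simps)
  have b: "(inv translation ^^ n) f = (\<lambda>x. f (x + of_nat n))" for n
    by (induction n) (auto simp: inv_translation algebra_simps)
  show ?thesis
    by (auto simp: op_powi_def a b)
qed

lemma op_powi_dilation:
  "op_powi dilation n f = (\<lambda>x. complex_of_real (sqrt 2 powi n) * f (2 powi n * x))"
proof -
  have a: "(dilation ^^ k) f = (\<lambda>x. complex_of_real (sqrt 2 ^ k) * f (2 ^ k * x))" for k
    by (induction k) (auto simp: dilation_def algebra_simps)
  have b: "(inv dilation ^^ k) f = (\<lambda>x. f (x / 2 ^ k) / complex_of_real (sqrt 2 ^ k))" for k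
    by (induction k) (auto simp: inv_dilation field_simps)
  show ?thesis
    by (auto simp: op_powi_def a b power_int_def field_simps)
qed


section \<open>Wavelets and multiresolution analyses\<close>

definition orthonormal_wavelet :: "(real \<Rightarrow> complex) \<Rightarrow> bool" where
  "orthonormal_wavelet \<psi> \<longleftrightarrow>
     \<psi> \<in> L2 \<and>
     orthonormal_basis_of (\<lambda>(n, l). op_powi dilation n (op_powi translation l \<psi>)) L2"

definition scaling_function :: "(int \<Rightarrow> (real \<Rightarrow> complex) set) \<Rightarrow> (real \<Rightarrow> complex) \<Rightarrow> bool" where
  "scaling_function V \<phi> \<longleftrightarrow>
     \<phi> \<in> V 0 \<and> orthonormal_basis_of (\<lambda>l. op_powi translation l \<phi>) (V 0)"

definition multiresolution_analysis :: "(int \<Rightarrow> (real \<Rightarrow> complex) set) \<Rightarrow> bool" where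
  "multiresolution_analysis V \<longleftrightarrow>
     (\<forall>j. l2_closed_subspace (V j)) \<and>
     (\<forall>j. V j \<subseteq> V (j + 1)) \<and>
     (\<forall>j. dilation ` V j = V (j + 1)) \<and>
     (\<Inter>j. V j) = {f \<in> L2. AE x in lborel. f x = 0} \<and>
     l2_closed_span (\<Union>j. V j) = L2 \<and>
     (\<exists>\<phi>. scaling_function V \<phi>)"


section \<open>The Fourier transform\<close>

definition fourier_L1 :: "(real \<Rightarrow> complex) \<Rightarrow> real \<Rightarrow> complex" where
  "fourier_L1 f \<xi> = (LINT x|lborel. f x * exp (- 2 * of_real pi * \<i> * of_real x * of_real \<xi>))"

text \<open>
  The extension by continuity of \<open>fourier_L1\<close> from the integrable functions in \<open>L2\<close> to all of \<open>L2\<close>.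
  As for \<open>orth_proj\<close>, the choice is only that of a representative.
\<close>

definition has_L2_fourier :: "(real \<Rightarrow> complex) \<Rightarrow> (real \<Rightarrow> complex) \<Rightarrow> bool" where
  "has_L2_fourier f F \<longleftrightarrow>
     F \<in> L2 \<and>
     (\<forall>X. (\<forall>n. integrable lborel (X n)) \<and> l2_tendsto X f \<longrightarrow>
        l2_tendsto (\<lambda>n. fourier_L1 (X n)) F)"

definition fourier :: "(real \<Rightarrow> complex) \<Rightarrow> (real \<Rightarrow> complex)" where
  "fourier f = (SOME F. has_L2_fourier f F)"

text \<open>
  The sum is taken in the extended nonnegative reals, as it may be infinite on a null set; there
  \<open>fourier_vec_norm\<close> is \<open>0\<close>, and a quotient by it is \<open>0\<close> as well.
\<close>

definition fourier_vec_norm_sq :: "(real \<Rightarrow> complex) \<Rightarrow> real \<Rightarrow> ennreal" where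
  "fourier_vec_norm_sq h \<xi> =
     (\<Sum>\<^sub>\<infinity>l\<in>(UNIV :: int set). ennreal ((cmod (fourier h (\<xi> + of_int l)))\<^sup>2))"

definition fourier_vec_norm :: "(real \<Rightarrow> complex) \<Rightarrow> real \<Rightarrow> real" where
  "fourier_vec_norm h \<xi> = sqrt (enn2real (fourier_vec_norm_sq h \<xi>))"

end

theory Submission
  imports Defs "HOL-Probability.Probability"
begin

text \<open>
  Write $[h,k](\xi) = \sum_l \hat h(\xi+l) \overline{\hat k(\xi+l)}$ and let $a = D\phi$, $b = DT\phi$.
  The integer translates of $a$ and $b$ form an orthonormal basis of $V_1$, so with the periodic functions
  $m_0 = [\phi,a]$ and $m_1 = [\phi,b]$ one has $\hat\phi = m_0 \hat a + m_1 \hat b$ and $|m_0|^2 + |m_1|^2 = 1$.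
  Projecting onto $W_0$ subtracts $\overline{m_0} \hat\phi$ and $\overline{m_1} \hat\phi$; hence
  $[\phi_0,\phi_0] = |m_1|^2$, $[\phi_1,\phi_1] = |m_0|^2$ and $m_0 \hat\phi_0 + m_1 \hat\phi_1 = 0$.
  So $E$ and $F$ are complementary up to a null set, on each of them $\hat\psi$ is the normalized generator,
  and the other generator is a periodic multiple of it. This gives $[\psi,\psi] = 1$, which is orthonormality of
  the translates of $\psi$, and shows that $h \in W_0$ with $[h,\psi] = 0$ vanishes. Dilating $W_0$
  exhausts $L^2$ because a function orthogonal to all dilates has the same projection onto every $V_j$,
  and $\bigcap_j V_j = 0$.
\<close>

section \<open>The Hilbert space of square-integrable functions\<close>

text \<open>The threshold 1/2 comes from |m0|^2 + |m1|^2 = 1: at almost every frequency one of the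
  two squared norms reaches it. Dividing by a norm whose square is at least 1/2 costs at most a
  factor sqrt 2, so the cutoffs are bounded periodic multipliers, which preserve closed
  translation-invariant subspaces. The strict inequality in F gives ties to E alone. Over a fixed
  frequency both residuals lie in the one-dimensional complement of the fiber of phi inside the span
  of the fibers of a and b; hence they are proportional and one generator suffices. Two obstacles
  shape the rest. A bracket is in general only an integrable periodic function, so deducing that it
  vanishes from vanishing inner products needs uniqueness of Fourier coefficients for integrable
  functions; this comes from Stone-Weierstrass on the circle. And \<open>fourier\<close> is
  determined only almost everywhere, while a bracket sees all integer translates of a frequency at
  once; identities are first made valid at all translates simultaneously and then become linear
  algebra in square summable sequences.\<close>

definition square_integrable :: "'a measure \<Rightarrow> ('a \<Rightarrow> complex) \<Rightarrow> bool" where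
  "square_integrable M f \<longleftrightarrow> f \<in> borel_measurable M \<and> integrable M (\<lambda>x. (cmod (f x))\<^sup>2)"

lemma L2_iff: "f \<in> L2 \<longleftrightarrow> square_integrable lborel f"
  by (simp add: L2_def square_integrable_def)

lemma borel_measurable_cnj [measurable]: "cnj \<in> borel_measurable borel"
  by (intro borel_measurable_continuous_onI continuous_intros)

lemma square_integrable_measurable [measurable_dest]:
  "square_integrable M f \<Longrightarrow> f \<in> borel_measurable M"
  by (simp add: square_integrable_def)

lemma square_integrable_dominated:
  assumes "f \<in> borel_measurable M" "integrable M h" "AE x in M. (cmod (f x))\<^sup>2 \<le> h x"
  shows "square_integrable M f"
  unfolding square_integrable_def
proof
  show "integrable M (\<lambda>x. (cmod (f x))\<^sup>2)"
    by (rule Bochner_Integration.integrable_bound[OF assms(2)]) (use assms in auto)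
qed fact

lemma cmod_add_sq_le: "(cmod (a + b))\<^sup>2 \<le> 2 * (cmod a)\<^sup>2 + 2 * (cmod b)\<^sup>2"
proof -
  have "(cmod (a + b))\<^sup>2 \<le> (cmod a + cmod b)\<^sup>2"
    by (intro power_mono norm_triangle_ineq) auto
  also have "\<dots> \<le> 2 * (cmod a)\<^sup>2 + 2 * (cmod b)\<^sup>2"
    using sum_squares_bound[of "cmod a" "cmod b"] by (simp add: power2_sum)
  finally show ?thesis .
qed

lemma square_integrable_add:
  assumes "square_integrable M f" "square_integrable M g"
  shows "square_integrable M (\<lambda>x. f x + g x)"
  by (rule square_integrable_dominated[where h="\<lambda>x. 2 * (cmod (f x))\<^sup>2 + 2 * (cmod (g x))\<^sup>2"])
     (use assms in \<open>auto simp: square_integrable_def cmod_add_sq_le\<close>)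

lemma square_integrable_cmult:
  assumes "square_integrable M f"
  shows "square_integrable M (\<lambda>x. c * f x)"
  using assms by (auto simp: square_integrable_def norm_mult power_mult_distrib)

lemma square_integrable_diff:
  assumes "square_integrable M f" "square_integrable M g"
  shows "square_integrable M (\<lambda>x. f x - g x)"
  using square_integrable_add[OF assms(1) square_integrable_cmult[OF assms(2), of "-1"]] by simp

lemma square_integrable_cnj:
  assumes "square_integrable M f"
  shows "square_integrable M (\<lambda>x. cnj (f x))"
  using assms by (auto simp: square_integrable_def)

lemma square_integrable_bounded_mult:
  assumes f: "square_integrable M f" and c[measurable]: "c \<in> borel_measurable M"
    and b: "\<And>x. cmod (c x) \<le> B"
  shows "square_integrable M (\<lambda>x. c x * f x)"
proof (rule square_integrable_dominated)
  show "(\<lambda>x. c x * f x) \<in> borel_measurable M" using f by measurable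
  show "integrable M (\<lambda>x. B\<^sup>2 * (cmod (f x))\<^sup>2)" using f by (simp add: square_integrable_def)
  show "AE x in M. (cmod (c x * f x))\<^sup>2 \<le> B\<^sup>2 * (cmod (f x))\<^sup>2"
    by (intro AE_I2) (simp add: norm_mult power_mult_distrib b mult_right_mono power_mono)
qed

lemma square_integrable_mult_cnj:
  assumes "square_integrable M f" "square_integrable M g"
  shows "integrable M (\<lambda>x. f x * cnj (g x))"
proof (rule Bochner_Integration.integrable_bound)
  show "integrable M (\<lambda>x. (cmod (f x))\<^sup>2 + (cmod (g x))\<^sup>2)"
    using assms by (simp add: square_integrable_def)
  show "(\<lambda>x. f x * cnj (g x)) \<in> borel_measurable M" using assms by measurable
  have "cmod (f x) * cmod (g x) \<le> (cmod (f x))\<^sup>2 + (cmod (g x))\<^sup>2" for x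
  proof -
    have "0 \<le> cmod (f x) * cmod (g x)" by simp
    with sum_squares_bound[of "cmod (f x)" "cmod (g x)"] show ?thesis
      unfolding mult.assoc by linarith
  qed
  then show "AE x in M. norm (f x * cnj (g x)) \<le> norm ((cmod (f x))\<^sup>2 + (cmod (g x))\<^sup>2)"
    by (intro AE_I2) (simp add: norm_mult)
qed

text \<open>An arbitrary measure is allowed because the inequality is used twice: for Lebesgue
  measure on the line and for counting measure on the integers, where the fibers live.\<close>

lemma square_integrable_Cauchy_Schwarz:
  assumes f: "square_integrable M f" and g: "square_integrable M g"
  shows "(cmod (LINT x|M. f x * cnj (g x)))\<^sup>2 \<le> (LINT x|M. (cmod (f x))\<^sup>2) * (LINT x|M. (cmod (g x))\<^sup>2)"
proof -
  have [measurable]: "f \<in> borel_measurable M" "g \<in> borel_measurable M" using f g by measurable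
  have "ennreal (cmod (LINT x|M. f x * cnj (g x))) \<le> (\<integral>\<^sup>+x. norm (f x * cnj (g x)) \<partial>M)"
    by (rule integral_norm_bound_ennreal) (rule square_integrable_mult_cnj[OF f g])
  also have "\<dots> = (\<integral>\<^sup>+x. ennreal (cmod (f x)) * ennreal (cmod (g x)) \<partial>M)"
    by (simp add: norm_mult ennreal_mult)
  finally have "(ennreal (cmod (LINT x|M. f x * cnj (g x))))\<^sup>2 \<le> \<dots>\<^sup>2"
    by (rule power_mono) simp
  also have "\<dots> \<le> (\<integral>\<^sup>+x. ennreal (cmod (f x)) ^ 2 \<partial>M) * (\<integral>\<^sup>+x. ennreal (cmod (g x)) ^ 2 \<partial>M)"
    by (rule Cauchy_Schwarz_nn_integral) auto
  also have "\<dots> = ennreal (LINT x|M. (cmod (f x))\<^sup>2) * ennreal (LINT x|M. (cmod (g x))\<^sup>2)"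
    using f g by (simp add: ennreal_power nn_integral_eq_integral square_integrable_def)
  finally show ?thesis
    by (simp add: ennreal_power flip: ennreal_mult)
qed

section \<open>The space \<open>L2\<close>: inner product, norm and convergence\<close>

abbreviation (input) l2_dist :: "(real \<Rightarrow> complex) \<Rightarrow> (real \<Rightarrow> complex) \<Rightarrow> real" where
  "l2_dist f g \<equiv> l2_norm (\<lambda>x. f x - g x)"

lemma L2_measurable [measurable_dest]: "f \<in> L2 \<Longrightarrow> f \<in> borel_measurable lborel"
  by (simp add: L2_def)

lemma L2_zero [simp]: "(\<lambda>x. 0) \<in> L2"
  by (simp add: L2_def)

lemma L2_add: "f \<in> L2 \<Longrightarrow> g \<in> L2 \<Longrightarrow> (\<lambda>x. f x + g x) \<in> L2"
  and L2_diff: "f \<in> L2 \<Longrightarrow> g \<in> L2 \<Longrightarrow> (\<lambda>x. f x - g x) \<in> L2"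
  and L2_cmult: "f \<in> L2 \<Longrightarrow> (\<lambda>x. c * f x) \<in> L2"
  and L2_cnj: "f \<in> L2 \<Longrightarrow> (\<lambda>x. cnj (f x)) \<in> L2"
  by (simp_all add: L2_iff square_integrable_add square_integrable_diff square_integrable_cmult
      square_integrable_cnj)

lemma L2_mult_cnj: "f \<in> L2 \<Longrightarrow> g \<in> L2 \<Longrightarrow> integrable lborel (\<lambda>x. f x * cnj (g x))"
  by (simp add: L2_iff square_integrable_mult_cnj)

lemma L2_bounded_mult:
  "f \<in> L2 \<Longrightarrow> c \<in> borel_measurable lborel \<Longrightarrow> (\<And>x. cmod (c x) \<le> B) \<Longrightarrow> (\<lambda>x. c x * f x) \<in> L2"
  unfolding L2_iff by (rule square_integrable_bounded_mult)

lemma L2_cong_AE: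
  assumes "f \<in> L2" "g \<in> borel_measurable lborel" "AE x in lborel. f x = g x"
  shows "g \<in> L2"
proof -
  have "AE x in lborel. (cmod (f x))\<^sup>2 = (cmod (g x))\<^sup>2"
    using assms(3) by eventually_elim simp
  then show ?thesis
    using assms integrable_cong_AE[of "\<lambda>x. (cmod (f x))\<^sup>2" lborel "\<lambda>x. (cmod (g x))\<^sup>2"]
    by (auto simp: L2_def)
qed

lemma l2_inner_add_left:
  "f \<in> L2 \<Longrightarrow> g \<in> L2 \<Longrightarrow> h \<in> L2 \<Longrightarrow> l2_inner (\<lambda>x. f x + g x) h = l2_inner f h + l2_inner g h"
  by (simp add: l2_inner_def L2_mult_cnj distrib_right)

lemma l2_inner_add_right:
  "f \<in> L2 \<Longrightarrow> g \<in> L2 \<Longrightarrow> h \<in> L2 \<Longrightarrow> l2_inner h (\<lambda>x. f x + g x) = l2_inner h f + l2_inner h g"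
  by (simp add: l2_inner_def L2_mult_cnj distrib_left)

lemma l2_inner_diff_left:
  "f \<in> L2 \<Longrightarrow> g \<in> L2 \<Longrightarrow> h \<in> L2 \<Longrightarrow> l2_inner (\<lambda>x. f x - g x) h = l2_inner f h - l2_inner g h"
  by (simp add: l2_inner_def L2_mult_cnj left_diff_distrib)

lemma l2_inner_diff_right:
  "f \<in> L2 \<Longrightarrow> g \<in> L2 \<Longrightarrow> h \<in> L2 \<Longrightarrow> l2_inner h (\<lambda>x. f x - g x) = l2_inner h f - l2_inner h g"
  by (simp add: l2_inner_def L2_mult_cnj right_diff_distrib)

lemma l2_inner_cmult_left: "l2_inner (\<lambda>x. c * f x) g = c * l2_inner f g"
  by (simp add: l2_inner_def mult.assoc)

lemma l2_inner_cmult_right: "l2_inner f (\<lambda>x. c * g x) = cnj c * l2_inner f g"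
  by (simp add: l2_inner_def mult.left_commute)

lemma l2_inner_cnj: "cnj (l2_inner f g) = l2_inner g f"
  by (simp add: l2_inner_def mult.commute flip: Bochner_Integration.integral_cnj)

lemma l2_inner_zero_right [simp]: "l2_inner f (\<lambda>x. 0) = 0"
  by (simp add: l2_inner_def)

lemma l2_inner_eq_0_sym: "l2_inner f g = 0 \<Longrightarrow> l2_inner g f = 0"
  by (metis l2_inner_cnj complex_cnj_zero)

lemma l2_norm_nonneg [simp]: "0 \<le> l2_norm f"
  by (simp add: l2_norm_def)

lemma l2_norm_sq: "(l2_norm f)\<^sup>2 = (LINT x|lborel. (cmod (f x))\<^sup>2)"
  by (simp add: l2_norm_def)

lemma l2_inner_self: "l2_inner f f = complex_of_real ((l2_norm f)\<^sup>2)"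
  by (simp add: l2_inner_def l2_norm_sq complex_norm_square[symmetric] del: of_real_power)

lemma l2_inner_cong_AE:
  assumes "f \<in> borel_measurable lborel" "f' \<in> borel_measurable lborel"
    "g \<in> borel_measurable lborel" "g' \<in> borel_measurable lborel"
    "AE x in lborel. f x = f' x" "AE x in lborel. g x = g' x"
  shows "l2_inner f g = l2_inner f' g'"
  unfolding l2_inner_def by (rule integral_cong_AE) (use assms in \<open>measurable; auto\<close>)+

lemma l2_norm_cong_AE:
  assumes "f \<in> borel_measurable lborel" "f' \<in> borel_measurable lborel"
    "AE x in lborel. f x = f' x"
  shows "l2_norm f = l2_norm f'"
proof -
  have "(LINT x|lborel. (cmod (f x))\<^sup>2) = (LINT x|lborel. (cmod (f' x))\<^sup>2)"
    by (rule integral_cong_AE) (use assms in auto)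
  then show ?thesis by (simp add: l2_norm_def)
qed

lemma l2_norm_eq_0_iff:
  assumes "f \<in> L2"
  shows "l2_norm f = 0 \<longleftrightarrow> (AE x in lborel. f x = 0)"
  using integral_nonneg_eq_0_iff_AE[of lborel "\<lambda>x. (cmod (f x))\<^sup>2"] assms
  by (simp add: l2_norm_def L2_def)

lemma l2_Cauchy_Schwarz:
  assumes "f \<in> L2" "g \<in> L2"
  shows "cmod (l2_inner f g) \<le> l2_norm f * l2_norm g"
proof -
  have "(cmod (l2_inner f g))\<^sup>2 \<le> (l2_norm f * l2_norm g)\<^sup>2"
    using square_integrable_Cauchy_Schwarz[of lborel f g] assms
    by (simp add: L2_iff l2_inner_def power_mult_distrib l2_norm_sq)
  then show ?thesis
    by (rule power2_le_imp_le) simp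
qed

lemma l2_norm_cmult: "l2_norm (\<lambda>x. c * f x) = cmod c * l2_norm f"
  by (simp add: l2_norm_def norm_mult power_mult_distrib real_sqrt_mult)

lemma l2_norm_minus_commute: "l2_dist f g = l2_dist g f"
  by (simp add: l2_norm_def norm_minus_commute)

lemma l2_norm_cnj: "l2_norm (\<lambda>x. cnj (f x)) = l2_norm f"
  by (simp add: l2_norm_def)

lemma l2_norm_sq_add:
  assumes "f \<in> L2" "g \<in> L2"
  shows "(l2_norm (\<lambda>x. f x + g x))\<^sup>2 = (l2_norm f)\<^sup>2 + (l2_norm g)\<^sup>2 + 2 * Re (l2_inner f g)"
proof -
  have "complex_of_real ((l2_norm (\<lambda>x. f x + g x))\<^sup>2)
      = l2_inner f f + l2_inner g g + (l2_inner f g + cnj (l2_inner f g))"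
    using assms by (simp add: l2_inner_add_left l2_inner_add_right L2_add l2_inner_cnj
        l2_inner_self[symmetric] del: of_real_power)
  from arg_cong[OF this, of Re] show ?thesis
    by (simp add: l2_inner_self del: of_real_power)
qed

lemma l2_norm_sq_diff:
  assumes "f \<in> L2" "g \<in> L2"
  shows "(l2_dist f g)\<^sup>2 = (l2_norm f)\<^sup>2 + (l2_norm g)\<^sup>2 - 2 * Re (l2_inner f g)"
  using l2_norm_sq_add[OF assms(1) L2_cmult[OF assms(2)], of "-1"]
  by (simp only: l2_norm_cmult l2_inner_cmult_right) simp

lemma l2_norm_triangle:
  assumes "f \<in> L2" "g \<in> L2"
  shows "l2_norm (\<lambda>x. f x + g x) \<le> l2_norm f + l2_norm g"
proof (rule power2_le_imp_le)
  have "Re (l2_inner f g) \<le> l2_norm f * l2_norm g"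
    using complex_Re_le_cmod l2_Cauchy_Schwarz[OF assms] order_trans by blast
  then show "(l2_norm (\<lambda>x. f x + g x))\<^sup>2 \<le> (l2_norm f + l2_norm g)\<^sup>2"
    by (simp add: l2_norm_sq_add[OF assms] power2_sum)
qed simp

lemma l2_norm_triangle_diff:
  assumes "f \<in> L2" "g \<in> L2" "h \<in> L2"
  shows "l2_dist f h \<le> l2_dist f g + l2_dist g h"
  using l2_norm_triangle[OF L2_diff[OF assms(1,2)] L2_diff[OF assms(2,3)]] by simp

lemma l2_norm_minus_le:
  assumes "f \<in> L2" "g \<in> L2"
  shows "l2_norm f - l2_norm g \<le> l2_dist f g"
  using l2_norm_triangle[OF L2_diff[OF assms] assms(2)] by simp

lemma l2_tendsto_norm:
  assumes "l2_tendsto X f"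
  shows "(\<lambda>n. l2_norm (X n)) \<longlonglongrightarrow> l2_norm f"
proof (rule LIMSEQ_I)
  fix r :: real assume "0 < r"
  have L: "X n \<in> L2" "f \<in> L2" for n
    using assms by (auto simp: l2_tendsto_def)
  have "(\<lambda>n. l2_dist (X n) f) \<longlonglongrightarrow> 0"
    using assms by (auto simp: l2_tendsto_def)
  from LIMSEQ_D[OF this \<open>0 < r\<close>] obtain N where N: "\<And>n. n \<ge> N \<Longrightarrow> l2_dist (X n) f < r"
    by auto
  have "norm (l2_norm (X n) - l2_norm f) < r" if "n \<ge> N" for n
    using N[OF that] l2_norm_minus_le[OF L(1) L(2), of n] l2_norm_minus_le[OF L(2) L(1), of n]
      l2_norm_minus_commute[of f "X n"] by (simp add: abs_if)
  then show "\<exists>N. \<forall>n\<ge>N. norm (l2_norm (X n) - l2_norm f) < r" by blast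
qed

lemma l2_tendsto_inner:
  assumes X: "l2_tendsto X f" and Y: "l2_tendsto Y g"
  shows "(\<lambda>n. l2_inner (X n) (Y n)) \<longlonglongrightarrow> l2_inner f g"
proof -
  have L[simp]: "X n \<in> L2" "f \<in> L2" "Y n \<in> L2" "g \<in> L2" for n
    using X Y by (auto simp: l2_tendsto_def)
  have l: "(\<lambda>n. l2_dist (X n) f) \<longlonglongrightarrow> 0" "(\<lambda>n. l2_dist (Y n) g) \<longlonglongrightarrow> 0"
    using X Y by (auto simp: l2_tendsto_def)
  have "norm (l2_inner (X n) (Y n) - l2_inner f g)
      \<le> l2_dist (X n) f * l2_norm (Y n) + l2_norm f * l2_dist (Y n) g" for n
  proof -
    have "l2_inner (X n) (Y n) - l2_inner f g
      = l2_inner (\<lambda>x. X n x - f x) (Y n) + l2_inner f (\<lambda>x. Y n x - g x)"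
      by (simp add: l2_inner_diff_left l2_inner_diff_right)
    also have "norm \<dots> \<le> cmod (l2_inner (\<lambda>x. X n x - f x) (Y n)) + cmod (l2_inner f (\<lambda>x. Y n x - g x))"
      by (rule norm_triangle_ineq)
    also have "\<dots> \<le> l2_dist (X n) f * l2_norm (Y n) + l2_norm f * l2_dist (Y n) g"
      by (intro add_mono l2_Cauchy_Schwarz L2_diff) simp_all
    finally show ?thesis .
  qed
  moreover have "(\<lambda>n. l2_dist (X n) f * l2_norm (Y n) + l2_norm f * l2_dist (Y n) g)
      \<longlonglongrightarrow> 0 * l2_norm g + l2_norm f * 0"
    by (intro tendsto_intros l l2_tendsto_norm[OF Y])
  ultimately have "(\<lambda>n. l2_inner (X n) (Y n) - l2_inner f g) \<longlonglongrightarrow> 0"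
    by (auto intro: Lim_null_comparison[rotated])
  then show ?thesis by (simp add: LIM_zero_iff)
qed

lemma l2_tendsto_const: "f \<in> L2 \<Longrightarrow> l2_tendsto (\<lambda>_. f) f"
  by (simp add: l2_tendsto_def l2_norm_def)

lemma l2_tendsto_add:
  assumes "l2_tendsto X f" "l2_tendsto Y g"
  shows "l2_tendsto (\<lambda>n x. X n x + Y n x) (\<lambda>x. f x + g x)"
  unfolding l2_tendsto_def
proof (intro conjI allI)
  have L: "X n \<in> L2" "f \<in> L2" "Y n \<in> L2" "g \<in> L2" for n
    using assms by (auto simp: l2_tendsto_def)
  show "(\<lambda>x. X n x + Y n x) \<in> L2" for n using L by (simp add: L2_add)
  show "(\<lambda>x. f x + g x) \<in> L2" using L by (simp add: L2_add)
  have "(\<lambda>n. l2_dist (X n) f + l2_dist (Y n) g) \<longlonglongrightarrow> 0 + 0"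
    using assms by (intro tendsto_add) (auto simp: l2_tendsto_def)
  moreover have "l2_norm (\<lambda>x. X n x + Y n x - (f x + g x))
      \<le> l2_dist (X n) f + l2_dist (Y n) g" for n
    using l2_norm_triangle[OF L2_diff[OF L(1) L(2)] L2_diff[OF L(3) L(4)], of n n]
    by (simp add: algebra_simps)
  ultimately show "(\<lambda>n. l2_norm (\<lambda>x. X n x + Y n x - (f x + g x))) \<longlonglongrightarrow> 0"
    by (auto intro: Lim_null_comparison[rotated])
qed

lemma l2_tendsto_cmult:
  assumes "l2_tendsto X f"
  shows "l2_tendsto (\<lambda>n x. c * X n x) (\<lambda>x. c * f x)"
proof -
  have "(\<lambda>n. cmod c * l2_dist (X n) f) \<longlonglongrightarrow> cmod c * 0"
    using assms by (intro tendsto_mult_left) (auto simp: l2_tendsto_def)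
  then show ?thesis
    using assms by (simp add: l2_tendsto_def L2_cmult l2_norm_cmult flip: right_diff_distrib)
qed

lemma l2_tendsto_unique:
  assumes "l2_tendsto X f" "l2_tendsto X g"
  shows "AE x in lborel. f x = g x"
proof -
  have L: "f \<in> L2" "g \<in> L2" using assms by (auto simp: l2_tendsto_def)
  \<comment> \<open>This sequence is identically zero, so the norm of its limit \<open>f - g\<close>
    is a limit of zeros.\<close>
  have "l2_tendsto (\<lambda>n x. X n x + (-1) * X n x) (\<lambda>x. f x + (-1) * g x)"
    by (intro l2_tendsto_add l2_tendsto_cmult assms)
  then have "l2_norm (\<lambda>x. f x + (-1) * g x) = 0"
    using l2_tendsto_norm LIMSEQ_unique[OF _ tendsto_const[of 0]] by (fastforce simp: l2_norm_def)
  then show ?thesis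
    using L by (simp add: l2_norm_eq_0_iff L2_diff)
qed

section \<open>Completeness\<close>

text \<open>Fatou's lemma for the squared moduli. A bound that holds from some index on is enough,
  since only a lower limit is involved; in the completeness proof it comes from the Cauchy
  condition.\<close>

lemma L2_Fatou:
  assumes Y: "\<And>k. Y k \<in> L2" and lim: "AE x in lborel. (\<lambda>k. Y k x) \<longlonglongrightarrow> g x"
    and [measurable]: "g \<in> borel_measurable lborel" and b: "\<And>k. k \<ge> N \<Longrightarrow> l2_norm (Y k) \<le> e"
    and e: "0 \<le> e"
  shows "g \<in> L2" and "l2_norm g \<le> e"
proof -
  have [measurable]: "Y k \<in> borel_measurable lborel" for k using Y by measurable
  have "(\<integral>\<^sup>+x. ennreal ((cmod (g x))\<^sup>2) \<partial>lborel) = (\<integral>\<^sup>+x. liminf (\<lambda>k. ennreal ((cmod (Y k x))\<^sup>2)) \<partial>lborel)"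
  proof (rule nn_integral_cong_AE, use lim in eventually_elim)
    fix x assume "(\<lambda>k. Y k x) \<longlonglongrightarrow> g x"
    then have "(\<lambda>k. ennreal ((cmod (Y k x))\<^sup>2)) \<longlonglongrightarrow> ennreal ((cmod (g x))\<^sup>2)"
      by (intro tendsto_ennrealI tendsto_intros)
    then show "ennreal ((cmod (g x))\<^sup>2) = liminf (\<lambda>k. ennreal ((cmod (Y k x))\<^sup>2))"
      by (intro lim_imp_Liminf[symmetric]) auto
  qed
  also have "\<dots> \<le> liminf (\<lambda>k. \<integral>\<^sup>+x. ennreal ((cmod (Y k x))\<^sup>2) \<partial>lborel)"
    by (rule nn_integral_liminf) simp
  also have "\<dots> \<le> liminf (\<lambda>k. ennreal (e\<^sup>2))"
  proof (rule Liminf_mono)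
    show "\<forall>\<^sub>F k in sequentially. (\<integral>\<^sup>+x. ennreal ((cmod (Y k x))\<^sup>2) \<partial>lborel) \<le> ennreal (e\<^sup>2)"
      unfolding eventually_sequentially
    proof (intro exI[of _ N] allI impI)
      fix k assume "k \<ge> N"
      from b[OF this] have "(l2_norm (Y k))\<^sup>2 \<le> e\<^sup>2" by (intro power_mono) auto
      then show "(\<integral>\<^sup>+x. ennreal ((cmod (Y k x))\<^sup>2) \<partial>lborel) \<le> ennreal (e\<^sup>2)"
        using Y[of k] by (subst nn_integral_eq_integral) (auto simp: L2_def l2_norm_sq)
    qed
  qed
  also have "\<dots> = ennreal (e\<^sup>2)" by (simp add: Liminf_const)
  finally have *: "(\<integral>\<^sup>+x. ennreal ((cmod (g x))\<^sup>2) \<partial>lborel) \<le> ennreal (e\<^sup>2)" .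
  then have int: "integrable lborel (\<lambda>x. (cmod (g x))\<^sup>2)"
    by (intro integrableI_bounded) (auto intro: le_less_trans)
  then show "g \<in> L2" by (simp add: L2_def)
  from * int have "(l2_norm g)\<^sup>2 \<le> e\<^sup>2"
    by (simp add: nn_integral_eq_integral l2_norm_sq)
  then show "l2_norm g \<le> e" using e by (rule power2_le_imp_le)
qed

text \<open>The weights \<open>4 ^ k\<close> turn square summability of the increments of a rapidly converging
  subsequence into absolute summability.\<close>
theorem L2_complete:
  assumes X: "\<And>n. X n \<in> L2"
    and cauchy: "\<And>e. e > 0 \<Longrightarrow> \<exists>N. \<forall>m\<ge>N. \<forall>n\<ge>N. l2_dist (X m) (X n) < e"
  shows "\<exists>f. l2_tendsto X f"
proof -
  have [measurable]: "X n \<in> borel_measurable lborel" for n using X by measurable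
  have "\<forall>k. \<exists>N. \<forall>m\<ge>N. \<forall>n\<ge>N. l2_dist (X m) (X n) < (1/4)^k"
    using cauchy by simp
  then obtain R where R: "\<And>k m n. m \<ge> R k \<Longrightarrow> n \<ge> R k \<Longrightarrow> l2_dist (X m) (X n) < (1/4)^k"
    by metis
  \<comment> \<open>The summand \<open>k\<close> forces the indices to infinity. The partial sums of
    \<open>R\<close> dominate \<open>R k\<close> at both \<open>r k\<close> and
    \<open>r (Suc k)\<close>, so the increment \<open>d k\<close> has norm below
    \<open>(1/4)^k\<close>.\<close>
  define r where "r k = k + (\<Sum>i\<le>k. R i)" for k
  have r_ge: "r k \<ge> k" and rR: "r k \<ge> R k" and rS: "r (Suc k) \<ge> R k" for k
    using member_le_sum[of k "{..k}" R] by (auto simp: r_def)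
  define d where "d k x = X (r (Suc k)) x - X (r k) x" for k x
  have d_L2: "d k \<in> L2" for k unfolding d_def[abs_def] by (intro L2_diff X)
  have [measurable]: "d k \<in> borel_measurable lborel" for k using d_L2 by measurable
  have dn: "(\<integral>\<^sup>+x. ennreal ((cmod (d k x))\<^sup>2) \<partial>lborel) \<le> ennreal ((1/16)^k)" for k
  proof -
    have "l2_norm (d k) \<le> (1/4)^k"
      using R[OF rS rR] by (simp add: d_def[abs_def] less_imp_le)
    then have "(l2_norm (d k))\<^sup>2 \<le> ((1/4)^k)\<^sup>2" by (intro power_mono) auto
    also have "\<dots> = (1/16)^k" by (simp add: power2_eq_square flip: power_mult_distrib)
    finally show ?thesis
      using d_L2[of k] by (subst nn_integral_eq_integral) (auto simp: L2_def l2_norm_sq)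
  qed
  have "(\<integral>\<^sup>+x. (\<Sum>k. ennreal (4^k * (cmod (d k x))\<^sup>2)) \<partial>lborel)
      = (\<Sum>k. \<integral>\<^sup>+x. ennreal (4^k * (cmod (d k x))\<^sup>2) \<partial>lborel)"
    by (rule nn_integral_suminf) simp
  also have "\<dots> = (\<Sum>k. ennreal (4^k) * (\<integral>\<^sup>+x. ennreal ((cmod (d k x))\<^sup>2) \<partial>lborel))"
    by (simp add: ennreal_mult nn_integral_cmult)
  also have "\<dots> \<le> (\<Sum>k. ennreal ((1/4)^k))"
  proof (rule suminf_le)
    fix k :: nat
    have "ennreal (4^k) * (\<integral>\<^sup>+x. ennreal ((cmod (d k x))\<^sup>2) \<partial>lborel) \<le> ennreal (4^k) * ennreal ((1/16)^k)"
      by (intro mult_left_mono dn) simp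
    also have "\<dots> = ennreal ((1/4)^k)"
      by (simp add: flip: ennreal_mult power_mult_distrib)
    finally show "ennreal (4^k) * (\<integral>\<^sup>+x. ennreal ((cmod (d k x))\<^sup>2) \<partial>lborel) \<le> ennreal ((1/4)^k)" .
  qed auto
  also have "\<dots> < top"
    by (subst suminf_ennreal_eq[OF _ geometric_sums]) auto
  finally have "AE x in lborel. (\<Sum>k. ennreal (4^k * (cmod (d k x))\<^sup>2)) \<noteq> \<infinity>"
    by (intro nn_integral_PInf_AE) auto
  then have conv: "AE x in lborel. convergent (\<lambda>k. X (r k) x)"
  proof eventually_elim
    fix x assume fin: "(\<Sum>k. ennreal (4^k * (cmod (d k x))\<^sup>2)) \<noteq> \<infinity>"
    define C where "C = enn2real (\<Sum>k. ennreal (4^k * (cmod (d k x))\<^sup>2))"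
    have C: "(\<Sum>k. ennreal (4^k * (cmod (d k x))\<^sup>2)) = ennreal C" "C \<ge> 0"
      using fin by (auto simp: C_def ennreal_enn2real_if)
    define F where "F k = 4^k * (cmod (d k x))\<^sup>2" for k
    \<comment> \<open>A single term of the weighted series is at most its sum \<open>C\<close>;
      taking square roots of \<open>4^k * (cmod (d k x))\<^sup>2 \<le> C\<close> leaves a geometric
      majorant.\<close>
    have "cmod (d k x) \<le> sqrt C * (1/2)^k" for k
    proof -
      have "(\<Sum>i\<in>{k}. ennreal (F i)) \<le> (\<Sum>i. ennreal (F i))"
        by (rule sum_le_suminf) auto
      also have "\<dots> = ennreal C" using C(1) unfolding F_def by blast
      finally have "F k \<le> C" using C(2) by simp
      moreover have "(4::real)^k = (2^k)\<^sup>2" by (simp add: power2_eq_square flip: power_mult_distrib)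
      then have "F k = (2^k * cmod (d k x))\<^sup>2" by (simp only: F_def power_mult_distrib)
      ultimately have "2^k * cmod (d k x) \<le> sqrt C" by (intro real_le_rsqrt) simp
      then show ?thesis
        by (simp only: power_one_over times_divide_eq_right mult_1_right) (simp add: pos_le_divide_eq mult.commute)
    qed
    moreover have "summable (\<lambda>k. sqrt C * (1/2)^k)"
      by (intro summable_mult summable_geometric) simp
    ultimately have "summable (\<lambda>k. d k x)"
      by (intro summable_comparison_test'[of "\<lambda>k. sqrt C * (1/2)^k" 0 "\<lambda>k. d k x"])
    then have "convergent (\<lambda>n. \<Sum>k<n. d k x)"
      by (simp add: summable_iff_convergent)
    moreover have "(\<Sum>k<n. d k x) = X (r n) x - X (r 0) x" for n
      unfolding d_def by (rule sum_lessThan_telescope)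
    ultimately have "convergent (\<lambda>n. X (r n) x - X (r 0) x)" by simp
    from convergent_add[OF this convergent_const[of "X (r 0) x"]]
    show "convergent (\<lambda>n. X (r n) x)" by simp
  qed
  define f where "f x = lim (\<lambda>k. X (r k) x)" for x
  have [measurable]: "f \<in> borel_measurable lborel" unfolding f_def by measurable
  have lim: "AE x in lborel. (\<lambda>k. X (r k) x) \<longlonglongrightarrow> f x"
    using conv by eventually_elim (simp add: f_def convergent_LIMSEQ_iff)
  \<comment> \<open>With \<open>n\<close> fixed, Fatou along the subsequence \<open>r k\<close>
    turns the Cauchy bound into a bound on the distance to \<open>f\<close>. Thus the whole sequence
    converges, and \<open>f\<close> is square integrable because one difference
    \<open>X n - f\<close> is.\<close>
  have close: "(\<lambda>x. X n x - f x) \<in> L2 \<and> l2_dist (X n) f \<le> e"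
    if "e > 0" and N: "\<forall>m\<ge>N. \<forall>n\<ge>N. l2_dist (X m) (X n) < e" and "n \<ge> N" for e N n
  proof -
    have Y: "(\<lambda>x. X n x - X (r k) x) \<in> L2" for k by (intro L2_diff X)
    have l: "AE x in lborel. (\<lambda>k. X n x - X (r k) x) \<longlonglongrightarrow> X n x - f x"
      using lim by eventually_elim (intro tendsto_intros)
    have b: "l2_norm (\<lambda>x. X n x - X (r k) x) \<le> e" if "k \<ge> N" for k
      using N \<open>n \<ge> N\<close> that r_ge[of k] by (simp add: less_imp_le)
    show ?thesis
      using L2_Fatou[OF Y l _ b] \<open>e > 0\<close> by auto
  qed
  have "f \<in> L2"
  proof -
    obtain N where "\<forall>m\<ge>N. \<forall>n\<ge>N. l2_dist (X m) (X n) < 1" using cauchy[of 1] by auto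
    then have "(\<lambda>x. X N x - f x) \<in> L2" using close[of 1 N N] by auto
    from L2_diff[OF X this, of N] show ?thesis by simp
  qed
  moreover have "(\<lambda>n. l2_dist (X n) f) \<longlonglongrightarrow> 0"
  proof (rule LIMSEQ_I)
    fix e :: real assume "0 < e"
    then obtain N where "\<forall>m\<ge>N. \<forall>n\<ge>N. l2_dist (X m) (X n) < e/2" using cauchy[of "e/2"] by auto
    then have le: "l2_dist (X n) f \<le> e/2" if "n \<ge> N" for n
      using close[of "e/2" N n] that \<open>0 < e\<close> by auto
    have "norm (l2_dist (X n) f - 0) < e" if "n \<ge> N" for n
      using le[OF that] \<open>0 < e\<close> by simp
    then show "\<exists>N. \<forall>n\<ge>N. norm (l2_dist (X n) f - 0) < e"
      by blast
  qed
  ultimately show ?thesis using X by (auto simp: l2_tendsto_def)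
qed

section \<open>Closed subspaces and orthogonal projection\<close>

lemma l2_tendstoD:
  assumes "l2_tendsto X f" "0 < e"
  obtains N where "\<And>n. n \<ge> N \<Longrightarrow> l2_dist (X n) f < e"
proof -
  have "(\<lambda>n. l2_dist (X n) f) \<longlonglongrightarrow> 0" using assms by (simp add: l2_tendsto_def)
  from LIMSEQ_D[OF this assms(2)] show ?thesis using that by auto
qed

lemma l2_closed_subspaceD:
  assumes "l2_closed_subspace S"
  shows "f \<in> S \<Longrightarrow> f \<in> L2" "(\<lambda>x. 0) \<in> S" "f \<in> S \<Longrightarrow> g \<in> S \<Longrightarrow> (\<lambda>x. f x + g x) \<in> S"
    "f \<in> S \<Longrightarrow> (\<lambda>x. c * f x) \<in> S" "(\<And>n. X n \<in> S) \<Longrightarrow> l2_tendsto X f \<Longrightarrow> f \<in> S"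
  using assms unfolding l2_closed_subspace_def by (auto, blast)

lemma l2_closed_subspace_diff:
  assumes "l2_closed_subspace S" "f \<in> S" "g \<in> S"
  shows "(\<lambda>x. f x - g x) \<in> S"
  using l2_closed_subspaceD(3)[OF assms(1,2) l2_closed_subspaceD(4)[OF assms(1,3), of "-1"]] by simp

lemma l2_tendsto_AE_const:
  assumes "f \<in> L2" "g \<in> borel_measurable lborel" "AE x in lborel. f x = g x"
  shows "l2_tendsto (\<lambda>_. f) g"
proof -
  have "g \<in> L2" using L2_cong_AE[OF assms] .
  moreover have "l2_dist f g = 0"
    using assms \<open>g \<in> L2\<close> by (simp add: l2_norm_eq_0_iff L2_diff)
  ultimately show ?thesis using assms by (simp add: l2_tendsto_def)
qed

lemma l2_closed_subspace_cong_AE: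
  assumes "l2_closed_subspace S" "f \<in> S" "g \<in> borel_measurable lborel" "AE x in lborel. f x = g x"
  shows "g \<in> S"
  using l2_closed_subspaceD(5)[OF assms(1), of "\<lambda>_. f" g] l2_tendsto_AE_const[of f g]
    l2_closed_subspaceD(1)[OF assms(1,2)] assms by auto

lemma l2_parallelogram:
  assumes "f \<in> L2" "g \<in> L2"
  shows "(l2_dist f g)\<^sup>2 = 2 * (l2_norm f)\<^sup>2 + 2 * (l2_norm g)\<^sup>2 - (l2_norm (\<lambda>x. f x + g x))\<^sup>2"
  by (simp add: l2_norm_sq_add l2_norm_sq_diff assms)

text \<open>A sequence minimizing the squared distance to \<open>h\<close> is Cauchy by the
  parallelogram law, and its limit is a nearest point. If the residual had a nonzero inner product
  with some \<open>w\<close>, a small step in the direction of \<open>w\<close> would come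
  closer.\<close>

theorem l2_projection_exists:
  assumes S: "l2_closed_subspace S" and h: "h \<in> L2"
  shows "\<exists>p\<in>S. \<forall>w\<in>S. l2_inner (\<lambda>x. h x - p x) w = 0"
proof -
  note SD = l2_closed_subspaceD[OF S]
  define d where "d = (INF s\<in>S. (l2_dist h s)\<^sup>2)"
  have bdd: "bdd_below ((\<lambda>s. (l2_dist h s)\<^sup>2) ` S)"
    by (rule bdd_belowI[of _ 0]) auto
  have d_le: "d \<le> (l2_dist h s)\<^sup>2" if "s \<in> S" for s
    unfolding d_def by (rule cINF_lower[OF bdd that])
  have "\<exists>s\<in>S. (l2_dist h s)\<^sup>2 < d + 1 / Suc n" for n
  proof (rule ccontr)
    assume "\<not> (\<exists>s\<in>S. (l2_dist h s)\<^sup>2 < d + 1 / Suc n)"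
    then have "d + 1 / Suc n \<le> (INF s\<in>S. (l2_dist h s)\<^sup>2)"
      using SD(2) by (intro cINF_greatest) (auto simp: not_less)
    then show False unfolding d_def[symmetric] by simp
  qed
  then have "\<forall>n. \<exists>s. s \<in> S \<and> (l2_dist h s)\<^sup>2 < d + 1 / Suc n" by (simp add: Bex_def)
  from choice[OF this] obtain s
    where s': "\<forall>n. s n \<in> S \<and> (l2_dist h (s n))\<^sup>2 < d + 1 / Suc n" ..
  have s: "s n \<in> S" "(l2_dist h (s n))\<^sup>2 < d + 1 / Suc n" for n
    using s' by simp_all
  have sL: "s n \<in> L2" for n by (rule SD(1)[OF s(1)])
  have est: "(l2_dist (s m) (s n))\<^sup>2 \<le> 2 / Suc m + 2 / Suc n" for m n
  proof -
    \<comment> \<open>The midpoint belongs to \<open>S\<close>, so its squared distance from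
      \<open>h\<close> is at least \<open>d\<close>; in the parallelogram law this cancels the
      \<open>4 * d\<close> contributed by the two nearly minimal terms.\<close>
    have mid: "(\<lambda>x. (1/2) * (s m x + s n x)) \<in> S"
      by (rule SD(4)[OF SD(3)[OF s(1) s(1)]])
    have "(l2_norm (\<lambda>x. (h x - s n x) + (h x - s m x)))\<^sup>2
        = (l2_norm (\<lambda>x. 2 * (h x - (1/2) * (s m x + s n x))))\<^sup>2"
      by (simp add: algebra_simps)
    also have "\<dots> = 4 * (l2_norm (\<lambda>x. h x - (1/2) * (s m x + s n x)))\<^sup>2"
      by (simp only: l2_norm_cmult) (simp add: power_mult_distrib)
    finally have e: "(l2_norm (\<lambda>x. (h x - s n x) + (h x - s m x)))\<^sup>2 \<ge> 4 * d"
      using d_le[OF mid] by simp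
    have "(l2_norm (\<lambda>x. (h x - s n x) - (h x - s m x)))\<^sup>2 \<le> 2 / Suc m + 2 / Suc n"
      using l2_parallelogram[OF L2_diff[OF h sL] L2_diff[OF h sL], of n m] e s(2)[of n] s(2)[of m]
      by simp
    then show ?thesis by simp
  qed
  have "\<exists>N. \<forall>m\<ge>N. \<forall>n\<ge>N. l2_dist (s m) (s n) < e" if "e > 0" for e
  proof -
    have "0 < e\<^sup>2 / 4" using that by simp
    from reals_Archimedean[OF this] obtain N where "inverse (real (Suc N)) < e\<^sup>2 / 4" ..
    then have N: "1 / real (Suc N) < e\<^sup>2 / 4" by (simp only: inverse_eq_divide)
    have "l2_dist (s m) (s n) < e" if "m \<ge> N" "n \<ge> N" for m n
    proof (rule power2_less_imp_less)
      have "1 / real (Suc m) \<le> 1 / Suc N" "1 / real (Suc n) \<le> 1 / Suc N"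
        using that by (simp_all add: frac_le)
      then show "(l2_dist (s m) (s n))\<^sup>2 < e\<^sup>2" using est[of m n] N by simp
    qed (use \<open>e > 0\<close> in simp)
    then show ?thesis by blast
  qed
  from L2_complete[OF sL this] obtain p where p: "l2_tendsto s p" by blast
  have pS: "p \<in> S" using SD(5)[OF s(1) p] .
  have pL: "p \<in> L2" using SD(1)[OF pS] .
  have "l2_tendsto (\<lambda>n x. h x + (-1) * s n x) (\<lambda>x. h x + (-1) * p x)"
    by (intro l2_tendsto_add l2_tendsto_cmult l2_tendsto_const p h)
  then have "(\<lambda>n. (l2_dist h (s n))\<^sup>2) \<longlonglongrightarrow> (l2_dist h p)\<^sup>2"
    by (intro tendsto_power) (use l2_tendsto_norm in force)
  moreover have "(\<lambda>n. d + 1 / Suc n) \<longlonglongrightarrow> d + 0"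
    by (intro tendsto_intros LIMSEQ_inverse_real_of_nat[unfolded inverse_eq_divide])
  ultimately have "(l2_dist h p)\<^sup>2 \<le> d + 0"
    by (rule LIMSEQ_le) (use s(2) less_imp_le in auto)
  then have pd: "(l2_dist h p)\<^sup>2 \<le> d" by simp
  show ?thesis
  proof (intro bexI[OF _ pS] ballI, rule ccontr)
    fix w assume w: "w \<in> S" and "l2_inner (\<lambda>x. h x - p x) w \<noteq> 0"
    define z where "z = l2_inner (\<lambda>x. h x - p x) w"
    define W where "W = (l2_norm w)\<^sup>2"
    \<comment> \<open>Moving by \<open>t * z * w\<close> changes the squared distance by t^2 |z|^2 W
      - 2 t |z|^2, which is negative as soon as t W < 2. The added 1 gives
      \<open>t * W \<le> 1\<close> and covers \<open>W = 0\<close>.\<close>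
    define t where "t = 1 / (W + 1)"
    have W: "W \<ge> 0" and z: "(cmod z)\<^sup>2 > 0" using \<open>_ \<noteq> 0\<close> by (auto simp: W_def z_def)
    have t: "t > 0" using W by (simp add: t_def)
    have wL: "w \<in> L2" using SD(1)[OF w] .
    have "d \<le> (l2_norm (\<lambda>x. h x - (p x + (of_real t * z) * w x)))\<^sup>2"
      by (rule d_le[OF SD(3)[OF pS SD(4)[OF w]]])
    also have "\<dots> = (l2_norm (\<lambda>x. (h x - p x) - (of_real t * z) * w x))\<^sup>2"
      by (simp add: algebra_simps)
    also have "\<dots> = (l2_dist h p)\<^sup>2 + (t * cmod z)\<^sup>2 * W - 2 * Re (cnj (of_real t * z) * z)"
      using t by (subst l2_norm_sq_diff[OF L2_diff[OF h pL] L2_cmult[OF wL]])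
        (simp only: l2_norm_cmult l2_inner_cmult_right z_def[symmetric] W_def power_mult_distrib, simp add: norm_mult power_mult_distrib)
    also have "Re (cnj (of_real t * z) * z) = t * (cmod z)\<^sup>2"
    proof -
      have "cnj (of_real t * z) * z = of_real (t * (cmod z)\<^sup>2)"
        using complex_norm_square[of z] by (simp add: mult_ac)
      then show ?thesis by (simp only: Re_complex_of_real)
    qed
    finally have "2 * (t * (cmod z)\<^sup>2) \<le> t * (cmod z)\<^sup>2 * (t * W)"
      using pd by (simp add: power_mult_distrib algebra_simps power2_eq_square)
    moreover have "t * W \<le> 1" using W by (simp add: t_def)
    then have "t * (cmod z)\<^sup>2 * (t * W) \<le> t * (cmod z)\<^sup>2 * 1"
      using t z by (intro mult_left_mono) auto
    moreover have "t * (cmod z)\<^sup>2 > 0" using t z by simp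
    ultimately show False by simp
  qed
qed

lemma orth_proj:
  assumes "l2_closed_subspace S" and "h \<in> L2"
  shows "orth_proj S h \<in> S" and "w \<in> S \<Longrightarrow> l2_inner (\<lambda>x. h x - orth_proj S h x) w = 0"
proof -
  have "\<exists>p. p \<in> S \<and> (\<forall>w\<in>S. l2_inner (\<lambda>x. h x - p x) w = 0)"
    using l2_projection_exists[OF assms] by blast
  from someI_ex[OF this]
  show "orth_proj S h \<in> S" and "w \<in> S \<Longrightarrow> l2_inner (\<lambda>x. h x - orth_proj S h x) w = 0"
    unfolding orth_proj_def by blast+
qed

lemma l2_closed_subspace_orth_complement_in:
  assumes U: "l2_closed_subspace U" and S: "S \<subseteq> L2"
  shows "l2_closed_subspace (orth_complement_in U S)"
  unfolding l2_closed_subspace_def orth_complement_in_def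
proof (intro conjI allI impI ballI)
  let ?C = "{f \<in> U. \<forall>g\<in>S. l2_inner f g = 0}"
  note UD = l2_closed_subspaceD[OF U]
  show "?C \<subseteq> L2" using UD(1) by blast
  show "(\<lambda>x. 0) \<in> ?C" using UD(2) by (simp add: l2_inner_def)
  show "(\<lambda>x. f x + g x) \<in> ?C"
    if "f \<in> ?C" "g \<in> ?C" for f g
    using that UD(1,3) S by (auto simp: l2_inner_add_left subset_iff)
  show "(\<lambda>x. c * f x) \<in> ?C"
    if "f \<in> ?C" for c f
    using that UD(4) by (auto simp: l2_inner_cmult_left)
  fix X f assume X: "(\<forall>n. X n \<in> ?C) \<and> l2_tendsto X f"
  have "l2_inner f g = 0" if "g \<in> S" for g
  proof -
    have "(\<lambda>n. l2_inner (X n) g) \<longlonglongrightarrow> l2_inner f g"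
      using X that S by (intro l2_tendsto_inner l2_tendsto_const) auto
    with X that show ?thesis by (simp add: LIMSEQ_const_iff)
  qed
  then show "f \<in> ?C" using X UD(5)[of X f] by auto
qed

text \<open>The residual of a projection onto \<open>S\<close> is orthogonal to \<open>S\<close>,
  hence zero almost everywhere. Closed subspaces contain every measurable function that agrees
  almost everywhere with a member, so \<open>f\<close> itself lies in \<open>S\<close>.\<close>

lemma l2_closed_subspace_eq_L2:
  assumes S: "l2_closed_subspace S"
    and orth: "\<And>h. h \<in> L2 \<Longrightarrow> (\<And>s. s \<in> S \<Longrightarrow> l2_inner h s = 0) \<Longrightarrow> AE x in lborel. h x = 0"
  shows "S = L2"
proof (intro equalityI subsetI)
  show "f \<in> L2" if "f \<in> S" for f using l2_closed_subspaceD(1)[OF S that] .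
  fix f assume f: "f \<in> L2"
  let ?p = "orth_proj S f"
  have p: "?p \<in> S" "?p \<in> L2"
    using orth_proj[OF S f] l2_closed_subspaceD(1)[OF S] by auto
  have "AE x in lborel. f x - ?p x = 0"
    by (rule orth) (use orth_proj[OF S f] f p in \<open>auto intro: L2_diff\<close>)
  then have "AE x in lborel. ?p x = f x" by eventually_elim simp
  then show "f \<in> S"
    using l2_closed_subspace_cong_AE[OF S p(1)] f L2_measurable by blast
qed

section \<open>Spans and closed spans\<close>

lemma l2_span_sum:
  fixes s :: "nat \<Rightarrow> real \<Rightarrow> complex"
  assumes "\<And>i. i < n \<Longrightarrow> s i \<in> S"
  shows "(\<lambda>x. \<Sum>i<n. c i * s i x) \<in> l2_span S"
  using assms unfolding l2_span_def by blast

lemma l2_span_base: "f \<in> S \<Longrightarrow> f \<in> l2_span S"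
  using l2_span_sum[of 1 "\<lambda>_. f" S "\<lambda>_. 1"] by simp

lemma l2_span_add:
  assumes "f \<in> l2_span S" "g \<in> l2_span S"
  shows "(\<lambda>x. f x + g x) \<in> l2_span S"
proof -
  obtain n :: nat and c s where f: "f = (\<lambda>x. \<Sum>i<n. c i * s i x)" "\<forall>i<n. s i \<in> S"
    using assms(1) unfolding l2_span_def by blast
  obtain m :: nat and d t where g: "g = (\<lambda>x. \<Sum>i<m. d i * t i x)" "\<forall>i<m. t i \<in> S"
    using assms(2) unfolding l2_span_def by blast
  define e where "e i = (if i < n then c i else d (i - n))" for i
  define u where "u i = (if i < n then s i else t (i - n))" for i
  have "(\<Sum>i<n + m. e i * u i x) = f x + g x" for x
  proof -
    have "(\<Sum>i<n + m. e i * u i x) = (\<Sum>i<n. e i * u i x) + (\<Sum>i=n..<n+m. e i * u i x)"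
      by (metis (no_types, lifting) atLeast0LessThan le_add1 le_add_same_cancel1 sum.atLeastLessThan_concat)
    also have "(\<Sum>i=n..<n+m. e i * u i x) = (\<Sum>i<m. e (i + n) * u (i + n) x)"
      using sum.shift_bounds_nat_ivl[of "\<lambda>i. e i * u i x" 0 n m]
      by (simp add: atLeast0LessThan add.commute)
    finally show ?thesis by (simp add: f g e_def u_def)
  qed
  moreover have "(\<lambda>x. \<Sum>i<n + m. e i * u i x) \<in> l2_span S"
    by (rule l2_span_sum) (use f g in \<open>auto simp: u_def\<close>)
  ultimately show ?thesis by simp
qed

lemma l2_span_cmult:
  assumes "f \<in> l2_span S"
  shows "(\<lambda>x. c * f x) \<in> l2_span S"
proof -
  obtain n :: nat and d s where f: "f = (\<lambda>x. \<Sum>i<n. d i * s i x)" "\<forall>i<n. s i \<in> S"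
    using assms unfolding l2_span_def by blast
  then show ?thesis
    using l2_span_sum[of n s S "\<lambda>i. c * d i"] by (simp add: sum_distrib_left mult.assoc)
qed

lemma l2_closed_subspace_sum:
  fixes s :: "nat \<Rightarrow> real \<Rightarrow> complex"
  assumes S: "l2_closed_subspace S" and "\<And>i. i < n \<Longrightarrow> s i \<in> S"
  shows "(\<lambda>x. \<Sum>i<n. c i * s i x) \<in> S"
  using assms(2)
proof (induction n)
  case (Suc n)
  then show ?case
    using l2_closed_subspaceD(3)[OF S, of "\<lambda>x. \<Sum>i<n. c i * s i x" "\<lambda>x. c n * s n x"]
      l2_closed_subspaceD(4)[OF S] by simp
qed (simp add: l2_closed_subspaceD(2)[OF S])

lemma l2_closed_spanI: "(\<And>n. X n \<in> l2_span A) \<Longrightarrow> l2_tendsto X f \<Longrightarrow> f \<in> l2_closed_span A"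
  by (auto simp: l2_closed_span_def)

lemma l2_closed_spanE:
  assumes "f \<in> l2_closed_span A"
  obtains X where "\<And>n. X n \<in> l2_span A" "l2_tendsto X f"
  using assms by (auto simp: l2_closed_span_def)

lemma l2_closed_span_minimal:
  assumes "l2_closed_subspace S" and "A \<subseteq> S"
  shows "l2_closed_span A \<subseteq> S"
proof
  fix f assume "f \<in> l2_closed_span A"
  then obtain X where X: "\<And>n. X n \<in> l2_span A" "l2_tendsto X f"
    unfolding l2_closed_span_def by blast
  have "X n \<in> S" for n
  proof -
    obtain k :: nat and c s where *: "X n = (\<lambda>x. \<Sum>i<k. c i * s i x)" "\<forall>i<k. s i \<in> A"
      using X(1)[of n] unfolding l2_span_def by blast
    then show ?thesis
      using l2_closed_subspace_sum[OF assms(1), of k s c] assms(2) by auto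
  qed
  then show "f \<in> S" using l2_closed_subspaceD(5)[OF assms(1)] X(2) by blast
qed

lemma l2_closed_subspace_L2: "l2_closed_subspace L2"
  by (simp add: l2_closed_subspace_def L2_add L2_cmult l2_tendsto_def)

text \<open>The epsilon form replaces a diagonal sequence when the closed span is shown to be
  closed.\<close>

lemma l2_closed_span_iff:
  assumes "A \<subseteq> L2"
  shows "f \<in> l2_closed_span A \<longleftrightarrow> f \<in> L2 \<and> (\<forall>e>0. \<exists>g\<in>l2_span A. l2_dist g f < e)"
proof
  assume "f \<in> l2_closed_span A"
  then obtain X where X: "\<And>n. X n \<in> l2_span A" "l2_tendsto X f"
    unfolding l2_closed_span_def by blast
  then have "(\<lambda>n. l2_dist (X n) f) \<longlonglongrightarrow> 0" "f \<in> L2" by (auto simp: l2_tendsto_def)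
  then have "\<exists>g\<in>l2_span A. l2_dist g f < e" if "e > 0" for e
    using X(1) LIMSEQ_D[OF _ that] by fastforce
  then show "f \<in> L2 \<and> (\<forall>e>0. \<exists>g\<in>l2_span A. l2_dist g f < e)"
    using \<open>f \<in> L2\<close> by blast
next
  assume f: "f \<in> L2 \<and> (\<forall>e>0. \<exists>g\<in>l2_span A. l2_dist g f < e)"
  then have "\<forall>n. \<exists>g. g \<in> l2_span A \<and> l2_dist g f < 1 / Suc n"
    by (auto simp: Bex_def)
  from choice[OF this] obtain X
    where X: "\<And>n. X n \<in> l2_span A" "\<And>n. l2_dist (X n) f < 1 / Suc n"
    by blast
  have XL: "X n \<in> L2" for n
  proof -
    obtain k :: nat and c s where *: "X n = (\<lambda>x. \<Sum>i<k. c i * s i x)" "\<forall>i<k. s i \<in> A"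
      using X(1)[of n] unfolding l2_span_def by blast
    then show ?thesis
      using l2_closed_subspace_sum[OF l2_closed_subspace_L2, of k s c] assms(1) by auto
  qed
  have "(\<lambda>n. l2_dist (X n) f) \<longlonglongrightarrow> 0"
    by (rule Lim_null_comparison[OF _ LIMSEQ_inverse_real_of_nat])
      (use X(2)[THEN less_imp_le] in \<open>auto simp: inverse_eq_divide\<close>)
  then have "l2_tendsto X f" using XL f by (auto simp: l2_tendsto_def)
  then show "f \<in> l2_closed_span A" using X(1) by (auto simp: l2_closed_span_def)
qed

lemma l2_closed_subspace_closed_span:
  assumes A: "A \<subseteq> L2"
  shows "l2_closed_subspace (l2_closed_span A)"
  unfolding l2_closed_subspace_def
proof (intro conjI allI impI ballI)
  show sub: "l2_closed_span A \<subseteq> L2" by (auto simp: l2_closed_span_iff[OF A])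
  have "(\<lambda>x. 0) \<in> l2_span A" using l2_span_sum[of 0 undefined A] by simp
  then show "(\<lambda>x. 0) \<in> l2_closed_span A"
    by (rule l2_closed_spanI[OF _ l2_tendsto_const[OF L2_zero]])
  show "(\<lambda>x. f x + g x) \<in> l2_closed_span A" if fg: "f \<in> l2_closed_span A" "g \<in> l2_closed_span A" for f g
  proof -
    obtain X where "\<And>n. X n \<in> l2_span A" "l2_tendsto X f"
      by (rule l2_closed_spanE[OF fg(1)]) (rule that)
    moreover obtain Y where "\<And>n. Y n \<in> l2_span A" "l2_tendsto Y g"
      by (rule l2_closed_spanE[OF fg(2)]) (rule that)
    ultimately show ?thesis
      by (intro l2_closed_spanI[of "\<lambda>n x. X n x + Y n x"] l2_span_add l2_tendsto_add)
  qed
  show "(\<lambda>x. c * f x) \<in> l2_closed_span A" if f: "f \<in> l2_closed_span A" for c f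
  proof -
    obtain X where "\<And>n. X n \<in> l2_span A" "l2_tendsto X f"
      by (rule l2_closed_spanE[OF f]) (rule that)
    then show ?thesis
      by (intro l2_closed_spanI[of "\<lambda>n x. c * X n x"] l2_span_cmult l2_tendsto_cmult)
  qed
  fix X f assume X: "(\<forall>n. X n \<in> l2_closed_span A) \<and> l2_tendsto X f"
  then have fL: "f \<in> L2" and XL: "X n \<in> L2" for n by (auto simp: l2_tendsto_def)
  have "\<exists>g\<in>l2_span A. l2_dist g f < e" if "e > 0" for e
  proof -
    have e2: "0 < e/2" using that by simp
    obtain n where n: "l2_dist (X n) f < e/2"
      using X l2_tendstoD[OF _ e2, of X f] by blast
    obtain g where g: "g \<in> l2_span A" "l2_dist g (X n) < e/2"
      using X e2 l2_closed_span_iff[OF A, of "X n"] by blast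
    have "g \<in> l2_closed_span A"
      unfolding l2_closed_span_iff[OF A]
    proof (intro conjI allI impI)
      obtain k :: nat and c s where *: "g = (\<lambda>x. \<Sum>i<k. c i * s i x)" "\<forall>i<k. s i \<in> A"
        using g(1) unfolding l2_span_def by blast
      then show "g \<in> L2"
        using l2_closed_subspace_sum[OF l2_closed_subspace_L2, of k s c] A by auto
      show "\<exists>h\<in>l2_span A. l2_dist h g < e" if "e > 0" for e
        using g(1) that by (intro bexI[of _ g]) (auto simp: l2_norm_def)
    qed
    then have "g \<in> L2" using sub by blast
    from l2_norm_triangle_diff[OF this XL fL, of n] n g show ?thesis by (intro bexI[of _ g]) auto
  qed
  then show "f \<in> l2_closed_span A" using fL by (simp add: l2_closed_span_iff[OF A])
qed

lemma l2_closed_span_base: "f \<in> A \<Longrightarrow> f \<in> L2 \<Longrightarrow> f \<in> l2_closed_span A"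
  by (rule l2_closed_spanI[of "\<lambda>_. f"]) (auto intro: l2_span_base l2_tendsto_const)

lemma l2_closed_span_orth:
  assumes A: "A \<subseteq> L2" and h: "h \<in> L2" and "\<And>a. a \<in> A \<Longrightarrow> l2_inner h a = 0" and f: "f \<in> l2_closed_span A"
  shows "l2_inner h f = 0"
proof -
  have "l2_closed_span A \<subseteq> orth_complement_in L2 {h}"
    using assms by (intro l2_closed_span_minimal l2_closed_subspace_orth_complement_in l2_closed_subspace_L2)
      (auto simp: orth_complement_in_def intro: l2_inner_eq_0_sym)
  then show ?thesis using f by (auto simp: orth_complement_in_def intro: l2_inner_eq_0_sym)
qed

section \<open>Density of step functions\<close>

text \<open>The Borel sets over which \<open>f\<close> integrates to zero form a Dynkin system, and
  open intervals are a generator of the Borel sets closed under intersection.\<close>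

lemma AE_zero_if_intervals_zero:
  fixes f :: "real \<Rightarrow> complex"
  assumes f: "integrable lborel f" and z: "\<And>a b. (LINT x|lborel. indicator {a<..<b} x *\<^sub>R f x) = 0"
  shows "AE x in lborel. f x = 0"
proof (rule sigma_finite_measure.density_zero[OF sigma_finite_lborel f])
  have [measurable]: "f \<in> borel_measurable borel" using f by simp
  \<comment> \<open>Complements require the integral over the whole line, which is not one of the
    bounded intervals; it is the limit of the integrals over
    \<open>{-real n<..<real n}\<close>.\<close>
  have tot: "(LINT x|lborel. f x) = 0"
  proof (rule LIMSEQ_unique)
    show "(\<lambda>n::nat. LINT x|lborel. indicator {-real n<..<real n} x *\<^sub>R f x) \<longlonglongrightarrow> (LINT x|lborel. f x)"
    proof (rule integral_dominated_convergence[where w="\<lambda>x. norm (f x)"])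
      show "AE x in lborel. (\<lambda>n. indicator {-real n<..<real n} x *\<^sub>R f x) \<longlonglongrightarrow> f x"
      proof (intro AE_I2 tendsto_eventually)
        fix x :: real
        obtain N where "\<bar>x\<bar> < real N" using reals_Archimedean2 by blast
        then have "x \<in> {-real n<..<real n}" if "n \<ge> N" for n
          using that by (auto simp: abs_less_iff)
        then show "\<forall>\<^sub>F n in sequentially. indicator {-real n<..<real n} x *\<^sub>R f x = f x"
          unfolding eventually_sequentially by (intro exI[of _ N]) auto
      qed
    qed (use f in \<open>auto simp: indicator_def\<close>)
    show "(\<lambda>n::nat. LINT x|lborel. indicator {-real n<..<real n} x *\<^sub>R f x) \<longlonglongrightarrow> 0"
      by (simp add: z)
  qed
  fix A :: "real set" assume "A \<in> sets lborel"
  have sets_eq: "sigma_sets UNIV (range (\<lambda>(a, b). {a<..<b})) = sets (borel :: real measure)"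
    using arg_cong[OF borel_eq_box[where 'a=real], of sets] by (simp add: box_real)
  have "Int_stable (range (\<lambda>(a, b). {a<..<b::real}))"
    by (auto simp: Int_stable_def image_iff)
  moreover have "range (\<lambda>(a, b). {a<..<b::real}) \<subseteq> Pow UNIV" by simp
  moreover have "A \<in> sigma_sets UNIV (range (\<lambda>(a, b). {a<..<b}))"
    using \<open>A \<in> sets lborel\<close> by (simp add: sets_eq)
  ultimately show "set_lebesgue_integral lborel A f = 0"
  proof (induction rule: sigma_sets_induct_disjoint)
    case (basic A)
    then show ?case using z by (auto simp: set_lebesgue_integral_def)
  next
    case empty
    then show ?case by (simp add: set_lebesgue_integral_def)
  next
    case (compl A)
    have [measurable]: "A \<in> sets borel" using compl(1) by (simp add: sets_eq)
    have "(LINT x|lborel. indicator (UNIV - A) x *\<^sub>R f x) = (LINT x|lborel. f x - indicator A x *\<^sub>R f x)"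
      by (intro Bochner_Integration.integral_cong) (auto simp: indicator_def)
    also have "\<dots> = 0"
      using compl f by (subst Bochner_Integration.integral_diff) (auto simp: tot set_lebesgue_integral_def intro!: integrable_mult_indicator)
    finally show ?case by (simp add: set_lebesgue_integral_def)
  next
    case (union A)
    have [measurable]: "A i \<in> sets borel" for i using union(2) by (auto simp: sets_eq)
    have "set_integrable lborel (\<Union>i. A i) f"
      unfolding set_integrable_def using f by (intro integrable_mult_indicator) auto
    then have "set_lebesgue_integral lborel (\<Union>i. A i) f = (\<Sum>i. set_lebesgue_integral lborel (A i) f)"
      using union(1) by (intro lebesgue_integral_countable_add) (auto simp: disjoint_family_on_def)
    then show ?case using union(3) by simp
  qed
qed

lemma indicator_interval_L2: "(indicator {a<..<b} :: real \<Rightarrow> complex) \<in> L2"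
proof -
  have "emeasure lborel {a<..<b} < \<infinity>"
    by (rule emeasure_bounded_finite) simp
  then have "integrable lborel (indicator {a<..<b} :: real \<Rightarrow> real)"
    by (simp add: integrable_indicator_iff)
  moreover have "(\<lambda>x. (cmod (indicator {a<..<b::real} x))\<^sup>2) = indicator {a<..<b}"
    by (auto simp: indicator_def)
  ultimately show ?thesis by (simp add: L2_def)
qed

text \<open>Serves as an induction principle: a property that defines a closed subspace need only be
  checked on indicators of intervals.\<close>

theorem l2_closed_subspace_intervals:
  assumes S: "l2_closed_subspace S" and I: "\<And>a b. indicator {a<..<b} \<in> S"
  shows "S = L2"
proof (rule l2_closed_subspace_eq_L2[OF S])
  fix h assume h: "h \<in> L2" and orth: "\<And>s. s \<in> S \<Longrightarrow> l2_inner h s = 0"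
  have [measurable]: "h \<in> borel_measurable lborel" using h by measurable
  \<comment> \<open>A square integrable \<open>h\<close> need not be integrable on the line, but its
    product with the indicator of a bounded interval is; countably many such intervals cover the
    line.\<close>
  have "AE x in lborel. indicator {-real n<..<real n} x *\<^sub>R h x = 0" for n
  proof (rule AE_zero_if_intervals_zero)
    have "integrable lborel (\<lambda>x. h x * cnj (indicator {-real n<..<real n} x))"
      by (intro L2_mult_cnj h indicator_interval_L2)
    also have "(\<lambda>x. h x * cnj (indicator {-real n<..<real n} x)) = (\<lambda>x. indicator {-real n<..<real n} x *\<^sub>R h x)"
      by (auto simp: indicator_def)
    finally show "integrable lborel \<dots>" .
    show "(LINT x|lborel. indicator {a<..<b} x *\<^sub>R indicator {-real n<..<real n} x *\<^sub>R h x) = 0" for a b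
    proof -
      have "(LINT x|lborel. indicator {a<..<b} x *\<^sub>R indicator {-real n<..<real n} x *\<^sub>R h x)
          = l2_inner h (indicator {max a (-real n)<..<min b (real n)})"
        unfolding l2_inner_def by (intro Bochner_Integration.integral_cong) (auto simp: indicator_def)
      with orth[OF I] show ?thesis by simp
    qed
  qed
  then have "AE x in lborel. \<forall>n. indicator {-real n<..<real n} x *\<^sub>R h x = 0"
    unfolding AE_all_countable by blast
  then show "AE x in lborel. h x = 0"
  proof eventually_elim
    fix x assume *: "\<forall>n. indicator {-real n<..<real n} x *\<^sub>R h x = 0"
    obtain N where "\<bar>x\<bar> < real N" using reals_Archimedean2 by blast
    then show "h x = 0" using *[rule_format, of N] by (auto simp: indicator_def abs_less_iff split: if_splits)
  qed
qed

section \<open>Plancherel's theorem\<close>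

lemma lborel_integrable_shift_iff:
  fixes f :: "real \<Rightarrow> 'a :: {banach, second_countable_topology}"
  shows "integrable lborel (\<lambda>x. f (x - s)) \<longleftrightarrow> integrable lborel f"
  using lborel_integrable_real_affine_iff[of 1 f "-s"] by simp

lemma lborel_integral_shift:
  fixes f :: "real \<Rightarrow> 'a :: {banach, second_countable_topology}"
  shows "(LINT x|lborel. f (x - s)) = (LINT x|lborel. f x)"
  using lborel_integral_real_affine[of 1 f "-s"] by simp

lemma L2_shift: "f \<in> L2 \<Longrightarrow> (\<lambda>x. f (x - s)) \<in> L2"
  using lborel_integrable_shift_iff[of "\<lambda>x. (cmod (f x))\<^sup>2" s] by (auto simp: L2_def)

lemma l2_norm_shift: "l2_norm (\<lambda>x. f (x - s)) = l2_norm f"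
  using lborel_integral_shift[of "\<lambda>x. (cmod (f x))\<^sup>2" s] by (simp add: l2_norm_def)

lemma l2_inner_shift: "l2_inner (\<lambda>x. f (x - s)) (\<lambda>x. g (x - s)) = l2_inner f g"
  using lborel_integral_shift[of "\<lambda>x. f x * cnj (g x)" s] by (simp add: l2_inner_def)

lemma l2_tendsto_shift: "l2_tendsto X f \<Longrightarrow> l2_tendsto (\<lambda>n x. X n (x - s)) (\<lambda>x. f (x - s))"
  using l2_norm_shift[of "\<lambda>x. X _ x - f x" s] by (simp add: l2_tendsto_def L2_shift)

text \<open>Off the two endpoints the translated indicators are eventually equal to the original
  one. Since \<open>Y\<close> is bounded by some \<open>B\<close>, the interval enlarged by
  \<open>B\<close> on both sides gives an integrable majorant.\<close>

lemma interval_shift_continuous: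
  assumes Y: "Y \<longlonglongrightarrow> (0::real)"
  shows "(\<lambda>n. l2_norm (\<lambda>x. indicator {a<..<b} (x - Y n) - indicator {a<..<b} x)) \<longlonglongrightarrow> 0"
proof -
  let ?d = "\<lambda>n x. (cmod (indicator {a<..<b} (x - Y n) - indicator {a<..<b} x))\<^sup>2"
  obtain B where B: "\<And>n. \<bar>Y n\<bar> \<le> B"
    using convergent_imp_Bseq[of Y] Y by (auto simp: convergent_def Bseq_def)
  have B0: "B \<ge> 0" using B[of 0] by linarith
  have "(\<lambda>n. LINT x|lborel. ?d n x)
      \<longlonglongrightarrow> (LINT x|(lborel :: real measure). 0)"
  proof (rule integral_dominated_convergence[where w="indicator {a-B..b+B} :: real \<Rightarrow> real"])
    show "AE x in lborel. (\<lambda>n. ?d n x) \<longlonglongrightarrow> 0"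
      using AE_lborel_singleton[of a] AE_lborel_singleton[of b]
    proof eventually_elim
      fix x assume "x \<noteq> a" "x \<noteq> b"
      then consider "x < a" | "a < x" "x < b" | "b < x" by linarith
      moreover have l: "(\<lambda>n. x - Y n) \<longlonglongrightarrow> x - 0" by (intro tendsto_intros Y)
      ultimately have "\<forall>\<^sub>F n in sequentially. (x - Y n \<in> {a<..<b}) = (x \<in> {a<..<b})"
      proof cases
        case 1
        then show ?thesis using order_tendstoD(2)[OF l, of a] by (auto elim!: eventually_mono)
      next
        case 2
        have "\<forall>\<^sub>F n in sequentially. a < x - Y n" "\<forall>\<^sub>F n in sequentially. x - Y n < b"
          using order_tendstoD(1)[OF l, of a] order_tendstoD(2)[OF l, of b] 2 by auto
        then show ?thesis by eventually_elim (use 2 in auto)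
      next
        case 3
        then show ?thesis using order_tendstoD(1)[OF l, of b] by (auto elim!: eventually_mono)
      qed
      then have "\<forall>\<^sub>F n in sequentially. ?d n x = 0"
        by eventually_elim (auto simp: indicator_def)
      then show "(\<lambda>n. ?d n x) \<longlonglongrightarrow> 0"
        by (rule tendsto_eventually)
    qed
    show "AE x in lborel. norm (?d n x)
        \<le> indicator {a-B..b+B} x" for n
      using B[of n] B0 by (intro AE_I2) (auto simp: indicator_def abs_le_iff)
    show "integrable lborel (indicator {a-B..b+B} :: real \<Rightarrow> real)"
      by (auto simp: integrable_indicator_iff emeasure_lborel_Icc_eq)
  qed auto
  then have "(\<lambda>n. sqrt (LINT x|lborel. ?d n x)) \<longlonglongrightarrow> sqrt 0"
    by (intro tendsto_intros) simp
  then show ?thesis by (simp add: l2_norm_def)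
qed

text \<open>The functions translated continuously form a closed subspace containing the intervals.\<close>
theorem L2_shift_continuous:
  assumes f: "f \<in> L2" and Y: "Y \<longlonglongrightarrow> (0::real)"
  shows "(\<lambda>n. l2_norm (\<lambda>x. f (x - Y n) - f x)) \<longlonglongrightarrow> 0"
proof -
  define C where "C = {f \<in> L2. (\<lambda>n. l2_norm (\<lambda>x. f (x - Y n) - f x)) \<longlonglongrightarrow> 0}"
  have C_iff: "g \<in> C \<longleftrightarrow> g \<in> L2 \<and> l2_tendsto (\<lambda>n x. g (x - Y n)) g" for g
    by (auto simp: C_def l2_tendsto_def L2_shift)
  have "l2_closed_subspace C"
    unfolding l2_closed_subspace_def
  proof (intro conjI allI impI ballI)
    show "C \<subseteq> L2" by (auto simp: C_def)
    show "(\<lambda>x. 0) \<in> C" by (simp add: C_def l2_norm_def)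
    show "(\<lambda>x. g x + h x) \<in> C" if "g \<in> C" "h \<in> C" for g h
      using that l2_tendsto_add[of _ g _ h] by (fastforce simp: C_iff L2_add)
    show "(\<lambda>x. c * g x) \<in> C" if "g \<in> C" for c g
      using that l2_tendsto_cmult[of _ g c] by (fastforce simp: C_iff L2_cmult)
    fix X g assume X: "(\<forall>n. X n \<in> C) \<and> l2_tendsto X g"
    then have g: "g \<in> L2" and XL: "X k \<in> L2" for k by (auto simp: l2_tendsto_def)
    have "(\<lambda>n. l2_norm (\<lambda>x. g (x - Y n) - g x)) \<longlonglongrightarrow> 0"
    proof (rule LIMSEQ_I)
      fix r :: real assume r: "0 < r"
      have r3: "0 < r/3" using r by simp
      obtain k where k: "l2_dist (X k) g < r/3"
        using X l2_tendstoD[OF _ r3, of X g] by blast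
      obtain N where N: "\<And>n. n \<ge> N \<Longrightarrow> l2_norm (\<lambda>x. X k (x - Y n) - X k x) < r/3"
        using X l2_tendstoD[OF _ r3, of "\<lambda>n x. X k (x - Y n)" "X k"] by (auto simp: C_iff)
      have "norm (l2_norm (\<lambda>x. g (x - Y n) - g x) - 0) < r" if "n \<ge> N" for n
      proof -
        have "l2_norm (\<lambda>x. g (x - Y n) - X k (x - Y n)) = l2_dist (X k) g"
          using l2_norm_shift[of "\<lambda>x. g x - X k x" "Y n"] l2_norm_minus_commute[of g "X k"] by simp
        then show ?thesis
          using l2_norm_triangle_diff[OF L2_shift[OF g] L2_shift[OF XL] g, of "Y n" k "Y n"]
            l2_norm_triangle_diff[OF L2_shift[OF XL] XL g, of k "Y n" k] k N[OF that] by simp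
      qed
      then show "\<exists>N. \<forall>n\<ge>N. norm (l2_norm (\<lambda>x. g (x - Y n) - g x) - 0) < r" by blast
    qed
    then show "g \<in> C" using g by (simp add: C_def)
  qed
  then have "C = L2"
    by (rule l2_closed_subspace_intervals)
      (use interval_shift_continuous[OF Y] indicator_interval_L2 in \<open>auto simp: C_def\<close>)
  then show ?thesis using f by (auto simp: C_def)
qed

section \<open>The Fourier transform of integrable functions\<close>

definition fexp :: "real \<Rightarrow> complex" where
  "fexp t = cis (2 * pi * t)"

lemma norm_fexp [simp]: "cmod (fexp t) = 1"
  by (simp add: fexp_def)

lemma cnj_fexp: "cnj (fexp t) = fexp (- t)"
  by (simp add: fexp_def cis_cnj)

lemma fexp_add: "fexp (s + t) = fexp s * fexp t"
  by (simp add: fexp_def cis_mult ring_distribs)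

lemma fexp_0 [simp]: "fexp 0 = 1"
  by (simp add: fexp_def)

lemma continuous_on_fexp [continuous_intros]: "continuous_on S g \<Longrightarrow> continuous_on S (\<lambda>x. fexp (g x))"
  unfolding fexp_def by (intro continuous_intros)

lemma borel_measurable_fexp [measurable]: "fexp \<in> borel_measurable borel"
  by (intro borel_measurable_continuous_onI continuous_intros)

lemma fourier_L1_eq: "fourier_L1 f \<xi> = (LINT x|lborel. f x * fexp (- (x * \<xi>)))"
proof -
  have "exp (- 2 * of_real pi * \<i> * of_real x * of_real \<xi>) = fexp (- (x * \<xi>))" for x
    by (simp add: fexp_def cis_conv_exp mult_ac)
  then show ?thesis by (simp add: fourier_L1_def)
qed

lemma fexp_mult_integrable:
  assumes "integrable lborel f" and [measurable]: "g \<in> borel_measurable borel"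
  shows "integrable lborel (\<lambda>x. f x * fexp (g x))"
  by (rule Bochner_Integration.integrable_bound[OF assms(1)])
    (use assms in \<open>auto simp: norm_mult\<close>)

lemma borel_measurable_fourier_L1 [measurable]:
  assumes [measurable]: "f \<in> borel_measurable lborel"
  shows "fourier_L1 f \<in> borel_measurable borel"
  unfolding fourier_L1_eq[abs_def] by measurable

lemma fourier_L1_bound:
  assumes "integrable lborel f"
  shows "cmod (fourier_L1 f \<xi>) \<le> (LINT x|lborel. cmod (f x))"
proof -
  have "cmod (fourier_L1 f \<xi>) \<le> (LINT x|lborel. cmod (f x * fexp (- (x * \<xi>))))"
    unfolding fourier_L1_eq by (rule integral_norm_bound)
  then show ?thesis by (simp add: norm_mult)
qed

lemma integrable_tensor:
  fixes f g :: "real \<Rightarrow> complex"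
  assumes f: "integrable lborel f" and g: "integrable lborel g"
    and [measurable]: "k \<in> borel_measurable (borel \<Otimes>\<^sub>M borel)" and k: "\<And>p. cmod (k p) \<le> 1"
  shows "integrable (lborel \<Otimes>\<^sub>M lborel) (\<lambda>(x, y). f x * g y * k (x, y))"
proof -
  have [measurable]: "f \<in> borel_measurable borel" "g \<in> borel_measurable borel" using f g by auto
  have "integrable (lborel \<Otimes>\<^sub>M lborel) (\<lambda>p. f (fst p) * g (snd p))"
    by (rule lborel_pair.Fubini_integrable) (use f g in \<open>auto simp: norm_mult\<close>)
  then show ?thesis
    by (rule Bochner_Integration.integrable_bound)
      (auto simp: norm_mult split_beta intro!: mult_left_le k)
qed

text \<open>The kernel is symmetric in its two variables, so Fubini moves the transform from one
  factor to the other.\<close>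

theorem fourier_L1_multiplication:
  assumes f: "integrable lborel f" and g: "integrable lborel g"
  shows "(LINT \<xi>|lborel. fourier_L1 f \<xi> * g \<xi>) = (LINT x|lborel. f x * fourier_L1 g x)"
proof -
  have [measurable]: "f \<in> borel_measurable borel" "g \<in> borel_measurable borel" using f g by auto
  have "(LINT \<xi>|lborel. fourier_L1 f \<xi> * g \<xi>)
      = (LINT \<xi>|lborel. LINT x|lborel. f x * g \<xi> * fexp (- (x * \<xi>)))"
    unfolding fourier_L1_eq by (simp add: mult.assoc mult.left_commute mult.commute flip: integral_mult_right_zero)
  also have "\<dots> = (LINT x|lborel. LINT \<xi>|lborel. f x * g \<xi> * fexp (- (x * \<xi>)))"
    by (rule lborel_pair.Fubini_integral)
      (use integrable_tensor[OF f g, of "\<lambda>(x, y). fexp (- (x * y))"] in \<open>auto simp: split_beta\<close>)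
  also have "\<dots> = (LINT x|lborel. f x * fourier_L1 g x)"
    unfolding fourier_L1_eq by (simp add: mult.assoc mult.left_commute mult.commute)
  finally show ?thesis .
qed

text \<open>\<open>A\<close> is the convolution of \<open>f\<close> with its conjugated reflection.
  It links both sides of Plancherel's identity: its transform is the squared modulus of the
  transform of \<open>f\<close>, and its value at 0 is the squared norm of \<open>f\<close>.\<close>

lemma fourier_L1_autocorrelation:
  assumes f: "integrable lborel f"
  defines "A \<equiv> \<lambda>s. LINT x|lborel. f x * cnj (f (x - s))"
  shows "integrable lborel A" and "fourier_L1 A \<xi> = of_real ((cmod (fourier_L1 f \<xi>))\<^sup>2)"
proof -
  have fm [measurable]: "f \<in> borel_measurable borel" using f by auto
  have inner: "(LINT s|lborel. h (x - s)) = (LINT y|lborel. h y)" for h :: "real \<Rightarrow> 'b::{banach, second_countable_topology}" and x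
    using lborel_integral_real_affine[of "-1" h x] by simp
  have inner': "integrable lborel (\<lambda>s. h (x - s)) \<longleftrightarrow> integrable lborel h" for h :: "real \<Rightarrow> 'b::{banach, second_countable_topology}" and x
    using lborel_integrable_real_affine_iff[of "-1" h x] by simp
  have int: "integrable (lborel \<Otimes>\<^sub>M lborel) (\<lambda>(x, s). f x * cnj (f (x - s)))"
  proof (rule lborel_pair.Fubini_integrable)
    have "(\<lambda>x. LINT s|lborel. norm (f x * cnj (f (x - s)))) = (\<lambda>x. norm (f x) * (LINT y|lborel. norm (f y)))"
      using inner[of "\<lambda>y. norm (f y)"] by (simp add: norm_mult fun_eq_iff)
    then show "integrable lborel (\<lambda>x. LINT s|lborel. norm (case (x, s) of (x, s) \<Rightarrow> f x * cnj (f (x - s))))"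
      using f by simp
    show "AE x in lborel. integrable lborel (\<lambda>s. case (x, s) of (x, s) \<Rightarrow> f x * cnj (f (x - s)))"
      using inner'[of "\<lambda>y. cnj (f y)"] f by (intro AE_I2) (auto intro!: integrable_mult_right)
  qed measurable
  show "integrable lborel A"
    unfolding A_def using lborel_pair.integrable_snd[OF int] by simp
  have int2: "integrable (lborel \<Otimes>\<^sub>M lborel) (\<lambda>(x, s). f x * cnj (f (x - s)) * fexp (- (s * \<xi>)))"
    by (rule Bochner_Integration.integrable_bound[OF int]) (auto simp: norm_mult split_beta)
  have "fourier_L1 A \<xi> = (LINT s|lborel. LINT x|lborel. f x * cnj (f (x - s)) * fexp (- (s * \<xi>)))"
    unfolding fourier_L1_eq A_def by simp
  also have "\<dots> = (LINT x|lborel. LINT s|lborel. f x * cnj (f (x - s)) * fexp (- (s * \<xi>)))"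
    by (rule lborel_pair.Fubini_integral) (use int2 in simp)
  also have "\<dots> = (LINT x|lborel. f x * fexp (- (x * \<xi>)) * cnj (fourier_L1 f \<xi>))"
  proof (rule Bochner_Integration.integral_cong[OF refl])
    fix x
    \<comment> \<open>Writing -s as -x + (x - s) splits the character so that the inner integral
      depends on \<open>x - s\<close> only and becomes independent of \<open>x\<close>.\<close>
    have "(LINT s|lborel. f x * cnj (f (x - s)) * fexp (- (s * \<xi>)))
        = (LINT s|lborel. f x * fexp (- (x * \<xi>)) * (cnj (f (x - s)) * fexp ((x - s) * \<xi>)))"
      by (intro Bochner_Integration.integral_cong refl)
        (simp add: algebra_simps flip: fexp_add)
    also have "\<dots> = f x * fexp (- (x * \<xi>)) * (LINT s|lborel. cnj (f (x - s)) * fexp ((x - s) * \<xi>))"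
      by simp
    also have "(LINT s|lborel. cnj (f (x - s)) * fexp ((x - s) * \<xi>)) = (LINT y|lborel. cnj (f y) * fexp (y * \<xi>))"
      by (rule inner)
    also have "\<dots> = cnj (fourier_L1 f \<xi>)"
      unfolding fourier_L1_eq by (simp add: cnj_fexp flip: Bochner_Integration.integral_cnj)
    finally show "(LINT s|lborel. f x * cnj (f (x - s)) * fexp (- (s * \<xi>)))
        = f x * fexp (- (x * \<xi>)) * cnj (fourier_L1 f \<xi>)" .
  qed
  also have "\<dots> = fourier_L1 f \<xi> * cnj (fourier_L1 f \<xi>)"
    unfolding fourier_L1_eq by simp
  also have "\<dots> = of_real ((cmod (fourier_L1 f \<xi>))\<^sup>2)"
    by (rule complex_norm_square[symmetric])
  finally show "fourier_L1 A \<xi> = of_real ((cmod (fourier_L1 f \<xi>))\<^sup>2)" .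
qed

text \<open>The substitution u = e * xi reduces this to the characteristic function of the standard
  normal distribution.\<close>

lemma fourier_L1_gaussian:
  assumes e: "e > 0"
  shows "fourier_L1 (\<lambda>\<xi>. of_real (exp (- (e * \<xi>)\<^sup>2 / 2))) s
    = of_real (sqrt (2 * pi) / e * exp (- (2 * pi * s / e)\<^sup>2 / 2))"
proof -
  have char: "(LINT u|lborel. of_real (std_normal_density u) * fexp (- (u * t))) = of_real (exp (- (2 * pi * t)\<^sup>2 / 2))" for t
  proof -
    have "(LINT u|lborel. of_real (std_normal_density u) * fexp (- (u * t)))
       = (LINT u|lborel. std_normal_density u *\<^sub>R iexp ((- 2 * pi * t) * u))"
      by (intro Bochner_Integration.integral_cong refl)
        (simp add: fexp_def cis_conv_exp scaleR_conv_of_real mult_ac)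
    also have "\<dots> = char std_normal_distribution (- 2 * pi * t)"
      unfolding char_def by (subst integral_density) (auto simp: normal_density_nonneg)
    finally show ?thesis by (simp add: char_std_normal_distribution)
  qed
  have "fourier_L1 (\<lambda>\<xi>. of_real (exp (- (e * \<xi>)\<^sup>2 / 2))) s
      = \<bar>1/e\<bar> *\<^sub>R (LINT u|lborel. of_real (exp (- (e * (0 + (1/e) * u))\<^sup>2 / 2)) * fexp (- ((0 + (1/e) * u) * s)))"
    unfolding fourier_L1_eq by (rule lborel_integral_real_affine) (use e in simp)
  also have "\<dots> = (1/e) *\<^sub>R (LINT u|lborel. of_real (sqrt (2 * pi)) * (of_real (std_normal_density u) * fexp (- (u * (s / e)))))"
  proof -
    have c: "exp (- u\<^sup>2 / 2) = sqrt (2 * pi) * std_normal_density u" for u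
      by (simp add: std_normal_density_def)
    have "e * (0 + (1/e) * u) = u" "(0 + (1/e) * u) * s = u * (s / e)" for u
      using e by simp_all
    then show ?thesis
      using e by (simp only: c of_real_mult mult.assoc abs_of_pos zero_less_divide_1_iff)
  qed
  also have "\<dots> = of_real (sqrt (2 * pi) / e * exp (- (2 * pi * s / e)\<^sup>2 / 2))"
    by (simp only: integral_mult_right_zero char) (simp add: scaleR_conv_of_real)
  finally show ?thesis .
qed

lemma integrable_gaussian:
  assumes e: "e > 0"
  shows "integrable lborel (\<lambda>x::real. exp (- (e * x)\<^sup>2 / 2))"
proof -
  have "integrable lborel (\<lambda>x. sqrt (2 * pi) * std_normal_density (0 + e * x))"
    using e lborel_integrable_real_affine_iff[of e std_normal_density 0]
    by (intro integrable_mult_right) simp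
  then show ?thesis by (simp add: std_normal_density_def)
qed

text \<open>Gaussian summation. The integral of |f^|^2 against a widening Gaussian equals, by the
  multiplication formula, an average of the autocorrelation \<open>A\<close> over a normal
  distribution shrinking to the origin. Continuity of translations makes \<open>A\<close> continuous
  at 0, so these averages tend to \<open>A 0\<close>, while the Gaussian integrals increase to the
  integral of |f^|^2.\<close>

theorem Plancherel_L1:
  assumes f: "integrable lborel f" and f2: "f \<in> L2"
  shows "fourier_L1 f \<in> L2" and "l2_norm (fourier_L1 f) = l2_norm f"
proof -
  have fm [measurable]: "f \<in> borel_measurable borel" using f by auto
  define A where "A s = (LINT x|lborel. f x * cnj (f (x - s)))" for s
  have A: "integrable lborel A" "\<And>\<xi>. fourier_L1 A \<xi> = of_real ((cmod (fourier_L1 f \<xi>))\<^sup>2)"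
    unfolding A_def[abs_def] using fourier_L1_autocorrelation[OF f] by auto
  have [measurable]: "A \<in> borel_measurable borel" using A by auto
  have A_inner: "A s = l2_inner f (\<lambda>x. f (x - s))" for s
    by (simp add: A_def l2_inner_def)
  define e where "e n = 1 / real (Suc n)" for n
  have e: "e n > 0" "e \<longlonglongrightarrow> 0" for n
    using LIMSEQ_inverse_real_of_nat by (simp_all add: e_def[abs_def] inverse_eq_divide)
  define G where "G n \<xi> = exp (- (e n * \<xi>)\<^sup>2 / 2)" for n \<xi>
  have G: "integrable lborel (G n)" for n unfolding G_def[abs_def] by (rule integrable_gaussian[OF e(1)])
  let ?p = "\<lambda>n \<xi>. (cmod (fourier_L1 f \<xi>))\<^sup>2 * G n \<xi>"
  have eq: "of_real (LINT \<xi>|lborel. ?p n \<xi>)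
      = (LINT u|lborel. A (e n / (2 * pi) * u) * of_real (std_normal_density u))" for n
  proof -
    have "of_real (LINT \<xi>|lborel. ?p n \<xi>)
        = (LINT \<xi>|lborel. fourier_L1 A \<xi> * of_real (G n \<xi>))"
      by (simp only: A(2) of_real_mult[symmetric] integral_complex_of_real)
    also have "\<dots> = (LINT s|lborel. A s * fourier_L1 (\<lambda>\<xi>. of_real (G n \<xi>)) s)"
      by (rule fourier_L1_multiplication) (use A G in auto)
    also have "\<dots> = (LINT s|lborel. A s * of_real (sqrt (2 * pi) / e n * exp (- (2 * pi * s / e n)\<^sup>2 / 2)))"
      unfolding G_def by (simp only: fourier_L1_gaussian[OF e(1)])
    \<comment> \<open>The scale \<open>e n / (2 * pi)\<close> is the one that turns the transformed
      Gaussian into the standard normal density.\<close>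
    also have "\<dots> = \<bar>e n / (2 * pi)\<bar> *\<^sub>R (LINT u|lborel. A (0 + (e n / (2 * pi)) * u)
        * of_real (sqrt (2 * pi) / e n * exp (- (2 * pi * (0 + (e n / (2 * pi)) * u) / e n)\<^sup>2 / 2)))"
      by (rule lborel_integral_real_affine) (use e(1)[of n] in simp)
    also have "\<dots> = (LINT u|lborel. A (e n / (2 * pi) * u) * of_real (e n / (2 * pi) * (sqrt (2 * pi) / e n * exp (- u\<^sup>2 / 2))))"
      unfolding integral_scaleR_right[symmetric] using e(1)[of n]
      by (intro Bochner_Integration.integral_cong refl) (simp add: scaleR_conv_of_real mult_ac)
    also have "\<dots> = (LINT u|lborel. A (e n / (2 * pi) * u) * of_real (std_normal_density u))"
    proof -
      have "e n / (2 * pi) * (sqrt (2 * pi) / e n * exp (- u\<^sup>2 / 2)) = std_normal_density u" for u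
        using e(1)[of n] by (simp add: std_normal_density_def field_simps flip: real_sqrt_mult)
      then show ?thesis by (simp only:)
    qed
    finally show ?thesis .
  qed
  have "(\<lambda>n. LINT u|lborel. A (e n / (2 * pi) * u) * of_real (std_normal_density u))
      \<longlonglongrightarrow> (LINT u|lborel. A 0 * of_real (std_normal_density u))"
  \<comment> \<open>By Cauchy-Schwarz and translation invariance of the norm, \<open>A\<close> is
    bounded by the squared norm of \<open>f\<close>; this gives the majorant.\<close>
  proof (rule integral_dominated_convergence[where w="\<lambda>u. (l2_norm f)\<^sup>2 * std_normal_density u"])
    show "AE u in lborel. (\<lambda>n. A (e n / (2 * pi) * u) * of_real (std_normal_density u))
        \<longlonglongrightarrow> A 0 * of_real (std_normal_density u)"
    proof (intro AE_I2 tendsto_mult_right)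
      fix u :: real
      have "(\<lambda>n. e n / (2 * pi) * u) \<longlonglongrightarrow> 0 / (2 * pi) * u" by (intro tendsto_intros e) simp
      then have "l2_tendsto (\<lambda>n x. f (x - e n / (2 * pi) * u)) f"
        using L2_shift_continuous[OF f2, of "\<lambda>n. e n / (2 * pi) * u"] f2 by (auto simp: l2_tendsto_def L2_shift)
      from l2_tendsto_inner[OF l2_tendsto_const[OF f2] this]
      show "(\<lambda>n. A (e n / (2 * pi) * u)) \<longlonglongrightarrow> A 0" by (simp add: A_inner)
    qed
    show "AE u in lborel. norm (A (e n / (2 * pi) * u) * of_real (std_normal_density u))
        \<le> (l2_norm f)\<^sup>2 * std_normal_density u" for n
    proof (rule AE_I2)
      fix u
      have "cmod (A (e n / (2 * pi) * u)) \<le> l2_norm f * l2_norm (\<lambda>x. f (x - e n / (2 * pi) * u))"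
        unfolding A_inner by (rule l2_Cauchy_Schwarz[OF f2 L2_shift[OF f2]])
      then show "norm (A (e n / (2 * pi) * u) * of_real (std_normal_density u)) \<le> (l2_norm f)\<^sup>2 * std_normal_density u"
        by (simp add: norm_mult l2_norm_shift power2_eq_square mult_right_mono)
    qed
  qed auto
  also have "(LINT u|lborel. A 0 * of_real (std_normal_density u)) = A 0"
    by simp
  also have "A 0 = of_real ((l2_norm f)\<^sup>2)"
    using l2_inner_self[of f] by (simp add: A_inner)
  finally have "(\<lambda>n. of_real (LINT \<xi>|lborel. ?p n \<xi>) :: complex) \<longlonglongrightarrow> of_real ((l2_norm f)\<^sup>2)"
    by (simp only: eq)
  then have lim: "(\<lambda>n. LINT \<xi>|lborel. ?p n \<xi>) \<longlonglongrightarrow> (l2_norm f)\<^sup>2"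
    by (simp only: tendsto_of_real_iff)
  \<comment> \<open>The transform of an integrable function is bounded by its L1 norm, so a Gaussian
    weight makes its square integrable before square integrability of the transform is
    known.\<close>
  have int: "integrable lborel (\<lambda>\<xi>. ?p n \<xi>)" for n
  proof (rule Bochner_Integration.integrable_bound)
    show "integrable lborel (\<lambda>\<xi>. (LINT x|lborel. cmod (f x))\<^sup>2 * G n \<xi>)" using G by simp
    show "AE \<xi> in lborel. norm (?p n \<xi>) \<le> norm ((LINT x|lborel. cmod (f x))\<^sup>2 * G n \<xi>)"
      by (intro AE_I2) (auto simp: abs_mult G_def intro!: power_mono fourier_L1_bound f)
  qed (simp add: G_def[abs_def])
  have mono: "mono (\<lambda>n. ?p n \<xi>)" for \<xi>
  proof (rule monoI)
    fix m n :: nat assume "m \<le> n"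
    then have "e n \<le> e m" by (simp add: e_def frac_le)
    then have "(e n * \<xi>)\<^sup>2 \<le> (e m * \<xi>)\<^sup>2"
      using e(1) by (simp add: power_mult_distrib mult_right_mono power_mono less_imp_le)
    then show "(cmod (fourier_L1 f \<xi>))\<^sup>2 * G m \<xi> \<le> ?p n \<xi>"
      by (simp add: G_def mult_left_mono)
  qed
  have ptw: "(\<lambda>n. ?p n \<xi>) \<longlonglongrightarrow> (cmod (fourier_L1 f \<xi>))\<^sup>2" for \<xi>
  proof -
    have "(\<lambda>n. (cmod (fourier_L1 f \<xi>))\<^sup>2 * exp (- (e n * \<xi>)\<^sup>2 / 2)) \<longlonglongrightarrow> (cmod (fourier_L1 f \<xi>))\<^sup>2 * exp (- (0 * \<xi>)\<^sup>2 / 2)"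
      by (intro tendsto_intros e) simp
    then show ?thesis by (simp add: G_def)
  qed
  \<comment> \<open>Since the limit of the integrals is already known to be finite, monotone
    convergence delivers integrability of |f^|^2 together with the value of its integral.\<close>
  note mc = integral_monotone_convergence_nonneg[where f="?p", OF int _ _ _ lim]
  have "integrable lborel (\<lambda>\<xi>. (cmod (fourier_L1 f \<xi>))\<^sup>2)"
    by (rule mc(1)) (use mono ptw in \<open>auto simp: G_def\<close>)
  then show "fourier_L1 f \<in> L2" by (simp add: L2_def)
  have "(LINT \<xi>|lborel. (cmod (fourier_L1 f \<xi>))\<^sup>2) = (l2_norm f)\<^sup>2"
    by (rule mc(2)) (use mono ptw in \<open>auto simp: G_def\<close>)
  then show "l2_norm (fourier_L1 f) = l2_norm f"
    by (simp add: l2_norm_def[of "fourier_L1 f"])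
qed

lemma fourier_L1_diff:
  assumes "integrable lborel f" "integrable lborel g"
  shows "fourier_L1 (\<lambda>x. f x - g x) \<xi> = fourier_L1 f \<xi> - fourier_L1 g \<xi>"
  using assms by (simp add: fourier_L1_eq left_diff_distrib fexp_mult_integrable)

lemma fourier_L1_add:
  assumes "integrable lborel f" "integrable lborel g"
  shows "fourier_L1 (\<lambda>x. f x + g x) \<xi> = fourier_L1 f \<xi> + fourier_L1 g \<xi>"
  using assms by (simp add: fourier_L1_eq distrib_right fexp_mult_integrable)

lemma fourier_L1_cmult: "fourier_L1 (\<lambda>x. c * f x) \<xi> = c * fourier_L1 f \<xi>"
  by (simp add: fourier_L1_eq mult.assoc)

lemma fourier_L1_shift: "fourier_L1 (\<lambda>x. f (x - s)) \<xi> = fexp (- (s * \<xi>)) * fourier_L1 f \<xi>"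
proof -
  have "fourier_L1 (\<lambda>x. f (x - s)) \<xi> = (LINT x|lborel. (\<lambda>y. f y * fexp (- ((y + s) * \<xi>))) (x - s))"
    by (simp add: fourier_L1_eq)
  also have "\<dots> = (LINT y|lborel. f y * fexp (- ((y + s) * \<xi>)))"
    by (rule lborel_integral_shift)
  also have "\<dots> = (LINT y|lborel. fexp (- (s * \<xi>)) * (f y * fexp (- (y * \<xi>))))"
    by (intro Bochner_Integration.integral_cong refl) (simp add: algebra_simps flip: fexp_add)
  finally show ?thesis by (simp add: fourier_L1_eq)
qed

section \<open>Extension of the Fourier transform to \<open>L2\<close>: isometry and
  surjectivity\<close>

lemma l2_truncation:
  assumes f: "f \<in> L2"
  obtains X where "\<And>n. integrable lborel (X n)" "l2_tendsto X f"
proof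
  define X where "X n x = f x * cnj (indicator {-real n<..<real n} x)" for n x
  have [measurable]: "f \<in> borel_measurable borel" using L2_measurable[OF f] by simp
  show int: "integrable lborel (X n)" for n
    unfolding X_def[abs_def] by (intro L2_mult_cnj f indicator_interval_L2)
  have XL: "X n \<in> L2" for n
    unfolding X_def[abs_def] L2_iff
    by (rule square_integrable_dominated[where h="\<lambda>x. (cmod (f x))\<^sup>2"])
      (use f in \<open>auto simp: L2_def indicator_def\<close>)
  have "(\<lambda>n. LINT x|lborel. (cmod (X n x - f x))\<^sup>2) \<longlonglongrightarrow> (LINT x|(lborel :: real measure). 0)"
  proof (rule integral_dominated_convergence[where w="\<lambda>x. (cmod (f x))\<^sup>2"])
    show "AE x in lborel. (\<lambda>n. (cmod (X n x - f x))\<^sup>2) \<longlonglongrightarrow> 0"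
    proof (intro AE_I2 tendsto_eventually)
      fix x :: real
      obtain N where "\<bar>x\<bar> < real N" using reals_Archimedean2 by blast
      then have "x \<in> {-real n<..<real n}" if "n \<ge> N" for n
        using that by (auto simp: abs_less_iff)
      then show "\<forall>\<^sub>F n in sequentially. (cmod (X n x - f x))\<^sup>2 = 0"
        unfolding eventually_sequentially X_def by (intro exI[of _ N]) auto
    qed
  qed (use f in \<open>auto simp: L2_def X_def indicator_def\<close>)
  then have "(\<lambda>n. sqrt (LINT x|lborel. (cmod (X n x - f x))\<^sup>2)) \<longlonglongrightarrow> sqrt 0"
    by (intro tendsto_intros) simp
  then show "l2_tendsto X f"
    using XL f by (simp add: l2_tendsto_def l2_norm_def)
qed

lemma l2_tendsto_diff:
  assumes "l2_tendsto X f" "l2_tendsto Y g"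
  shows "l2_tendsto (\<lambda>n x. X n x - Y n x) (\<lambda>x. f x - g x)"
  using l2_tendsto_add[OF assms(1) l2_tendsto_cmult[OF assms(2), of "-1"]] by simp

lemma l2_tendsto_cnj: "l2_tendsto X f \<Longrightarrow> l2_tendsto (\<lambda>n x. cnj (X n x)) (\<lambda>x. cnj (f x))"
  using l2_norm_cnj[of "\<lambda>x. X _ x - f x"] by (simp add: l2_tendsto_def L2_cnj)

lemma l2_tendsto_if_close:
  assumes X: "l2_tendsto X f" and Y: "\<And>n. Y n \<in> L2"
    and d: "(\<lambda>n. l2_dist (Y n) (X n)) \<longlonglongrightarrow> 0"
  shows "l2_tendsto Y f"
proof -
  have XL: "X n \<in> L2" and fL: "f \<in> L2" for n using X by (auto simp: l2_tendsto_def)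
  have "(\<lambda>n. l2_dist (Y n) (X n) + l2_dist (X n) f) \<longlonglongrightarrow> 0 + 0"
    using X d by (intro tendsto_add) (auto simp: l2_tendsto_def)
  moreover have "norm (l2_dist (Y n) f) \<le> l2_dist (Y n) (X n) + l2_dist (X n) f" for n
    using l2_norm_triangle_diff[OF Y XL fL, of n n] by simp
  ultimately have "(\<lambda>n. l2_dist (Y n) f) \<longlonglongrightarrow> 0"
    by (auto intro: Lim_null_comparison[rotated])
  then show ?thesis using Y fL by (simp add: l2_tendsto_def)
qed

text \<open>Isometry makes the transforms of one approximating sequence Cauchy. Any other
  approximating sequence differs from it by a null sequence, again by isometry, so a single limit
  serves all of them, as \<open>has_L2_fourier\<close> demands.\<close>

lemma has_L2_fourier_exists:
  assumes f: "f \<in> L2"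
  shows "\<exists>F. has_L2_fourier f F"
proof -
  obtain X where X: "\<And>n. integrable lborel (X n)" "l2_tendsto X f"
    using l2_truncation[OF f] by blast
  have XL: "X n \<in> L2" for n using X by (auto simp: l2_tendsto_def)
  have FL: "fourier_L1 (X n) \<in> L2" for n by (rule Plancherel_L1[OF X(1) XL])
  have iso: "l2_norm (\<lambda>\<xi>. fourier_L1 g \<xi> - fourier_L1 h \<xi>) = l2_dist g h"
    if "integrable lborel g" "g \<in> L2" "integrable lborel h" "h \<in> L2" for g h
  proof -
    have "fourier_L1 (\<lambda>x. g x - h x) = (\<lambda>\<xi>. fourier_L1 g \<xi> - fourier_L1 h \<xi>)"
      using that by (simp add: fun_eq_iff fourier_L1_diff)
    then show ?thesis using Plancherel_L1(2)[of "\<lambda>x. g x - h x"] that by (simp add: L2_diff)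
  qed
  have "\<exists>N. \<forall>m\<ge>N. \<forall>n\<ge>N. l2_norm (\<lambda>\<xi>. fourier_L1 (X m) \<xi> - fourier_L1 (X n) \<xi>) < e" if "e > 0" for e
  proof -
    have e2: "0 < e/2" using that by simp
    obtain N where N: "\<And>n. n \<ge> N \<Longrightarrow> l2_dist (X n) f < e/2"
      using l2_tendstoD[OF X(2) e2] by blast
    have "l2_dist (X m) (X n) < e" if "m \<ge> N" "n \<ge> N" for m n
      using l2_norm_triangle_diff[OF XL f XL, of m n] N[OF that(1)] N[OF that(2)]
        l2_norm_minus_commute[of f "X n"] by simp
    then show ?thesis by (auto simp: iso[OF X(1) XL X(1) XL])
  qed
  from L2_complete[OF FL this] obtain F where F: "l2_tendsto (\<lambda>n. fourier_L1 (X n)) F" by blast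
  have "has_L2_fourier f F"
    unfolding has_L2_fourier_def
  proof (intro conjI allI impI)
    show "F \<in> L2" using F by (auto simp: l2_tendsto_def)
    fix Y assume Y: "(\<forall>n. integrable lborel (Y n)) \<and> l2_tendsto Y f"
    then have YL: "Y n \<in> L2" for n by (auto simp: l2_tendsto_def)
    have "l2_tendsto (\<lambda>n x. Y n x - X n x) (\<lambda>x. f x - f x)"
      using Y X by (intro l2_tendsto_diff) auto
    then have "(\<lambda>n. l2_dist (Y n) (X n)) \<longlonglongrightarrow> 0" by (simp add: l2_tendsto_def)
    then show "l2_tendsto (\<lambda>n. fourier_L1 (Y n)) F"
      using Y YL X XL Plancherel_L1(1) by (intro l2_tendsto_if_close[OF F]) (auto simp: iso)
  qed
  then show ?thesis by blast
qed

lemma fourier_L2: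
  assumes "f \<in> L2"
  shows "fourier f \<in> L2"
    and "(\<And>n. integrable lborel (X n)) \<Longrightarrow> l2_tendsto X f \<Longrightarrow> l2_tendsto (\<lambda>n. fourier_L1 (X n)) (fourier f)"
proof -
  have "has_L2_fourier f (fourier f)"
    unfolding fourier_def by (rule someI_ex[OF has_L2_fourier_exists[OF assms]])
  then show "fourier f \<in> L2"
    and "(\<And>n. integrable lborel (X n)) \<Longrightarrow> l2_tendsto X f \<Longrightarrow> l2_tendsto (\<lambda>n. fourier_L1 (X n)) (fourier f)"
    unfolding has_L2_fourier_def by auto
qed

lemma borel_measurable_fourier [simp, measurable]: "f \<in> L2 \<Longrightarrow> fourier f \<in> borel_measurable borel"
  using L2_measurable[OF fourier_L2(1)] by simp

lemma fourier_approx: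
  assumes f: "f \<in> L2"
  obtains X where "\<And>n. integrable lborel (X n)" "l2_tendsto X f" "l2_tendsto (\<lambda>n. fourier_L1 (X n)) (fourier f)"
proof -
  obtain X where "\<And>n. integrable lborel (X n)" "l2_tendsto X f" using l2_truncation[OF f] by blast
  then show ?thesis using fourier_L2(2)[OF f] that by blast
qed

lemma fourier_add:
  assumes f: "f \<in> L2" and g: "g \<in> L2"
  shows "AE \<xi> in lborel. fourier (\<lambda>x. f x + g x) \<xi> = fourier f \<xi> + fourier g \<xi>"
proof -
  obtain X where X: "\<And>n. integrable lborel (X n)" "l2_tendsto X f" "l2_tendsto (\<lambda>n. fourier_L1 (X n)) (fourier f)"
    using fourier_approx[OF f] by blast
  obtain Y where Y: "\<And>n. integrable lborel (Y n)" "l2_tendsto Y g" "l2_tendsto (\<lambda>n. fourier_L1 (Y n)) (fourier g)"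
    using fourier_approx[OF g] by blast
  have "l2_tendsto (\<lambda>n. fourier_L1 (\<lambda>x. X n x + Y n x)) (fourier (\<lambda>x. f x + g x))"
    using X Y by (intro fourier_L2(2) L2_add l2_tendsto_add f g) auto
  moreover have "l2_tendsto (\<lambda>n. fourier_L1 (\<lambda>x. X n x + Y n x)) (\<lambda>\<xi>. fourier f \<xi> + fourier g \<xi>)"
  proof -
    have "fourier_L1 (\<lambda>x. X n x + Y n x) = (\<lambda>\<xi>. fourier_L1 (X n) \<xi> + fourier_L1 (Y n) \<xi>)" for n
      using X Y by (simp add: fun_eq_iff fourier_L1_add)
    then show ?thesis using l2_tendsto_add[OF X(3) Y(3)] by simp
  qed
  ultimately show ?thesis by (rule l2_tendsto_unique)
qed

lemma fourier_cmult:
  assumes f: "f \<in> L2"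
  shows "AE \<xi> in lborel. fourier (\<lambda>x. c * f x) \<xi> = c * fourier f \<xi>"
proof -
  obtain X where X: "\<And>n. integrable lborel (X n)" "l2_tendsto X f" "l2_tendsto (\<lambda>n. fourier_L1 (X n)) (fourier f)"
    using fourier_approx[OF f] by blast
  have "l2_tendsto (\<lambda>n. fourier_L1 (\<lambda>x. c * X n x)) (fourier (\<lambda>x. c * f x))"
    using X by (intro fourier_L2(2) L2_cmult l2_tendsto_cmult f) auto
  moreover have "l2_tendsto (\<lambda>n. fourier_L1 (\<lambda>x. c * X n x)) (\<lambda>\<xi>. c * fourier f \<xi>)"
    using l2_tendsto_cmult[OF X(3)] by (simp add: fourier_L1_cmult[abs_def])
  ultimately show ?thesis by (rule l2_tendsto_unique)
qed

lemma fourier_diff: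
  assumes f: "f \<in> L2" and g: "g \<in> L2"
  shows "AE \<xi> in lborel. fourier (\<lambda>x. f x - g x) \<xi> = fourier f \<xi> - fourier g \<xi>"
  using fourier_add[OF f L2_cmult[OF g, of "-1"]] fourier_cmult[OF g, of "-1"]
  by eventually_elim simp

lemma l2_norm_unimodular_mult:
  assumes "\<And>x. cmod (c x) = 1"
  shows "l2_norm (\<lambda>x. c x * f x) = l2_norm f"
  by (simp add: l2_norm_def norm_mult assms)

lemma fourier_shift:
  assumes f: "f \<in> L2"
  shows "AE \<xi> in lborel. fourier (\<lambda>x. f (x - s)) \<xi> = fexp (- (s * \<xi>)) * fourier f \<xi>"
proof -
  obtain X where X: "\<And>n. integrable lborel (X n)" "l2_tendsto X f" "l2_tendsto (\<lambda>n. fourier_L1 (X n)) (fourier f)"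
    using fourier_approx[OF f] by blast
  have "l2_tendsto (\<lambda>n. fourier_L1 (\<lambda>x. X n (x - s))) (fourier (\<lambda>x. f (x - s)))"
    using X by (intro fourier_L2(2) L2_shift l2_tendsto_shift f) (auto simp: lborel_integrable_shift_iff)
  moreover have "l2_tendsto (\<lambda>n. fourier_L1 (\<lambda>x. X n (x - s))) (\<lambda>\<xi>. fexp (- (s * \<xi>)) * fourier f \<xi>)"
    using X(3) unfolding l2_tendsto_def fourier_L1_shift[abs_def]
    by (auto simp: L2_bounded_mult[of _ _ 1] l2_norm_unimodular_mult simp flip: right_diff_distrib)
  ultimately show ?thesis by (rule l2_tendsto_unique)
qed

theorem fourier_norm:
  assumes f: "f \<in> L2"
  shows "l2_norm (fourier f) = l2_norm f"
proof -
  obtain X where X: "\<And>n. integrable lborel (X n)" "l2_tendsto X f" "l2_tendsto (\<lambda>n. fourier_L1 (X n)) (fourier f)"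
    using fourier_approx[OF f] by blast
  then have "l2_norm (fourier_L1 (X n)) = l2_norm (X n)" for n
    by (intro Plancherel_L1) (auto simp: l2_tendsto_def)
  then show ?thesis
    using l2_tendsto_norm[OF X(2)] l2_tendsto_norm[OF X(3)] LIMSEQ_unique by auto
qed

text \<open>Polarization: the norms of sums determine the real part of the inner product, and
  replacing \<open>g\<close> by i times \<open>g\<close> turns the imaginary part into a real
  part.\<close>

theorem fourier_inner:
  assumes f: "f \<in> L2" and g: "g \<in> L2"
  shows "l2_inner (fourier f) (fourier g) = l2_inner f g"
proof -
  have re: "Re (l2_inner (fourier f) (fourier h)) = Re (l2_inner f h)" if h: "h \<in> L2" for h
  proof -
    have "l2_norm (\<lambda>\<xi>. fourier f \<xi> + fourier h \<xi>) = l2_norm (fourier (\<lambda>x. f x + h x))"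
    proof (rule l2_norm_cong_AE)
      show "AE \<xi> in lborel. fourier f \<xi> + fourier h \<xi> = fourier (\<lambda>x. f x + h x) \<xi>"
        using fourier_add[OF f h] by eventually_elim simp
    qed (use f h in \<open>simp_all add: L2_add\<close>)
    also have "\<dots> = l2_norm (\<lambda>x. f x + h x)"
      by (rule fourier_norm[OF L2_add[OF f h]])
    finally show ?thesis
      using l2_norm_sq_add[OF f h] l2_norm_sq_add[OF fourier_L2(1)[OF f] fourier_L2(1)[OF h]]
      by (simp add: fourier_norm f h)
  qed
  have "Im (l2_inner (fourier f) (fourier g)) = Re (l2_inner (fourier f) (\<lambda>x. \<i> * fourier g x))"
    by (simp add: l2_inner_cmult_right)
  also have "l2_inner (fourier f) (\<lambda>x. \<i> * fourier g x) = l2_inner (fourier f) (fourier (\<lambda>x. \<i> * g x))"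
  proof (rule l2_inner_cong_AE)
    show "AE \<xi> in lborel. \<i> * fourier g \<xi> = fourier (\<lambda>x. \<i> * g x) \<xi>"
      using fourier_cmult[OF g, of "\<i>"] by eventually_elim simp
  qed (use f g in \<open>simp_all add: L2_cmult\<close>)
  also have "Re \<dots> = Im (l2_inner f g)"
    by (simp add: re L2_cmult g l2_inner_cmult_right)
  finally show ?thesis using re[OF g] by (simp add: complex_eq_iff)
qed

theorem fourier_multiplication:
  assumes f: "f \<in> L2" and g: "g \<in> L2"
  shows "(LINT x|lborel. fourier f x * g x) = (LINT x|lborel. f x * fourier g x)"
proof -
  obtain X where X: "\<And>n. integrable lborel (X n)" "l2_tendsto X f" "l2_tendsto (\<lambda>n. fourier_L1 (X n)) (fourier f)"
    using fourier_approx[OF f] by blast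
  obtain Y where Y: "\<And>n. integrable lborel (Y n)" "l2_tendsto Y g" "l2_tendsto (\<lambda>n. fourier_L1 (Y n)) (fourier g)"
    using fourier_approx[OF g] by blast
  have "(\<lambda>n. LINT x|lborel. fourier_L1 (X n) x * Y n x) \<longlonglongrightarrow> (LINT x|lborel. fourier f x * g x)"
    using l2_tendsto_inner[OF X(3) l2_tendsto_cnj[OF Y(2)]] by (simp add: l2_inner_def)
  moreover have "(\<lambda>n. LINT x|lborel. X n x * fourier_L1 (Y n) x) \<longlonglongrightarrow> (LINT x|lborel. f x * fourier g x)"
    using l2_tendsto_inner[OF X(2) l2_tendsto_cnj[OF Y(3)]] by (simp add: l2_inner_def)
  ultimately show ?thesis
    using LIMSEQ_unique by (auto simp: fourier_L1_multiplication[OF X(1) Y(1)])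
qed

text \<open>The candidate is the inverse transform, written as the conjugate of the transform of the
  conjugate of \<open>h\<close>. The multiplication formula gives
  \<open>l2_inner h (fourier f)\<close> the value of the squared norm of \<open>h\<close>; as
  \<open>fourier f\<close> has the same norm as \<open>h\<close>, expanding the squared distance
  between them gives 0.\<close>

theorem fourier_surj:
  assumes h: "h \<in> L2"
  shows "\<exists>f\<in>L2. AE \<xi> in lborel. fourier f \<xi> = h \<xi>"
proof -
  define k where "k = fourier (\<lambda>x. cnj (h x))"
  define f where "f x = cnj (k x)" for x
  have k: "k \<in> L2" "l2_norm k = l2_norm h"
    unfolding k_def using fourier_L2(1) fourier_norm L2_cnj[OF h] l2_norm_cnj by auto
  have f: "f \<in> L2" "l2_norm f = l2_norm h"
    unfolding f_def[abs_def] using k L2_cnj l2_norm_cnj by auto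
  have "l2_inner h (fourier f) = cnj (LINT x|lborel. cnj (h x) * fourier f x)"
    by (simp add: l2_inner_def flip: Bochner_Integration.integral_cnj)
  also have "(LINT x|lborel. cnj (h x) * fourier f x) = (LINT x|lborel. k x * f x)"
    unfolding k_def by (rule fourier_multiplication[OF L2_cnj[OF h] f(1), symmetric])
  also have "\<dots> = l2_inner k k"
    by (simp add: l2_inner_def f_def)
  finally have "l2_inner h (fourier f) = of_real ((l2_norm h)\<^sup>2)"
    by (simp add: l2_inner_self k)
  then have "(l2_dist h (fourier f))\<^sup>2 = 0"
    by (simp add: l2_norm_sq_diff[OF h fourier_L2(1)[OF f(1)]] fourier_norm f)
  then have "AE x in lborel. h x - fourier f x = 0"
    using l2_norm_eq_0_iff[OF L2_diff[OF h fourier_L2(1)[OF f(1)]]] by simp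
  then have "AE x in lborel. fourier f x = h x" by eventually_elim simp
  then show ?thesis using f(1) by blast
qed

section \<open>Periodization and brackets\<close>

text \<open>Sums over the integers are integrals for counting measure, so Fubini and Cauchy-Schwarz
  apply to them directly.\<close>

abbreviation (input) int_space :: "int measure" where
  "int_space \<equiv> count_space UNIV"

lemma pair_sigma_finite_lborel_int:
  "pair_sigma_finite (lborel :: real measure) int_space"
  by (intro pair_sigma_finite.intro sigma_finite_lborel sigma_finite_measure_count_space_countable) auto

text \<open>Each real number lies in exactly one integer translate of \<open>{0..<1}\<close>; this
  collapses the sum over translates whenever an integral is unfolded.\<close>

lemma indicator_unit_interval_shift:
  fixes l :: int
  shows "indicator {0..<1} (y - real_of_int l) = (indicator {\<lfloor>y\<rfloor>} l :: 'a::zero_neq_one)"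
proof -
  have "y - real_of_int l \<in> {0..<1} \<longleftrightarrow> l = \<lfloor>y\<rfloor>"
    by (auto simp: floor_eq_iff) linarith+
  then show ?thesis by (auto simp: indicator_def)
qed

lemma nn_integral_shift:
  assumes [measurable]: "h \<in> borel_measurable borel"
  shows "(\<integral>\<^sup>+x. h (x + c) \<partial>lborel) = (\<integral>\<^sup>+x. h x \<partial>(lborel :: real measure))"
  using nn_integral_real_affine[of h 1 c] by (simp add: add.commute)

lemma nn_integral_periodize:
  assumes [measurable]: "h \<in> borel_measurable borel"
  shows "(\<integral>\<^sup>+y. indicator {0..<1} y * (\<integral>\<^sup>+l. h (y + real_of_int l) \<partial>count_space UNIV) \<partial>lborel)
    = (\<integral>\<^sup>+y. h y \<partial>lborel)"
proof -
  interpret pair_sigma_finite "lborel :: real measure" "int_space"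
    by (rule pair_sigma_finite_lborel_int)
  have "(\<integral>\<^sup>+y. indicator {0..<1} y * (\<integral>\<^sup>+l. h (y + real_of_int l) \<partial>count_space UNIV) \<partial>lborel)
      = (\<integral>\<^sup>+y. \<integral>\<^sup>+l. indicator {0..<1} y * h (y + real_of_int l) \<partial>count_space UNIV \<partial>lborel)"
    by (simp add: nn_integral_cmult)
  also have "\<dots> = (\<integral>\<^sup>+l. \<integral>\<^sup>+y. indicator {0..<1} y * h (y + real_of_int l) \<partial>lborel \<partial>count_space UNIV)"
    by (rule Fubini'[symmetric]) (simp add: split_beta)
  also have "\<dots> = (\<integral>\<^sup>+l. \<integral>\<^sup>+y. indicator {0..<1} (y - real_of_int l) * h y \<partial>lborel \<partial>count_space UNIV)"
  proof (rule nn_integral_cong)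
    fix l :: int
    show "(\<integral>\<^sup>+y. indicator {0..<1} y * h (y + real_of_int l) \<partial>lborel)
        = (\<integral>\<^sup>+y. indicator {0..<1} (y - real_of_int l) * h y \<partial>lborel)"
      using nn_integral_shift[of "\<lambda>y. indicator {0..<1} (y - real_of_int l) * h y" "real_of_int l"]
      by simp
  qed
  also have "\<dots> = (\<integral>\<^sup>+y. \<integral>\<^sup>+l. indicator {0..<1} (y - real_of_int l) * h y \<partial>count_space UNIV \<partial>lborel)"
    by (rule Fubini') (simp add: split_beta)
  also have "\<dots> = (\<integral>\<^sup>+y. h y \<partial>lborel)"
    unfolding indicator_unit_interval_shift by (simp add: nn_integral_multc)
  finally show ?thesis .
qed

lemma AE_lborel_shift:
  fixes c :: real
  assumes "AE x in lborel. P x"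
  shows "AE x in lborel. P (x + c)"
proof -
  obtain N where N: "{x \<in> space lborel. \<not> P x} \<subseteq> N" "emeasure lborel N = 0" "N \<in> sets lborel"
    using AE_E[OF assms] by blast
  have [measurable]: "N \<in> sets borel" using N by simp
  have "AE x in lborel. x \<notin> N" using N by (intro AE_not_in) (auto simp: null_sets_def)
  then have "AE x in lborel. c + 1 * x \<notin> N" by (intro AE_borel_affine) auto
  then show ?thesis by eventually_elim (use N(1) in \<open>auto simp: add.commute\<close>)
qed

lemma AE_lborel_all_shifts:
  assumes "AE x in lborel. P x"
  shows "AE x in lborel. \<forall>l::int. P (x + real_of_int l)"
  unfolding AE_all_countable using AE_lborel_shift[OF assms] by blast

text \<open>The integer translates of a null set still have a null union, and leaving out the
  endpoint 0 costs a null set; the open interval is the form that arises from integrals over open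
  intervals.\<close>

lemma AE_lborel_periodic:
  assumes per: "\<And>x l. P (x + real_of_int l) \<longleftrightarrow> P x"
    and "AE x in lborel. x \<in> {0<..<1} \<longrightarrow> P x"
  shows "AE x in lborel. P x"
proof -
  have "AE x in lborel. x \<in> {0..<1} \<longrightarrow> P x"
    using assms(2) AE_lborel_singleton[of 0] by eventually_elim auto
  from AE_lborel_all_shifts[OF this] show ?thesis
  proof eventually_elim
    fix x :: real assume "\<forall>l. x + real_of_int l \<in> {0..<1} \<longrightarrow> P (x + real_of_int l)"
    from this[rule_format, of "- \<lfloor>x\<rfloor>"] have "P (x + real_of_int (- \<lfloor>x\<rfloor>))"
      by (auto simp: floor_le_iff) linarith
    then show "P x" by (simp only: per)
  qed
qed

lemma bij_betw_int_add: "bij_betw (\<lambda>l. l + m) (UNIV :: int set) UNIV"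
  by (rule bij_betwI[of _ _ _ "\<lambda>l. l - m"]) auto

text \<open>Where the sum does not converge absolutely the value is 0. For integrable
  \<open>G\<close> this concerns a null set only, and the convention keeps the function periodic at
  every point.\<close>

definition periodize :: "(real \<Rightarrow> complex) \<Rightarrow> real \<Rightarrow> complex" where
  "periodize G y = (LINT l|int_space. G (y + real_of_int l))"

lemma periodize_periodic: "periodize G (y + real_of_int m) = periodize G y"
  unfolding periodize_def
  using integral_bij_count_space[OF bij_betw_int_add[of m], of "\<lambda>l. G (y + real_of_int l)"]
  by (simp add: add_ac)

lemma integrable_periodic:
  "integrable (count_space UNIV) (\<lambda>l::int. G (y + real_of_int m + real_of_int l))
    \<longleftrightarrow> integrable (count_space UNIV) (\<lambda>l::int. G (y + real_of_int l) :: 'a :: {banach, second_countable_topology})"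
  using integrable_bij_count_space[OF bij_betw_int_add[of m], of "\<lambda>l. G (y + real_of_int l)"]
  by (simp add: add_ac)

text \<open>The two integrands correspond under the translation of \<open>y\<close> by
  \<open>l\<close>; the unfolding identity applies Fubini once before and once after that
  translation.\<close>

lemma integrable_periodize_pair:
  fixes G :: "real \<Rightarrow> complex"
  assumes G: "integrable lborel G"
  shows "integrable (lborel \<Otimes>\<^sub>M int_space) (\<lambda>(y, l). indicator {0..<1} y *\<^sub>R G (y + real_of_int l))"
    and "integrable (lborel \<Otimes>\<^sub>M int_space) (\<lambda>(y, l). indicator {0..<1} (y - real_of_int l) *\<^sub>R G y)"
proof -
  interpret pair_sigma_finite "lborel :: real measure" "int_space"
    by (rule pair_sigma_finite_lborel_int)
  have [measurable]: "G \<in> borel_measurable borel" using G by simp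
  have fin: "(\<integral>\<^sup>+y. ennreal (norm (G y)) \<partial>lborel) < \<infinity>"
    using G by (simp add: integrable_iff_bounded)
  have I: "integrable (lborel \<Otimes>\<^sub>M int_space) k"
    if [measurable]: "k \<in> borel_measurable (lborel \<Otimes>\<^sub>M int_space)"
      and "(\<integral>\<^sup>+y. \<integral>\<^sup>+l. ennreal (norm (k (y, l))) \<partial>int_space \<partial>lborel) = (\<integral>\<^sup>+y. ennreal (norm (G y)) \<partial>lborel)"
    for k :: "real \<times> int \<Rightarrow> complex"
    using that fin by (intro integrableI_bounded) (simp_all flip: M2.nn_integral_fst)
  show "integrable (lborel \<Otimes>\<^sub>M int_space) (\<lambda>(y, l). indicator {0..<1} y *\<^sub>R G (y + real_of_int l))"
    using nn_integral_periodize[of "\<lambda>y. ennreal (norm (G y))"]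
    by (intro I) (simp_all add: split_beta ennreal_mult' ennreal_indicator nn_integral_cmult)
  show "integrable (lborel \<Otimes>\<^sub>M int_space) (\<lambda>(y, l). indicator {0..<1} (y - real_of_int l) *\<^sub>R G y)"
    by (intro I) (simp_all add: split_beta ennreal_mult' ennreal_indicator nn_integral_multc
        indicator_unit_interval_shift)
qed

lemma borel_measurable_periodize [measurable]:
  assumes [measurable]: "G \<in> borel_measurable borel"
  shows "periodize G \<in> borel_measurable borel"
proof -
  interpret pair_sigma_finite "lborel :: real measure" "int_space"
    by (rule pair_sigma_finite_lborel_int)
  have "(\<lambda>y. LINT l|int_space. G (y + real_of_int l)) \<in> borel_measurable lborel"
    by (rule M2.borel_measurable_lebesgue_integral) (simp add: split_beta)
  then show ?thesis by (simp add: periodize_def[abs_def])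
qed

lemma AE_integrable_periodize:
  fixes G :: "real \<Rightarrow> complex"
  assumes G: "integrable lborel G"
  shows "AE y in lborel. integrable (count_space UNIV) (\<lambda>l::int. G (y + real_of_int l))"
proof (rule AE_lborel_periodic)
  show "integrable (count_space UNIV) (\<lambda>l::int. G (y + real_of_int m + real_of_int l))
    \<longleftrightarrow> integrable (count_space UNIV) (\<lambda>l::int. G (y + real_of_int l))" for y m
    by (rule integrable_periodic)
  interpret pair_sigma_finite "lborel :: real measure" "int_space"
    by (rule pair_sigma_finite_lborel_int)
  show "AE y in lborel. y \<in> {0<..<1} \<longrightarrow> integrable (count_space UNIV) (\<lambda>l::int. G (y + real_of_int l))"
    using AE_integrable_fst[OF integrable_periodize_pair(1)[OF G]] by eventually_elim auto
qed

lemma integral_periodize: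
  fixes G :: "real \<Rightarrow> complex"
  assumes G: "integrable lborel G"
  shows "integrable lborel (\<lambda>y. indicator {0..<1} y *\<^sub>R periodize G y)"
    and "(LINT y|lborel. indicator {0..<1} y *\<^sub>R periodize G y) = (LINT y|lborel. G y)"
proof -
  interpret pair_sigma_finite "lborel :: real measure" "int_space"
    by (rule pair_sigma_finite_lborel_int)
  have [measurable]: "G \<in> borel_measurable borel" using G by simp
  note int = integrable_periodize_pair[OF G]
  have eq: "indicator {0..<1} y *\<^sub>R periodize G y = (LINT l|count_space UNIV. indicator {0..<1} y *\<^sub>R G (y + real_of_int l))" for y
    by (simp add: periodize_def)
  show "integrable lborel (\<lambda>y. indicator {0..<1} y *\<^sub>R periodize G y)"
    unfolding eq by (rule integrable_fst[OF int(1)])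
  have "(LINT y|lborel. indicator {0..<1} y *\<^sub>R periodize G y)
      = (LINT l|count_space UNIV. LINT y|lborel. indicator {0..<1} y *\<^sub>R G (y + real_of_int l))"
    unfolding eq by (rule Fubini_integral[OF int(1), symmetric])
  also have "\<dots> = (LINT l|count_space UNIV. LINT y|lborel. indicator {0..<1} (y - real_of_int l) *\<^sub>R G y)"
  proof (rule Bochner_Integration.integral_cong[OF refl])
    fix l :: int
    show "(LINT y|lborel. indicator {0..<1} y *\<^sub>R G (y + real_of_int l))
        = (LINT y|lborel. indicator {0..<1} (y - real_of_int l) *\<^sub>R G y)"
      using lborel_integral_shift[of "\<lambda>y. indicator {0..<1} y *\<^sub>R G (y + real_of_int l)" "real_of_int l"]
      by simp
  qed
  also have "\<dots> = (LINT y|lborel. LINT l|count_space UNIV. indicator {0..<1} (y - real_of_int l) *\<^sub>R G y)"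
    by (rule Fubini_integral[OF int(2)])
  also have "\<dots> = (LINT y|lborel. G y)"
    unfolding indicator_unit_interval_shift by (simp add: integrable_indicator_iff)
  finally show "(LINT y|lborel. indicator {0..<1} y *\<^sub>R periodize G y) = (LINT y|lborel. G y)" .
qed

section \<open>Uniqueness of Fourier coefficients\<close>

lemma fexp_int [simp]: "fexp (real_of_int l) = 1"
  by (simp add: fexp_def cis_multiple_2pi)

lemma fexp_periodic [simp]: "fexp (y + real_of_int l) = fexp y"
  by (simp add: fexp_add)

lemma fexp_mult_periodic: "fexp (real_of_int k * (y + real_of_int l)) = fexp (real_of_int k * y)"
  using fexp_periodic[of "real_of_int k * y" "k * l"] by (simp add: distrib_left)

lemma fexp_eq_iff: "fexp s = fexp t \<longleftrightarrow> (\<exists>n::int. s = t + real_of_int n)"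
proof
  assume "fexp s = fexp t"
  then have "exp (\<i> * of_real (2 * pi * s)) = exp (\<i> * of_real (2 * pi * t))"
    by (simp add: fexp_def cis_conv_exp)
  then obtain n :: int where "\<i> * of_real (2 * pi * s) = \<i> * of_real (2 * pi * t) + of_real (real_of_int (2 * n) * pi) * \<i>"
    unfolding exp_eq by auto
  from arg_cong[OF this, of Im] have "2 * pi * s = 2 * pi * (t + real_of_int n)"
    by (simp add: algebra_simps)
  then show "\<exists>n::int. s = t + real_of_int n" by auto
qed auto

text \<open>By unfolding, these integrals over the line are the Fourier coefficients of
  \<open>periodize G\<close>, because the exponentials have period 1. Working with \<open>G\<close>
  on the whole line keeps multiplication by periodic functions free of cut points.\<close>

definition fourier_null :: "(real \<Rightarrow> complex) \<Rightarrow> bool" where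
  "fourier_null G \<longleftrightarrow> integrable lborel G \<and> (\<forall>k::int. (LINT y|lborel. G y * fexp (real_of_int k * y)) = 0)"

lemma fourier_null_add:
  "fourier_null G \<Longrightarrow> fourier_null H \<Longrightarrow> fourier_null (\<lambda>y. G y + H y)"
  by (auto simp: fourier_null_def distrib_right fexp_mult_integrable)

lemma fourier_null_cmult: "fourier_null G \<Longrightarrow> fourier_null (\<lambda>y. c * G y)"
  by (auto simp: fourier_null_def mult.assoc)

lemma fourier_null_fexp: "fourier_null G \<Longrightarrow> fourier_null (\<lambda>y. G y * fexp (real_of_int m * y))"
proof -
  assume G: "fourier_null G"
  have "(LINT y|lborel. G y * fexp (real_of_int m * y) * fexp (real_of_int k * y)) = 0" for k
  proof -
    have "G y * fexp (real_of_int m * y) * fexp (real_of_int k * y) = G y * fexp (real_of_int (m + k) * y)" for y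
      by (simp add: distrib_right fexp_add mult.assoc)
    then show ?thesis using G by (simp only: fourier_null_def)
  qed
  then show ?thesis using G by (auto simp: fourier_null_def fexp_mult_integrable)
qed

text \<open>A real linear form in \<open>fexp y\<close> is a combination of \<open>fexp y\<close>
  and \<open>fexp (- y)\<close>, and multiplying by either only shifts the coefficients. Keeping
  \<open>G\<close> arbitrary in the induction lets a product of polynomials act by one factor after
  the other.\<close>

lemma fourier_null_polynomial:
  assumes "real_polynomial_function p" and "fourier_null G"
  shows "fourier_null (\<lambda>y. of_real (p (fexp y)) * G y)"
  using assms
proof (induction arbitrary: G rule: real_polynomial_function.induct)
  case (linear f)
  have "f z = Re z * f 1 + Im z * f \<i>" for z
  proof -
    have "f z = f (Re z *\<^sub>R 1 + Im z *\<^sub>R \<i>)"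
      by (rule arg_cong[of _ _ f]) (simp add: complex_eq_iff)
    also have "\<dots> = Re z * f 1 + Im z * f \<i>"
      using linear(1) by (simp add: bounded_linear.linear linear_add linear_cmul)
    finally show ?thesis .
  qed
  then have lin: "complex_of_real (f z) = of_real (Re z) * of_real (f 1) + of_real (Im z) * of_real (f \<i>)" for z
    by (metis of_real_add of_real_mult)
  \<comment> \<open>The factors in Re z = (z + cnj z) / 2 and Im z = (z - cnj z) / (2 i), named so
    that the simplifier does not expand them.\<close>
  define h w :: complex where "h = 1 / 2" and "w = 1 / (2 * \<i>)"
  have re: "of_real (Re (fexp y)) = (fexp y + fexp (- y)) * h"
    and im: "of_real (Im (fexp y)) = (fexp y - fexp (- y)) * w" for y
    by (simp_all add: fexp_def complex_eq_iff h_def w_def)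
  have "of_real (f (fexp y)) * G y
      = (of_real (f 1) * h + of_real (f \<i>) * w) * (G y * fexp (real_of_int 1 * y))
        + (of_real (f 1) * h - of_real (f \<i>) * w) * (G y * fexp (real_of_int (-1) * y))" for y
    unfolding lin[of "fexp y"] re im by (simp add: algebra_simps)
  moreover have "fourier_null (\<lambda>y. (of_real (f 1) * h + of_real (f \<i>) * w) * (G y * fexp (real_of_int 1 * y))
        + (of_real (f 1) * h - of_real (f \<i>) * w) * (G y * fexp (real_of_int (-1) * y)))"
    by (intro fourier_null_add fourier_null_cmult fourier_null_fexp linear)
  ultimately show ?case by (simp only:)
next
  case (const c)
  then show ?case by (intro fourier_null_cmult)
next
  case (add f g)
  then show ?case using fourier_null_add[OF add.IH] by (simp add: distrib_right)
next
  case (mult f g)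
  then show ?case using mult.IH(1)[OF mult.IH(2)[OF mult.prems]] by (simp add: mult.assoc)
qed

text \<open>By Stone-Weierstrass a polynomial approximates \<open>u\<close> uniformly on the unit
  circle; its integral against \<open>G\<close> vanishes, and the error is at most the uniform error
  times the L1 norm of \<open>G\<close>.\<close>

lemma fourier_null_continuous:
  assumes G: "fourier_null G" and u: "continuous_on UNIV u"
  shows "(LINT y|lborel. of_real (u (fexp y)) * G y) = 0"
proof -
  have Gi: "integrable lborel G" using G by (simp add: fourier_null_def)
  have [measurable]: "G \<in> borel_measurable borel" "u \<in> borel_measurable borel"
    using Gi u by (auto intro: borel_measurable_continuous_onI)
  obtain B where B: "\<And>z. z \<in> sphere 0 1 \<Longrightarrow> \<bar>u z\<bar> \<le> B"
  proof -
    have "compact (u ` sphere 0 1)"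
      by (rule compact_continuous_image) (use u in \<open>auto intro: continuous_on_subset\<close>)
    then have "bounded (u ` sphere 0 1)" by (rule compact_imp_bounded)
    then obtain a where "\<forall>z\<in>sphere 0 1. norm (u z) \<le> a" by (auto simp: bounded_iff)
    then show ?thesis by (intro that[of a]) auto
  qed
  have int: "integrable lborel (\<lambda>y. of_real (u (fexp y)) * G y)"
  proof (rule Bochner_Integration.integrable_bound)
    show "integrable lborel (\<lambda>y. B *\<^sub>R norm (G y))" using Gi by simp
    show "AE y in lborel. norm (of_real (u (fexp y)) * G y) \<le> norm (B *\<^sub>R norm (G y))"
    proof (rule AE_I2)
      fix y
      have "\<bar>u (fexp y)\<bar> \<le> B" by (rule B) simp
      then have "\<bar>u (fexp y)\<bar> \<le> \<bar>B\<bar>" by simp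
      then show "norm (of_real (u (fexp y)) * G y) \<le> norm (B *\<^sub>R norm (G y))"
        by (simp add: norm_mult abs_mult mult_right_mono)
    qed
  qed simp
  have "cmod (LINT y|lborel. of_real (u (fexp y)) * G y) \<le> e * (LINT y|lborel. norm (G y))" if "e > 0" for e
  proof -
    have "compact (sphere (0::complex) 1)" "continuous_on (sphere 0 1) u"
      using u by (auto intro: continuous_on_subset)
    from Stone_Weierstrass_real_polynomial_function[OF this \<open>e > 0\<close>]
    obtain p where p: "real_polynomial_function p" "\<And>z. z \<in> sphere 0 1 \<Longrightarrow> \<bar>u z - p z\<bar> < e"
      by blast
    have pG: "fourier_null (\<lambda>y. of_real (p (fexp y)) * G y)"
      by (rule fourier_null_polynomial[OF p(1) G])
    then have pG_int: "integrable lborel (\<lambda>y. of_real (p (fexp y)) * G y)"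
      and pG0: "(LINT y|lborel. of_real (p (fexp y)) * G y) = 0"
      by (auto simp: fourier_null_def dest: spec[of _ 0])
    have "cmod (LINT y|lborel. of_real (u (fexp y)) * G y)
        = cmod (LINT y|lborel. of_real (u (fexp y)) * G y - of_real (p (fexp y)) * G y)"
      using int pG_int by (simp add: pG0)
    also have "\<dots> \<le> (LINT y|lborel. cmod (of_real (u (fexp y)) * G y - of_real (p (fexp y)) * G y))"
      by (rule integral_norm_bound)
    also have "\<dots> \<le> (LINT y|lborel. e * norm (G y))"
    proof (rule integral_mono)
      show "cmod (of_real (u (fexp y)) * G y - of_real (p (fexp y)) * G y) \<le> e * norm (G y)" for y
      proof -
        have "\<bar>u (fexp y) - p (fexp y)\<bar> \<le> e" using p(2)[of "fexp y"] by simp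
        then show ?thesis
          by (simp add: norm_mult mult_right_mono flip: left_diff_distrib of_real_diff)
      qed
    qed (use int pG_int Gi in auto)
    finally show ?thesis by simp
  qed
  note small = this
  define I where "I = (LINT y|lborel. norm (G y))"
  have "I \<ge> 0" by (simp add: I_def)
  show ?thesis
  proof (rule ccontr)
    assume "\<not> ?thesis"
    then have pos: "cmod (LINT y|lborel. of_real (u (fexp y)) * G y) > 0" (is "?c > 0") by simp
    \<comment> \<open>With this error bound the estimate reads c <= c I / (I + 1) < c; the added 1
      avoids dividing by zero when \<open>I = 0\<close>.\<close>
    have "?c / (I + 1) > 0" using \<open>I \<ge> 0\<close> pos by simp
    from small[OF this] have "?c \<le> ?c / (I + 1) * I" by (simp only: I_def)
    also have "\<dots> < ?c"
      using \<open>I \<ge> 0\<close> pos by (simp add: field_simps)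
    finally show False by simp
  qed
qed

text \<open>The continuous functions \<open>min 1 (real n * infdist z K)\<close> vanish on
  \<open>K\<close> and are eventually 1 at each point off \<open>K\<close>. Nonemptiness matters
  because \<open>infdist\<close> from the empty set is 0.\<close>

lemma fourier_null_arc:
  assumes G: "fourier_null G" and K: "closed K" "K \<noteq> {}"
  shows "(LINT y|lborel. indicator (- K) (fexp y) *\<^sub>R G y) = 0"
proof (rule LIMSEQ_unique)
  have Gi: "integrable lborel G" using G by (simp add: fourier_null_def)
  have [measurable]: "G \<in> borel_measurable borel" "K \<in> sets borel" using Gi K by auto
  let ?u = "\<lambda>(n::nat) z. min 1 (real n * infdist z K)"
  have cont: "continuous_on UNIV (?u n)" for n by (intro continuous_intros)
  have [measurable]: "?u n \<in> borel_measurable borel" for n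
    by (rule borel_measurable_continuous_onI[OF cont])
  show "(\<lambda>n. LINT y|lborel. of_real (?u n (fexp y)) * G y) \<longlonglongrightarrow> (LINT y|lborel. indicator (- K) (fexp y) *\<^sub>R G y)"
  proof (rule integral_dominated_convergence[where w="\<lambda>y. norm (G y)"])
    show "AE y in lborel. (\<lambda>n. of_real (?u n (fexp y)) * G y) \<longlonglongrightarrow> indicator (- K) (fexp y) *\<^sub>R G y"
    proof (intro AE_I2 tendsto_eventually)
      fix y
      show "\<forall>\<^sub>F n in sequentially. of_real (?u n (fexp y)) * G y = indicator (- K) (fexp y) *\<^sub>R G y"
      proof (cases "fexp y \<in> K")
        case False
        then have pos: "infdist (fexp y) K > 0"
          using K by (metis in_closed_iff_infdist_zero infdist_nonneg less_eq_real_def)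
        obtain N where N: "1 / infdist (fexp y) K < real N" using reals_Archimedean2 by blast
        have "?u n (fexp y) = 1" if "n \<ge> N" for n
        proof -
          have "1 / infdist (fexp y) K \<le> real n" using N that by (meson less_imp_le of_nat_le_iff order_trans)
          then have "1 \<le> real n * infdist (fexp y) K" using pos by (simp add: field_simps)
          then show ?thesis by simp
        qed
        then show ?thesis unfolding eventually_sequentially using False by (intro exI[of _ N]) auto
      qed simp
    qed
    show "AE y in lborel. norm (of_real (?u n (fexp y)) * G y) \<le> norm (G y)" for n
      by (intro AE_I2) (simp add: norm_mult mult_left_le_one_le infdist_nonneg)
  qed (use Gi in auto)
  show "(\<lambda>n. LINT y|lborel. of_real (?u n (fexp y)) * G y) \<longlonglongrightarrow> 0"
    by (simp only: fourier_null_continuous[OF G cont] tendsto_const)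
qed

text \<open>An open subinterval of a period corresponds to an open set on the circle. Its indicator
  is a periodic factor, so it passes through the periodization, and the integral of
  \<open>periodize G\<close> over the subinterval unfolds to one that vanishes by
  \<open>fourier_null_arc\<close>.\<close>

theorem fourier_null_periodize:
  assumes G: "fourier_null G"
  shows "AE y in lborel. periodize G y = 0"
proof (rule AE_lborel_periodic)
  have Gi: "integrable lborel G" using G by (simp add: fourier_null_def)
  have [measurable]: "G \<in> borel_measurable borel" using Gi by simp
  show "periodize G (y + real_of_int l) = 0 \<longleftrightarrow> periodize G y = 0" for y l
    by (simp add: periodize_periodic)
  have "AE y in lborel. indicator {0<..<1} y *\<^sub>R periodize G y = 0"
  proof (rule AE_zero_if_intervals_zero)
    have "integrable lborel (\<lambda>y. indicator {0<..<1} y *\<^sub>R (indicator {0..<1} y *\<^sub>R periodize G y))"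
      by (intro integrable_mult_indicator integral_periodize(1) Gi) simp
    also have "(\<lambda>y. indicator {0<..<1} y *\<^sub>R (indicator {0..<1} y *\<^sub>R periodize G y)) = (\<lambda>y. indicator {0<..<1} y *\<^sub>R periodize G y)"
      by (auto simp: indicator_def)
    finally show "integrable lborel (\<lambda>y. indicator {0<..<1} y *\<^sub>R periodize G y)" .
    show "(LINT y|lborel. indicator {a<..<b} y *\<^sub>R indicator {0<..<1} y *\<^sub>R periodize G y) = 0" for a b
    proof -
      define c d where "c = max a 0" and "d = min b 1"
      have eq: "indicator {a<..<b} y *\<^sub>R indicator {0<..<1} y *\<^sub>R periodize G y = indicator {c<..<d} y *\<^sub>R periodize G y" for y
        by (auto simp: indicator_def c_def d_def)
      show ?thesis
      proof (cases "c < d")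
        case False
        then show ?thesis unfolding eq by simp
      next
        case True
        have cd: "0 \<le> c" "d \<le> 1" by (auto simp: c_def d_def)
        \<comment> \<open>The closed arc run through after \<open>(c, d)\<close> until the next
          period reaches \<open>c + 1\<close>. Points of the unit interval at or left of
          \<open>c\<close> land in it after adding 1; it is nonempty since
          \<open>d \<le> 1 \<le> c + 1\<close>.\<close>
        define K where "K = fexp ` {d..c+1}"
        have "compact K" unfolding K_def by (intro compact_continuous_image continuous_intros) auto
        then have K: "closed K" "K \<noteq> {}" using True cd by (auto simp: compact_imp_closed K_def)
        have [measurable]: "K \<in> sets borel" using K by simp
        have arc: "fexp y \<in> K \<longleftrightarrow> y \<notin> {c<..<d}" if "y \<in> {0..<1}" for y
        proof
          assume "fexp y \<in> K"
          then obtain t n where t: "t \<in> {d..c+1}" "y = t + real_of_int n"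
            by (auto simp: K_def fexp_eq_iff)
          show "y \<notin> {c<..<d}"
          proof
            assume "y \<in> {c<..<d}"
            then have "real_of_int n < 0" "real_of_int n > -1" using t by auto
            then show False by simp
          qed
        next
          assume "y \<notin> {c<..<d}"
          then consider "y \<ge> d" | "y \<le> c" by force
          then show "fexp y \<in> K"
          proof cases
            case 1
            then show ?thesis using that cd by (auto simp: K_def)
          next
            case 2
            then have "y + 1 \<in> {d..c+1}" using that cd by auto
            moreover have "fexp y = fexp (y + 1)" using fexp_periodic[of y 1] by simp
            ultimately show ?thesis by (auto simp: K_def)
          qed
        qed
        have int: "integrable lborel (\<lambda>y. indicator (- K) (fexp y) *\<^sub>R G y)"
          by (rule Bochner_Integration.integrable_bound[OF Gi]) (auto simp: indicator_def)
        have "0 = (LINT y|lborel. indicator (- K) (fexp y) *\<^sub>R G y)"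
          by (rule fourier_null_arc[OF G K, symmetric])
        also have "\<dots> = (LINT y|lborel. indicator {0..<1} y *\<^sub>R periodize (\<lambda>y. indicator (- K) (fexp y) *\<^sub>R G y) y)"
          by (rule integral_periodize(2)[OF int, symmetric])
        also have "\<dots> = (LINT y|lborel. indicator {c<..<d} y *\<^sub>R periodize G y)"
        proof (rule Bochner_Integration.integral_cong[OF refl])
          fix y :: real
          have "periodize (\<lambda>y. indicator (- K) (fexp y) *\<^sub>R G y) y = indicator (- K) (fexp y) *\<^sub>R periodize G y"
            by (simp add: periodize_def)
          then show "indicator {0..<1} y *\<^sub>R periodize (\<lambda>y. indicator (- K) (fexp y) *\<^sub>R G y) y
              = indicator {c<..<d} y *\<^sub>R periodize G y"
            using arc[of y] cd by (auto simp: indicator_def)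
        qed
        finally show ?thesis unfolding eq by simp
      qed
    qed
  qed
  then show "AE y in lborel. y \<in> {0<..<1} \<longrightarrow> periodize G y = 0"
    by eventually_elim (auto simp: indicator_def)
qed

section \<open>Brackets and orthogonality of integer translates\<close>

abbreviation (input) shift :: "int \<Rightarrow> (real \<Rightarrow> complex) \<Rightarrow> real \<Rightarrow> complex" where
  "shift k f \<equiv> \<lambda>x. f (x - of_int k)"

text \<open>The arguments are already functions of the frequency: the bracket [h,k] is
  \<open>bracket (fourier h) (fourier k)\<close>.\<close>

definition bracket :: "(real \<Rightarrow> complex) \<Rightarrow> (real \<Rightarrow> complex) \<Rightarrow> real \<Rightarrow> complex" where
  "bracket H K = periodize (\<lambda>y. H y * cnj (K y))"

lemma bracket_periodic: "bracket H K (y + of_int l) = bracket H K y"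
  by (simp add: bracket_def periodize_periodic)

lemma borel_measurable_bracket [measurable]:
  assumes [measurable]: "H \<in> borel_measurable borel" "K \<in> borel_measurable borel"
  shows "bracket H K \<in> borel_measurable borel"
  unfolding bracket_def by measurable

lemma l2_inner_shift_fourier:
  assumes h: "h \<in> L2" and e: "e \<in> L2"
  shows "l2_inner h (\<lambda>x. e (x - s)) = (LINT y|lborel. fourier h y * cnj (fourier e y) * fexp (s * y))"
proof -
  have "l2_inner h (\<lambda>x. e (x - s)) = l2_inner (fourier h) (fourier (\<lambda>x. e (x - s)))"
    by (rule fourier_inner[symmetric]) (simp_all add: h e L2_shift)
  also have "\<dots> = l2_inner (fourier h) (\<lambda>y. fexp (- (s * y)) * fourier e y)"
    by (rule l2_inner_cong_AE) (use h e fourier_shift[OF e] in \<open>simp_all add: L2_shift\<close>)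
  also have "\<dots> = (LINT y|lborel. fourier h y * cnj (fourier e y) * fexp (s * y))"
    by (simp add: l2_inner_def cnj_fexp mult_ac)
  finally show ?thesis .
qed

text \<open>The inner products of \<open>h\<close> with the integer translates of \<open>e\<close>
  are the Fourier coefficients of the bracket, because translation becomes multiplication by a
  character.\<close>

lemma bracket_eq_0:
  assumes h: "h \<in> L2" and e: "e \<in> L2" and orth: "\<And>k::int. l2_inner h (shift k e) = 0"
  shows "AE y in lborel. bracket (fourier h) (fourier e) y = 0"
  unfolding bracket_def
  by (rule fourier_null_periodize)
    (use orth l2_inner_shift_fourier[OF h e] in \<open>auto simp: fourier_null_def L2_mult_cnj fourier_L2(1) h e\<close>)

text \<open>A periodic factor is constant on each fiber and comes out of the periodizing sum; its
  boundedness keeps the integrand integrable.\<close>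

lemma integral_bracket:
  assumes H: "H \<in> L2" and K: "K \<in> L2" and [measurable]: "c \<in> borel_measurable borel"
    and B: "\<And>y. cmod (c y) \<le> B" and per: "\<And>y l. c (y + of_int l) = c y"
  shows "(LINT y|lborel. c y * (H y * cnj (K y))) = (LINT y|lborel. indicator {0..<1} y *\<^sub>R (c y * bracket H K y))"
proof -
  have "integrable lborel (\<lambda>y. c y * H y * cnj (K y))"
    by (rule L2_mult_cnj[OF L2_bounded_mult[OF H _ B] K]) simp
  then have "integrable lborel (\<lambda>y. c y * (H y * cnj (K y)))" by (simp add: mult.assoc)
  from integral_periodize(2)[OF this, symmetric] show ?thesis
    by (simp add: bracket_def periodize_def per)
qed

lemma integral_bracket_eq_0:
  assumes "H \<in> L2" "K \<in> L2" "c \<in> borel_measurable borel"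
    "\<And>y. cmod (c y) \<le> B" "\<And>y l. c (y + of_int l) = c y"
    and "AE y in lborel. bracket H K y = 0"
  shows "(LINT y|lborel. c y * (H y * cnj (K y))) = 0"
proof -
  have "AE y in lborel. indicator {0..<1} y *\<^sub>R (c y * bracket H K y) = 0"
    using assms(6) by eventually_elim simp
  then show ?thesis
    by (subst integral_bracket[OF assms(1-5)]) (rule integral_eq_zero_AE)
qed

lemma l2_inner_shift_eq_0:
  assumes h: "h \<in> L2" and e: "e \<in> L2" and "AE y in lborel. bracket (fourier h) (fourier e) y = 0"
  shows "l2_inner h (shift k e) = 0"
proof -
  have "(LINT y|lborel. fexp (of_int k * y) * (fourier h y * cnj (fourier e y))) = 0"
    by (rule integral_bracket_eq_0[where B=1]) (use assms fexp_mult_periodic in \<open>auto intro: fourier_L2(1)\<close>)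
  then show ?thesis
    by (simp add: l2_inner_shift_fourier[OF h e] mult_ac)
qed

text \<open>For nonzero \<open>k\<close>, translating by half a period of the character changes its
  sign, while the integral over a full unit period does not depend on where that period starts. The
  latter is again unfolding: the character cut to a translated unit interval periodizes to the
  character.\<close>

lemma integral_fexp_unit_interval:
  "(LINT y|lborel. indicator {0..<1} y *\<^sub>R fexp (of_int k * y)) = (if k = 0 then 1 else 0)"
proof (cases "k = 0")
  case False
  define I where "I = (LINT y|lborel. indicator {0..<1} y *\<^sub>R fexp (of_int k * y))"
  \<comment> \<open>Half a period of \<open>fexp (of_int k * y)\<close>, chosen so that
    \<open>fexp (of_int k * s) = -1\<close> and hence \<open>I = - I\<close>.\<close>
  define s :: real where "s = 1 / (2 * of_int k)"
  have ind: "integrable lborel (\<lambda>y. indicator {0..<1} (y - s) *\<^sub>R fexp (of_int k * y))"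
  proof (rule Bochner_Integration.integrable_bound)
    show "integrable lborel (indicator {s..<s+1} :: real \<Rightarrow> real)"
      by (simp add: integrable_indicator_iff)
  qed (auto simp: indicator_def)
  have pz: "periodize (\<lambda>y. indicator {0..<1} (y - s) *\<^sub>R fexp (of_int k * y)) y = fexp (of_int k * y)" for y
  proof -
    have "indicator {0..<1} (y + of_int l - s) = (indicator {- \<lfloor>y - s\<rfloor>} l :: real)" for l
      using indicator_unit_interval_shift[of "y - s" "- l", where 'a=real]
      by (auto simp: indicator_def algebra_simps split: if_splits)
    then show ?thesis by (simp add: periodize_def fexp_mult_periodic integrable_indicator_iff)
  qed
  have "I = (LINT y|lborel. indicator {0..<1} y *\<^sub>R periodize (\<lambda>y. indicator {0..<1} (y - s) *\<^sub>R fexp (of_int k * y)) y)"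
    by (simp only: pz I_def)
  also have "\<dots> = (LINT y|lborel. indicator {0..<1} (y - s) *\<^sub>R fexp (of_int k * y))"
    by (rule integral_periodize(2)[OF ind])
  also have "\<dots> = (LINT y|lborel. fexp (of_int k * s) * (indicator {0..<1} (y - s) *\<^sub>R fexp (of_int k * (y - s))))"
    by (intro Bochner_Integration.integral_cong refl) (simp add: algebra_simps flip: fexp_add)
  also have "\<dots> = fexp (of_int k * s) * (LINT y|lborel. indicator {0..<1} (y - s) *\<^sub>R fexp (of_int k * (y - s)))"
    by (rule integral_mult_right_zero)
  also have "(LINT y|lborel. indicator {0..<1} (y - s) *\<^sub>R fexp (of_int k * (y - s))) = I"
    unfolding I_def by (rule lborel_integral_shift)
  also have "fexp (of_int k * s) = -1"
    using False by (simp add: s_def fexp_def)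
  finally show ?thesis using False by (simp add: I_def)
qed simp

lemma bracket_eq_1_iff:
  assumes e: "e \<in> L2"
  shows "(\<forall>k::int. l2_inner e (shift k e) = (if k = 0 then 1 else 0))
    \<longleftrightarrow> (AE y in lborel. bracket (fourier e) (fourier e) y = 1)"
proof
  have int: "integrable lborel (\<lambda>y. fourier e y * cnj (fourier e y))"
    by (simp add: L2_mult_cnj fourier_L2(1) e)
  have ind: "integrable lborel (\<lambda>y. indicator {0..<1} y *\<^sub>R fexp (of_int k * y))" for k
  proof (rule Bochner_Integration.integrable_bound)
    show "integrable lborel (indicator {0..<1} :: real \<Rightarrow> real)"
      by (simp add: integrable_indicator_iff)
  qed (auto simp: indicator_def)
  {
    assume orth: "\<forall>k::int. l2_inner e (shift k e) = (if k = 0 then 1 else 0)"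
    \<comment> \<open>The indicator of \<open>{0..<1}\<close> periodizes to the constant 1, so
      \<open>periodize G\<close> is the bracket minus 1 and orthonormality says that all its
      coefficients vanish.\<close>
    define G where "G y = fourier e y * cnj (fourier e y) - indicator {0..<1} y *\<^sub>R 1" for y
    have "fourier_null G"
      unfolding fourier_null_def
    proof (intro conjI allI)
      show "integrable lborel G"
        unfolding G_def using int ind[of 0] by (intro Bochner_Integration.integrable_diff) simp_all
      fix k :: int
      have "(LINT y|lborel. G y * fexp (of_int k * y))
          = (LINT y|lborel. fourier e y * cnj (fourier e y) * fexp (of_int k * y)
              - indicator {0..<1} y *\<^sub>R fexp (of_int k * y))"
        by (simp add: G_def left_diff_distrib)
      also have "\<dots> = l2_inner e (shift k e) - (if k = 0 then 1 else 0)"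
        by (subst Bochner_Integration.integral_diff[OF fexp_mult_integrable[OF int] ind])
          (simp_all add: l2_inner_shift_fourier[OF e e] integral_fexp_unit_interval)
      finally show "(LINT y|lborel. G y * fexp (of_int k * y)) = 0" using orth by simp
    qed
    \<comment> \<open>Absolute convergence of the bracket's own sum is what allows the sum for
      \<open>G\<close> to be split into two.\<close>
    from fourier_null_periodize[OF this] AE_integrable_periodize[OF int]
    show "AE y in lborel. bracket (fourier e) (fourier e) y = 1"
    proof eventually_elim
      fix y
      assume 1: "periodize G y = 0"
        and 2: "integrable (count_space UNIV) (\<lambda>l::int. fourier e (y + of_int l) * cnj (fourier e (y + of_int l)))"
      have "indicator {0..<1} (y + of_int l) = (indicator {- \<lfloor>y\<rfloor>} l :: real)" for l
        using indicator_unit_interval_shift[of y "- l", where 'a=real]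
        by (auto simp: indicator_def algebra_simps split: if_splits)
      then show "bracket (fourier e) (fourier e) y = 1"
        using 1 2 by (simp add: periodize_def bracket_def G_def integrable_indicator_iff)
    qed
  }
  assume b: "AE y in lborel. bracket (fourier e) (fourier e) y = 1"
  show "\<forall>k::int. l2_inner e (shift k e) = (if k = 0 then 1 else 0)"
  proof
    fix k :: int
    have "l2_inner e (shift k e) = (LINT y|lborel. fexp (of_int k * y) * (fourier e y * cnj (fourier e y)))"
      by (simp add: l2_inner_shift_fourier[OF e e] mult_ac)
    also have "\<dots> = (LINT y|lborel. indicator {0..<1} y *\<^sub>R (fexp (of_int k * y) * bracket (fourier e) (fourier e) y))"
      by (rule integral_bracket[where B=1]) (use e fexp_mult_periodic in \<open>auto intro: fourier_L2(1)\<close>)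
    also have "\<dots> = (LINT y|lborel. indicator {0..<1} y *\<^sub>R fexp (of_int k * y))"
    proof (rule integral_cong_AE)
      show "AE y in lborel. indicator {0..<1} y *\<^sub>R (fexp (of_int k * y) * bracket (fourier e) (fourier e) y)
          = indicator {0..<1} y *\<^sub>R fexp (of_int k * y)"
        using b by eventually_elim simp
    qed (use e in simp_all)
    also have "\<dots> = (if k = 0 then 1 else 0)" by (rule integral_fexp_unit_interval)
    finally show "l2_inner e (shift k e) = (if k = 0 then 1 else 0)" .
  qed
qed

section \<open>Fibers over a frequency and their inner product\<close>

definition fiber :: "(real \<Rightarrow> complex) \<Rightarrow> real \<Rightarrow> int \<Rightarrow> complex" where
  "fiber H y l = H (y + of_int l)"

lemma AE_square_summable_fiber:
  assumes h: "h \<in> L2"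
  shows "AE y in lborel. square_integrable (count_space UNIV) (fiber (fourier h) y)"
proof -
  define H where "H = fourier h"
  have H: "H \<in> L2" unfolding H_def by (rule fourier_L2(1)[OF h])
  have "integrable lborel (\<lambda>y. H y * cnj (H y))" by (rule L2_mult_cnj[OF H H])
  from AE_integrable_periodize[OF this] show ?thesis
  proof eventually_elim
    fix y assume "integrable (count_space UNIV) (\<lambda>l::int. H (y + of_int l) * cnj (H (y + of_int l)))"
    then have "integrable (count_space UNIV) (\<lambda>l::int. complex_of_real ((cmod (H (y + of_int l)))\<^sup>2))"
      by (simp add: complex_norm_square del: of_real_power)
    then show "square_integrable (count_space UNIV) (fiber (fourier h) y)"
      unfolding H_def[symmetric] complex_of_real_integrable_eq square_integrable_def fiber_def by simp
  qed
qed

definition fiber_inner :: "(int \<Rightarrow> complex) \<Rightarrow> (int \<Rightarrow> complex) \<Rightarrow> complex" where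
  "fiber_inner u v = (LINT l|count_space UNIV. u l * cnj (v l))"

lemma bracket_fiber: "bracket H K y = fiber_inner (fiber H y) (fiber K y)"
  by (simp add: bracket_def periodize_def fiber_inner_def fiber_def)

abbreviation "square_summable \<equiv> square_integrable int_space"

lemma fiber_inner_add:
  assumes "square_summable u" "square_summable v" "square_summable w"
  shows "fiber_inner (\<lambda>l. u l + v l) w = fiber_inner u w + fiber_inner v w"
    and "fiber_inner w (\<lambda>l. u l + v l) = fiber_inner w u + fiber_inner w v"
  using assms by (simp_all add: fiber_inner_def distrib_right distrib_left square_integrable_mult_cnj)

lemma fiber_inner_diff:
  assumes "square_summable u" "square_summable v" "square_summable w"
  shows "fiber_inner (\<lambda>l. u l - v l) w = fiber_inner u w - fiber_inner v w"
    and "fiber_inner w (\<lambda>l. u l - v l) = fiber_inner w u - fiber_inner w v"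
  using assms by (simp_all add: fiber_inner_def left_diff_distrib right_diff_distrib square_integrable_mult_cnj)

lemma fiber_inner_cmult:
  shows "fiber_inner (\<lambda>l. c * u l) w = c * fiber_inner u w"
    and "fiber_inner w (\<lambda>l. c * u l) = cnj c * fiber_inner w u"
  by (simp_all add: fiber_inner_def mult.assoc mult.left_commute[of _ "cnj c"])

lemma fiber_inner_cnj: "fiber_inner v u = cnj (fiber_inner u v)"
  by (simp add: fiber_inner_def mult.commute flip: Bochner_Integration.integral_cnj)

lemma fiber_Cauchy_Schwarz:
  assumes u: "square_summable u" and v: "square_summable v" and "fiber_inner u u = 1" "fiber_inner v v = 1"
  shows "cmod (fiber_inner u v) \<le> 1"
proof -
  have *: "(LINT l|count_space UNIV. (cmod (w l))\<^sup>2) = 1" if "fiber_inner w w = 1" for w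
  proof -
    have "complex_of_real (LINT l|count_space UNIV. (cmod (w l))\<^sup>2) = fiber_inner w w"
      by (simp only: fiber_inner_def complex_norm_square[symmetric] integral_complex_of_real)
    then show ?thesis using that by (metis of_real_eq_1_iff)
  qed
  have "(cmod (fiber_inner u v))\<^sup>2 \<le> 1"
    using square_integrable_Cauchy_Schwarz[OF u v] *[OF assms(3)] *[OF assms(4)]
    by (simp add: fiber_inner_def)
  then show ?thesis by (simp add: power2_le_iff_abs_le abs_square_le_1)
qed

text \<open>Links the unordered infinite sum in \<open>fourier_vec_norm_sq\<close> to counting
  measure, through an enumeration of the integers by natural numbers.\<close>

lemma infsum_ennreal_int: "(\<Sum>\<^sub>\<infinity>l\<in>(UNIV :: int set). h l) = (\<integral>\<^sup>+l. h l \<partial>count_space UNIV)"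
  for h :: "int \<Rightarrow> ennreal"
proof -
  have b: "bij_betw (from_nat_into (UNIV :: int set)) UNIV UNIV"
    by (rule bij_betw_from_nat_into) auto
  have "(\<Sum>\<^sub>\<infinity>l\<in>UNIV. h l) = (\<Sum>\<^sub>\<infinity>n\<in>UNIV. h (from_nat_into UNIV n))"
    by (rule infsum_reindex_bij_betw[OF b, symmetric])
  also have "\<dots> = (\<Sum>n. h (from_nat_into UNIV n))"
    by (rule sums_unique[OF has_sum_imp_sums[OF has_sum_infsum]]) (simp add: nonneg_summable_on_complete)
  also have "\<dots> = (\<integral>\<^sup>+n. h (from_nat_into UNIV n) \<partial>count_space UNIV)"
    by (rule nn_integral_count_space_nat[symmetric])
  also have "\<dots> = (\<integral>\<^sup>+l. h l \<partial>count_space UNIV)"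
    by (rule nn_integral_bij_count_space[OF b])
  finally show ?thesis .
qed

lemma fourier_vec_norm_sq_fiber:
  assumes "square_summable (fiber (fourier h) y)"
  shows "fourier_vec_norm_sq h y = ennreal (Re (bracket (fourier h) (fourier h) y))"
proof -
  have "fourier_vec_norm_sq h y = (\<integral>\<^sup>+l. ennreal ((cmod (fiber (fourier h) y l))\<^sup>2) \<partial>count_space UNIV)"
    by (simp add: fourier_vec_norm_sq_def infsum_ennreal_int fiber_def)
  also have "\<dots> = ennreal (LINT l|count_space UNIV. (cmod (fiber (fourier h) y l))\<^sup>2)"
    using assms by (intro nn_integral_eq_integral) (auto simp: square_integrable_def)
  also have "(LINT l|count_space UNIV. (cmod (fiber (fourier h) y l))\<^sup>2) = Re (bracket (fourier h) (fourier h) y)"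
    by (simp only: bracket_fiber fiber_inner_def complex_norm_square[symmetric] integral_complex_of_real Re_complex_of_real)
  finally show ?thesis .
qed

lemma fourier_vec_norm_sq_periodic: "fourier_vec_norm_sq h (y + of_int m) = fourier_vec_norm_sq h y"
  unfolding fourier_vec_norm_sq_def
  using infsum_reindex_bij_betw[OF bij_betw_int_add[of m], of "\<lambda>l. ennreal ((cmod (fourier h (y + of_int l)))\<^sup>2)"]
  by (simp add: add_ac)

lemma borel_measurable_fourier_vec_norm_sq [measurable]:
  assumes h: "h \<in> L2"
  shows "fourier_vec_norm_sq h \<in> borel_measurable borel"
proof -
  interpret pair_sigma_finite "lborel :: real measure" "int_space"
    by (rule pair_sigma_finite_lborel_int)
  have [measurable]: "fourier h \<in> borel_measurable borel" using h by simp
  have "(\<lambda>y. \<integral>\<^sup>+l. ennreal ((cmod (fourier h (y + of_int l)))\<^sup>2) \<partial>int_space) \<in> borel_measurable lborel"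
    by (rule M2.borel_measurable_nn_integral) (simp add: split_beta)
  then show ?thesis by (simp add: fourier_vec_norm_sq_def[abs_def] infsum_ennreal_int)
qed

text \<open>The residual of the projection of \<open>z\<close> onto \<open>S\<close> has vanishing bracket with \<open>e\<close>,
  hence it is orthogonal to every multiple of \<open>e\<close> by a periodic function.\<close>
theorem periodic_multiplier_mem:
  assumes S: "l2_closed_subspace S" and eS: "\<And>k::int. (shift k e) \<in> S"
    and c: "c \<in> borel_measurable borel" and B: "\<And>y. cmod (c y) \<le> B"
    and per: "\<And>y l. c (y + of_int l) = c y"
    and z: "z \<in> L2" and zc: "AE y in lborel. fourier z y = c y * fourier e y"
  shows "z \<in> S"
proof -
  have e: "e \<in> L2" using l2_closed_subspaceD(1)[OF S eS[of 0]] by simp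
  define p where "p = orth_proj S z"
  define r where "r x = z x - p x" for x
  have p: "p \<in> S" and orth: "\<And>w. w \<in> S \<Longrightarrow> l2_inner r w = 0"
    using orth_proj[OF S z] by (auto simp: p_def r_def[abs_def])
  have pL: "p \<in> L2" using l2_closed_subspaceD(1)[OF S p] .
  have rL: "r \<in> L2" unfolding r_def[abs_def] by (rule L2_diff[OF z pL])
  have br: "AE y in lborel. bracket (fourier r) (fourier e) y = 0"
    by (rule bracket_eq_0[OF rL e orth[OF eS]])
  have "l2_inner r z = l2_inner (fourier r) (fourier z)"
    by (rule fourier_inner[OF rL z, symmetric])
  also have "\<dots> = l2_inner (fourier r) (\<lambda>y. c y * fourier e y)"
    by (rule l2_inner_cong_AE) (use rL z c e zc in simp_all)
  also have "\<dots> = (LINT y|lborel. cnj (c y) * (fourier r y * cnj (fourier e y)))"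
    by (simp add: l2_inner_def mult_ac)
  also have "\<dots> = 0"
    by (rule integral_bracket_eq_0[where B=B]) (use rL e c B per br in \<open>auto intro: fourier_L2(1)\<close>)
  finally have "l2_inner r r = 0"
    using orth[OF p] l2_inner_diff_right[OF z pL rL] by (simp add: r_def[abs_def])
  then have "l2_norm r = 0" by (simp add: l2_inner_self)
  then have "AE x in lborel. r x = 0" using l2_norm_eq_0_iff[OF rL] by simp
  then have "AE x in lborel. p x = z x" by eventually_elim (simp add: r_def)
  then show ?thesis using l2_closed_subspace_cong_AE[OF S p] L2_measurable[OF z] by blast
qed

section \<open>Wavelets from the orthogonal complement of an MRA\<close>

lemma l2_inner_self_eq_0:
  assumes "f \<in> L2" "l2_inner f f = 0"
  shows "AE x in lborel. f x = 0"
  using assms l2_norm_eq_0_iff[of f] by (simp add: l2_inner_self)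

lemma sqrt2_powi_sq: "sqrt 2 powi n * sqrt 2 powi n = 2 powi n"
  by (simp flip: power_int_mult_distrib)

lemma dilation_integral:
  fixes F :: "real \<Rightarrow> 'a :: {banach, second_countable_topology}"
  shows "(LINT x|lborel. (2 powi n) *\<^sub>R F (2 powi n * x)) = (LINT x|lborel. F x)"
  using lborel_integral_real_affine[of "2 powi n" F 0] by simp

lemma L2_dilation:
  assumes f: "f \<in> L2"
  shows "op_powi dilation n f \<in> L2"
proof -
  have [measurable]: "f \<in> borel_measurable borel" using L2_measurable[OF f] by simp
  have "integrable lborel (\<lambda>x. (2 powi n) *\<^sub>R (cmod (f (2 powi n * x)))\<^sup>2)"
    using f lborel_integrable_real_affine_iff[of "2 powi n" "\<lambda>x. (cmod (f x))\<^sup>2" 0]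
    by (simp add: L2_def)
  moreover have "(cmod (complex_of_real c * F))\<^sup>2 = (c * c) *\<^sub>R (cmod F)\<^sup>2" for c F
    by (simp add: norm_mult power_mult_distrib power2_eq_square)
  then have "(cmod (complex_of_real (sqrt 2 powi n) * f (2 powi n * x)))\<^sup>2 = (2 powi n) *\<^sub>R (cmod (f (2 powi n * x)))\<^sup>2" for x
    by (simp only: sqrt2_powi_sq)
  ultimately show ?thesis
    by (simp add: L2_def op_powi_dilation del: scaleR_conv_of_real real_scaleR_def)
qed

lemma l2_inner_dilation: "l2_inner (op_powi dilation n f) (op_powi dilation n g) = l2_inner f g"
proof -
  have "complex_of_real c * F * cnj (complex_of_real c * G) = (c * c) *\<^sub>R (F * cnj G)" for c F G
    by (simp add: scaleR_conv_of_real)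
  then have "complex_of_real (sqrt 2 powi n) * f (2 powi n * x) * cnj (complex_of_real (sqrt 2 powi n) * g (2 powi n * x))
      = (2 powi n) *\<^sub>R (f (2 powi n * x) * cnj (g (2 powi n * x)))" for x
    by (simp only: sqrt2_powi_sq)
  then show ?thesis
    unfolding l2_inner_def op_powi_dilation
    by (simp only: dilation_integral[of n "\<lambda>x. f x * cnj (g x)"])
qed

lemma dilation_add: "op_powi dilation m (op_powi dilation n f) = op_powi dilation (m + n) f"
  by (simp add: op_powi_dilation fun_eq_iff power_int_add mult_ac)

lemma dilation_0 [simp]: "op_powi dilation 0 f = f"
  by (simp add: op_powi_dilation)

lemma dilation_1: "op_powi dilation 1 f = dilation f"
  by (simp add: op_powi_dilation dilation_def)

lemma dilation_AE_0:
  assumes "f \<in> L2" "AE x in lborel. f x = 0"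
  shows "AE x in lborel. op_powi dilation n f x = 0"
proof -
  have "l2_norm f = 0" using assms by (simp add: l2_norm_eq_0_iff)
  then have "l2_inner (op_powi dilation n f) (op_powi dilation n f) = 0"
    unfolding l2_inner_dilation by (simp add: l2_inner_self)
  then show ?thesis by (rule l2_inner_self_eq_0[OF L2_dilation[OF assms(1)]])
qed

section \<open>From a generator of the complement to a wavelet\<close>

context
  fixes V :: "int \<Rightarrow> (real \<Rightarrow> complex) set"
  assumes mra: "multiresolution_analysis V"
begin

lemma mra_closed_subspace: "l2_closed_subspace (V j)"
  using mra by (simp add: multiresolution_analysis_def)

lemma mra_L2: "f \<in> V j \<Longrightarrow> f \<in> L2"
  using l2_closed_subspaceD(1)[OF mra_closed_subspace] .

lemma mra_mono:
  assumes "i \<le> j" shows "V i \<subseteq> V j"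
  using assms
proof (induction rule: int_ge_induct)
  case (step j)
  then show ?case using mra unfolding multiresolution_analysis_def by blast
qed simp

lemma mra_dilation: "f \<in> V j \<Longrightarrow> op_powi dilation n f \<in> V (j + n)"
proof (induction n rule: int_induct[where k=0])
  case (step1 n)
  have "dilation (op_powi dilation n f) \<in> V (j + n + 1)"
    using mra step1 unfolding multiresolution_analysis_def by blast
  moreover have "dilation (op_powi dilation n f) = op_powi dilation (n + 1) f"
    using dilation_add[of 1 n f] by (simp add: dilation_1 add.commute)
  ultimately show ?case by (simp add: add.assoc)
next
  case (step2 n)
  \<comment> \<open>Going down uses that dilation maps the lower space onto the upper one: the
    preimage \<open>g\<close> supplied by surjectivity is then recognized as the inverse
    dilate.\<close>
  have "op_powi dilation n f \<in> dilation ` V (j + n - 1)"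
    using mra step2 unfolding multiresolution_analysis_def by (metis diff_add_cancel)
  then obtain g where g: "g \<in> V (j + n - 1)" "op_powi dilation n f = op_powi dilation 1 g"
    by (auto simp: dilation_1)
  have "op_powi dilation (n - 1) f = op_powi dilation (-1) (op_powi dilation n f)"
    by (simp add: dilation_add)
  also have "\<dots> = g" by (simp add: g(2) dilation_add)
  finally show ?case using g(1) by (simp add: algebra_simps)
qed simp

lemma mra_complement_dilation_orth:
  assumes "w \<in> orth_complement_in (V 1) (V 0)" "v \<in> V n"
  shows "l2_inner v (op_powi dilation n w) = 0"
proof -
  have "op_powi dilation (- n) v \<in> V 0" using mra_dilation[OF assms(2), of "- n"] by simp
  then have "l2_inner w (op_powi dilation (- n) v) = 0"
    using assms(1) by (simp add: orth_complement_in_def)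
  then have "l2_inner (op_powi dilation n w) (op_powi dilation n (op_powi dilation (- n) v)) = 0"
    by (simp add: l2_inner_dilation)
  then show ?thesis by (simp add: dilation_add l2_inner_eq_0_sym)
qed

text \<open>All members of the family agree almost everywhere with \<open>p 0\<close>, and each
  space is saturated under such changes, so \<open>p 0\<close> lies in the intersection of all
  spaces.\<close>

lemma mra_intersection_null:
  assumes h: "\<And>n. p n \<in> V n" and eq: "\<And>n. AE x in lborel. p (n + 1) x = p n x"
  shows "AE x in lborel. p n x = 0"
proof -
  have eq0: "AE x in lborel. p m x = p 0 x" for m
  proof (induction m rule: int_induct[where k=0])
    case (step1 i)
    from step1(2) eq[of i] show ?case by eventually_elim simp
  next
    case (step2 i)
    from step2(2) eq[of "i - 1"] show ?case by eventually_elim simp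
  qed simp
  have "p 0 \<in> V m" for m
    using l2_closed_subspace_cong_AE[OF mra_closed_subspace h[of m] _ eq0[of m]] mra_L2[OF h[of 0]] L2_measurable
    by blast
  then have "p 0 \<in> (\<Inter>j. V j)" by blast
  moreover have "(\<Inter>j. V j) = {f \<in> L2. AE x in lborel. f x = 0}"
    using mra by (simp add: multiresolution_analysis_def)
  ultimately have "AE x in lborel. p 0 x = 0" by blast
  with eq0[of n] show ?thesis by eventually_elim simp
qed

text \<open>The difference of consecutive projections lies in \<open>V (n + 1)\<close> and is
  orthogonal to \<open>V n\<close>; scaled back by \<open>n\<close> it lies in the complement at
  level 0. It is orthogonal to the translates of psi there: the larger projection has the same inner
  products with them at level \<open>n\<close> as \<open>h\<close>, namely 0, and \<open>V n\<close>
  is orthogonal to them. Completeness inside the complement makes it vanish.\<close>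

lemma mra_projection_constant:
  assumes h: "h \<in> L2"
    and compl: "\<And>w. w \<in> orth_complement_in (V 1) (V 0) \<Longrightarrow>
        (\<And>k::int. l2_inner w (shift k \<psi>) = 0) \<Longrightarrow> AE x in lborel. w x = 0"
    and \<psi>: "\<And>k::int. (shift k \<psi>) \<in> orth_complement_in (V 1) (V 0)"
    and orth: "\<And>n (k::int). l2_inner h (op_powi dilation n (shift k \<psi>)) = 0"
  shows "AE x in lborel. orth_proj (V (n + 1)) h x = orth_proj (V n) h x"
proof -
  define P where "P j = orth_proj (V j) h" for j
  have P: "P j \<in> V j" "\<And>w. w \<in> V j \<Longrightarrow> l2_inner (\<lambda>x. h x - P j x) w = 0" for j
    using orth_proj[OF mra_closed_subspace h] by (auto simp: P_def)
  have PL: "P j \<in> L2" for j using mra_L2[OF P(1)] .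
  have P_inner: "l2_inner (P j) w = l2_inner h w" if "w \<in> V j" for j w
    using P(2)[OF that] l2_inner_diff_left[OF h PL mra_L2[OF that], of j] by simp
  define q where "q x = P (n + 1) x - P n x" for x
  have q: "q \<in> V (n + 1)"
    unfolding q_def[abs_def]
    using P(1)[of "n + 1"] P(1)[of n] mra_mono[of n "n + 1"]
    by (intro l2_closed_subspace_diff[OF mra_closed_subspace]) auto
  define w where "w = op_powi dilation (- n) q"
  have wV: "w \<in> V 1" unfolding w_def using mra_dilation[OF q, of "- n"] by simp
  have q_inner: "l2_inner q v = l2_inner (P (n + 1)) v - l2_inner (P n) v" if "v \<in> L2" for v
    unfolding q_def[abs_def] by (rule l2_inner_diff_left[OF PL PL that])
  have w_inner: "l2_inner w v = l2_inner q (op_powi dilation n v)" for v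
    using l2_inner_dilation[of n w v] by (simp add: w_def dilation_add)
  have "l2_inner w v = 0" if "v \<in> V 0" for v
  proof -
    have "op_powi dilation n v \<in> V n" using mra_dilation[OF that, of n] by simp
    moreover from this have "op_powi dilation n v \<in> V (n + 1)" using mra_mono[of n "n + 1"] by auto
    ultimately show ?thesis
      by (simp add: w_inner q_inner P_inner mra_L2)
  qed
  then have wW: "w \<in> orth_complement_in (V 1) (V 0)" using wV by (simp add: orth_complement_in_def)
  have "AE x in lborel. w x = 0"
  proof (rule compl[OF wW])
    fix k :: int
    let ?e = "op_powi dilation n (shift k \<psi>)"
    have e: "?e \<in> V (n + 1)"
      using mra_dilation[of "\<lambda>x. \<psi> (x - of_int k)" 1 n] \<psi>[of k] by (simp add: orth_complement_in_def add.commute)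
    have "l2_inner w (shift k \<psi>) = l2_inner (P (n + 1)) ?e - l2_inner (P n) ?e"
      by (simp add: w_inner q_inner mra_L2[OF e])
    also have "l2_inner (P (n + 1)) ?e = 0" by (simp add: P_inner[OF e] orth)
    also have "l2_inner (P n) ?e = 0" by (rule mra_complement_dilation_orth[OF \<psi> P(1)])
    finally show "l2_inner w (shift k \<psi>) = 0" by simp
  qed
  from dilation_AE_0[OF mra_L2[OF wV] this, of n] have "AE x in lborel. q x = 0"
    by (simp add: w_def dilation_add)
  then show ?thesis
    by eventually_elim (simp add: q_def P_def)
qed

text \<open>The last hypothesis is completeness of the translates inside the complement, phrased as:
  only the zero class is orthogonal to them.\<close>

theorem mra_orthonormal_wavelet:
  assumes \<psi>: "\<And>k::int. (shift k \<psi>) \<in> orth_complement_in (V 1) (V 0)"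
    and on: "\<And>k::int. l2_inner \<psi> (shift k \<psi>) = (if k = 0 then 1 else 0)"
    and compl: "\<And>w. w \<in> orth_complement_in (V 1) (V 0) \<Longrightarrow>
        (\<And>k::int. l2_inner w (shift k \<psi>) = 0) \<Longrightarrow> AE x in lborel. w x = 0"
  shows "orthonormal_wavelet \<psi>"
proof -
  define T where "T k x = \<psi> (x - of_int k)" for k :: int and x
  have T: "T k \<in> orth_complement_in (V 1) (V 0)" for k using \<psi> by (simp add: T_def[abs_def])
  have TV: "T k \<in> V 1" for k using T by (simp add: orth_complement_in_def)
  have TL: "T k \<in> L2" for k using mra_L2[OF TV] .
  have inner_T: "l2_inner (T k) (T l) = (if k = l then 1 else 0)" for k l
  proof -
    have "l2_inner (T k) (T l) = l2_inner \<psi> (shift (l - k) \<psi>)"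
      using l2_inner_shift[of \<psi> "of_int k" "\<lambda>x. \<psi> (x - of_int (l - k))"]
      by (simp add: T_def[abs_def] algebra_simps)
    then show ?thesis using on[of "l - k"] by simp
  qed
  define e where "e = (\<lambda>(n, l). op_powi dilation n (T l))"
  have e_eq: "(\<lambda>(n, l). op_powi dilation n (op_powi translation l \<psi>)) = e"
    by (simp add: e_def op_powi_translation T_def[abs_def])
  have eL: "e i \<in> L2" for i by (cases i) (simp add: e_def L2_dilation TL)
  \<comment> \<open>An element of level \<open>n\<close> lies in \<open>V (n + 1)\<close>, hence in
    \<open>V m\<close> for every larger \<open>m\<close>, and level \<open>m\<close> is orthogonal
    to \<open>V m\<close>.\<close>
  have lower: "l2_inner (e (n, k)) (e (m, l)) = 0" if "n < m" for n m k l
  proof -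
    have "e (n, k) \<in> V (1 + n)" unfolding e_def using mra_dilation[OF TV] by simp
    then have "e (n, k) \<in> V m" using that mra_mono[of "1 + n" m] by auto
    then show ?thesis unfolding e_def using mra_complement_dilation_orth[OF T] by simp
  qed
  have "l2_inner (e i) (e j) = (if i = j then 1 else 0)" for i j
  proof -
    obtain n k m l where ij: "i = (n, k)" "j = (m, l)" by fastforce
    consider "n < m" | "n = m" | "m < n" by linarith
    then show ?thesis
    proof cases
      case 2
      then show ?thesis by (simp add: ij e_def l2_inner_dilation inner_T)
    qed (use lower l2_inner_eq_0_sym in \<open>auto simp: ij\<close>)
  qed
  moreover have "l2_closed_span (range e) = L2"
  proof (rule l2_closed_subspace_eq_L2)
    show "l2_closed_subspace (l2_closed_span (range e))"
      using eL by (intro l2_closed_subspace_closed_span) auto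
    fix h assume h: "h \<in> L2" and orth: "\<And>s. s \<in> l2_closed_span (range e) \<Longrightarrow> l2_inner h s = 0"
    have "l2_inner h (e (n, k)) = 0" for n k
      using eL by (intro orth l2_closed_span_base) auto
    then have orth': "l2_inner h (op_powi dilation n (shift k \<psi>)) = 0" for n k
      by (simp add: e_def T_def[abs_def])
    have P: "orth_proj (V n) h \<in> V n" for n
      by (rule orth_proj(1)[OF mra_closed_subspace h])
    \<comment> \<open>Constancy in \<open>n\<close> places the common projection in every space at
      once, so it is null; consequently \<open>h\<close> is orthogonal to each \<open>V n\<close>
      and to their dense span.\<close>
    have null: "AE x in lborel. orth_proj (V n) h x = 0" for n
      by (rule mra_intersection_null[OF P]) (rule mra_projection_constant[OF h compl \<psi> orth'])
    have "l2_inner h v = 0" if v: "v \<in> V n" for v n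
    proof -
      have "l2_inner (orth_proj (V n) h) v = l2_inner (\<lambda>x. 0) v"
        by (rule l2_inner_cong_AE)
          (use L2_measurable[OF mra_L2[OF P]] L2_measurable[OF mra_L2[OF v]] null in simp_all)
      then have "l2_inner (orth_proj (V n) h) v = 0" by (simp add: l2_inner_def)
      then show ?thesis
        using orth_proj(2)[OF mra_closed_subspace h v] l2_inner_diff_left[OF h mra_L2[OF P] mra_L2[OF v]]
        by simp
    qed
    then have "l2_inner h f = 0" if "f \<in> l2_closed_span (\<Union>j. V j)" for f
      using mra_L2 by (intro l2_closed_span_orth[OF _ h _ that]) auto
    moreover have "h \<in> l2_closed_span (\<Union>j. V j)"
      using mra h by (simp add: multiresolution_analysis_def)
    ultimately show "AE x in lborel. h x = 0"
      using l2_inner_self_eq_0[OF h] by blast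
  qed
  moreover have "\<psi> \<in> L2" using TL[of 0] by (simp add: T_def[abs_def])
  ultimately show ?thesis
    unfolding orthonormal_wavelet_def orthonormal_basis_of_def e_eq using eL by simp
qed

end

section \<open>The two-generator construction\<close>

lemma l2_closed_subspace_shift_vimage:
  assumes S: "l2_closed_subspace S"
  shows "l2_closed_subspace {f \<in> L2. (\<lambda>x. f (x - s)) \<in> S}"
  unfolding l2_closed_subspace_def
proof (intro conjI allI impI ballI)
  let ?C = "{f \<in> L2. (\<lambda>x. f (x - s)) \<in> S}"
  note SD = l2_closed_subspaceD[OF S]
  show "?C \<subseteq> L2" by blast
  show "(\<lambda>x. 0) \<in> ?C" using SD(2) by simp
  show "(\<lambda>x. f x + g x) \<in> ?C"
    if "f \<in> ?C" "g \<in> ?C" for f g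
    using that SD(3)[of "\<lambda>x. f (x - s)" "\<lambda>x. g (x - s)"] by (simp add: L2_add)
  show "(\<lambda>x. c * f x) \<in> ?C"
    if "f \<in> ?C" for c f
    using that SD(4)[of "\<lambda>x. f (x - s)" c] by (simp add: L2_cmult)
  fix X f assume X: "(\<forall>n. X n \<in> ?C) \<and> l2_tendsto X f"
  then have "(\<lambda>x. f (x - s)) \<in> S"
    using SD(5)[of "\<lambda>n x. X n (x - s)"] l2_tendsto_shift[of X f s] by simp
  then show "f \<in> ?C" using X by (simp add: l2_tendsto_def)
qed

text \<open>The functions whose translate lies in the closed span form a closed subspace containing
  \<open>A\<close>, so minimality of the closed span applies.\<close>

lemma l2_closed_span_shift:
  assumes A: "A \<subseteq> L2" and "\<And>a. a \<in> A \<Longrightarrow> (\<lambda>x. a (x - s)) \<in> A" and "f \<in> l2_closed_span A"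
  shows "(\<lambda>x. f (x - s)) \<in> l2_closed_span A"
proof -
  have "l2_closed_span A \<subseteq> {f \<in> L2. (\<lambda>x. f (x - s)) \<in> l2_closed_span A}"
    using assms(1,2) L2_shift
    by (intro l2_closed_span_minimal l2_closed_subspace_shift_vimage l2_closed_subspace_closed_span)
      (auto intro!: l2_closed_span_base)
  then show ?thesis using assms(3) by blast
qed

lemma fourier_AE_0:
  assumes "f \<in> L2" "AE x in lborel. f x = 0"
  shows "AE \<xi> in lborel. fourier f \<xi> = 0"
  using assms fourier_norm[OF assms(1)] l2_norm_eq_0_iff[OF assms(1)] l2_norm_eq_0_iff[OF fourier_L2(1)[OF assms(1)]]
  by simp

lemma fourier_inj:
  assumes f: "f \<in> L2" and g: "g \<in> L2" and "AE \<xi> in lborel. fourier f \<xi> = fourier g \<xi>"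
  shows "AE x in lborel. f x = g x"
proof -
  note d = L2_diff[OF f g]
  have "AE \<xi> in lborel. fourier (\<lambda>x. f x - g x) \<xi> = 0"
    using fourier_diff[OF f g] assms(3) by eventually_elim simp
  then have "l2_norm (\<lambda>x. f x - g x) = 0"
    using fourier_norm[OF d] l2_norm_eq_0_iff[OF fourier_L2(1)[OF d]] by simp
  then have "AE x in lborel. f x - g x = 0" using l2_norm_eq_0_iff[OF d] by simp
  then show ?thesis by eventually_elim simp
qed

text \<open>Surjectivity of the transform produces a function with the prescribed transform;
  boundedness of \<open>c\<close> keeps the product square integrable, and
  \<open>periodic_multiplier_mem\<close> puts the function into \<open>S\<close>.\<close>

lemma periodic_multiplier_exists:
  assumes S: "l2_closed_subspace S" and eS: "\<And>k::int. (shift k e) \<in> S"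
    and c: "c \<in> borel_measurable borel" "\<And>\<xi>. cmod (c \<xi>) \<le> B" "\<And>\<xi> l. c (\<xi> + of_int l) = c \<xi>"
  obtains z where "z \<in> S" "AE \<xi> in lborel. fourier z \<xi> = c \<xi> * fourier e \<xi>"
proof -
  have e: "e \<in> L2" using l2_closed_subspaceD(1)[OF S eS[of 0]] by simp
  have "(\<lambda>\<xi>. c \<xi> * fourier e \<xi>) \<in> L2"
    by (rule L2_bounded_mult[OF fourier_L2(1)[OF e] _ c(2)]) (use c(1) in simp)
  from fourier_surj[OF this] obtain z where "z \<in> L2" "AE \<xi> in lborel. fourier z \<xi> = c \<xi> * fourier e \<xi>"
    by blast
  with periodic_multiplier_mem[OF S eS c] that show ?thesis by blast
qed

text \<open>Here \<open>p\<close> is a unit vector with coordinates \<open>m0\<close>,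
  \<open>m1\<close> in the orthonormal pair \<open>a\<close>, \<open>b\<close>, and
  \<open>u0\<close>, \<open>u1\<close> are the residuals of \<open>a\<close>, \<open>b\<close> after
  projection onto \<open>p\<close>. Each residual has squared norm 1 minus the squared modulus of
  its coordinate, which is that of the other coordinate. The combination of residuals with weights
  \<open>m0\<close>, \<open>m1\<close> is \<open>p\<close> minus (|m0|^2 + |m1|^2) times
  \<open>p\<close>.\<close>

lemma fiber_frame:
  assumes sum: "square_summable a" "square_summable b" "square_summable p"
    and on: "fiber_inner a a = 1" "fiber_inner b b = 1" "fiber_inner a b = 0" "fiber_inner p p = 1"
    and m: "m0 = fiber_inner p a" "m1 = fiber_inner p b"
    and p: "p = (\<lambda>l. m0 * a l + m1 * b l)"
    and u: "u0 = (\<lambda>l. a l - cnj m0 * p l)" "u1 = (\<lambda>l. b l - cnj m1 * p l)"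
  shows "(cmod m0)\<^sup>2 + (cmod m1)\<^sup>2 = 1" "square_summable u0" "square_summable u1"
    "fiber_inner u0 u0 = of_real ((cmod m1)\<^sup>2)" "fiber_inner u1 u1 = of_real ((cmod m0)\<^sup>2)"
    "m0 * u0 l + m1 * u1 l = 0"
proof -
  note cm = square_integrable_cmult
  have ba: "fiber_inner b a = 0" using on(3) fiber_inner_cnj[of b a] by simp
  have ap: "fiber_inner a p = cnj m0" "fiber_inner b p = cnj m1"
    unfolding m by (rule fiber_inner_cnj)+
  have "fiber_inner p p = fiber_inner p (\<lambda>l. m0 * a l + m1 * b l)"
    by (subst (2) p) (rule refl)
  also have "\<dots> = cnj m0 * m0 + cnj m1 * m1"
    using sum by (simp add: fiber_inner_add(2) cm fiber_inner_cmult(2) flip: m)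
  also have "\<dots> = of_real ((cmod m0)\<^sup>2 + (cmod m1)\<^sup>2)"
    by (simp only: of_real_add complex_norm_square mult.commute)
  finally have "complex_of_real ((cmod m0)\<^sup>2 + (cmod m1)\<^sup>2) = 1" by (simp only: on(4))
  then show m1: "(cmod m0)\<^sup>2 + (cmod m1)\<^sup>2 = 1" by (simp only: of_real_eq_1_iff)
  show s: "square_summable u0" "square_summable u1"
    unfolding u using sum by (simp_all add: square_integrable_diff cm)
  have "fiber_inner u0 u0 = 1 - m0 * cnj m0"
    unfolding u using sum
    by (simp add: fiber_inner_diff square_integrable_diff cm fiber_inner_cmult on ap flip: m)
  also have "\<dots> = of_real (1 - (cmod m0)\<^sup>2)"
    by (simp only: of_real_diff of_real_1 complex_norm_square)
  also have "1 - (cmod m0)\<^sup>2 = (cmod m1)\<^sup>2" using m1 by simp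
  finally show "fiber_inner u0 u0 = of_real ((cmod m1)\<^sup>2)" .
  have "fiber_inner u1 u1 = 1 - m1 * cnj m1"
    unfolding u using sum
    by (simp add: fiber_inner_diff square_integrable_diff cm fiber_inner_cmult on ap flip: m)
  also have "\<dots> = of_real (1 - (cmod m1)\<^sup>2)"
    by (simp only: of_real_diff of_real_1 complex_norm_square)
  also have "1 - (cmod m1)\<^sup>2 = (cmod m0)\<^sup>2" using m1 by simp
  finally show "fiber_inner u1 u1 = of_real ((cmod m0)\<^sup>2)" .
  have "m0 * u0 l + m1 * u1 l = (m0 * a l + m1 * b l) - (m0 * cnj m0 + m1 * cnj m1) * p l"
    unfolding u by (simp add: algebra_simps)
  also have "m0 * cnj m0 + m1 * cnj m1 = of_real ((cmod m0)\<^sup>2 + (cmod m1)\<^sup>2)"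
    by (simp only: of_real_add complex_norm_square)
  also have "\<dots> = 1" by (simp only: m1 of_real_1)
  also have "m0 * a l + m1 * b l = p l" by (subst p) (rule refl)
  finally show "m0 * u0 l + m1 * u1 l = 0" by simp
qed

text \<open>The predicate \<open>Q\<close> stands for either threshold, weak for E and strict for F,
  so both cutoffs are covered at once.\<close>

lemma normalized_cutoff:
  assumes h: "h \<in> L2" and Q [measurable]: "Measurable.pred borel Q" and Q_ge: "\<And>t. Q t \<Longrightarrow> t \<ge> ennreal (1 / 2)"
  defines "c \<equiv> \<lambda>\<xi>. indicator {\<xi>. Q (fourier_vec_norm_sq h \<xi>)} \<xi> / fourier_vec_norm h \<xi>"
  shows "c \<in> borel_measurable borel" "\<bar>c \<xi>\<bar> \<le> sqrt 2" "c (\<xi> + of_int l) = c \<xi>"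
proof -
  have [measurable]: "fourier_vec_norm_sq h \<in> borel_measurable borel" using h by measurable
  show "c \<in> borel_measurable borel"
    unfolding c_def fourier_vec_norm_def[abs_def] by measurable
  show "c (\<xi> + of_int l) = c \<xi>"
    by (simp add: c_def fourier_vec_norm_def fourier_vec_norm_sq_periodic indicator_def)
  show "\<bar>c \<xi>\<bar> \<le> sqrt 2"
  \<comment> \<open>An infinite sum may satisfy \<open>Q\<close>, but there
    \<open>fourier_vec_norm\<close> is 0 and so is the quotient; the bound thus holds at every
    point.\<close>
  proof (cases "Q (fourier_vec_norm_sq h \<xi>) \<and> fourier_vec_norm_sq h \<xi> \<noteq> top")
    case True
    then obtain r where r: "fourier_vec_norm_sq h \<xi> = ennreal r" "r \<ge> 0" by (cases "fourier_vec_norm_sq h \<xi>") auto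
    have "Q (ennreal r)" using True r by simp
    from Q_ge[OF this] have "1 / 2 \<le> r" by (simp only: ennreal_le_iff[OF r(2)])
    then have "sqrt (1 / 2) \<le> sqrt r" by (rule real_sqrt_le_mono)
    moreover have "sqrt r > 0" using \<open>1 / 2 \<le> r\<close> by simp
    ultimately have "1 / sqrt r \<le> sqrt 2" by (simp add: real_sqrt_divide divide_simps mult.commute)
    then show ?thesis using True r by (simp add: c_def fourier_vec_norm_def)
  qed (auto simp: c_def fourier_vec_norm_def indicator_def)
qed

section \<open>Generators of \<open>V 1\<close> and the transforms of the projections\<close>

context
  fixes V :: "int \<Rightarrow> (real \<Rightarrow> complex) set" and \<phi> :: "real \<Rightarrow> complex"
  assumes mra: "multiresolution_analysis V" and sc: "scaling_function V \<phi>"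
begin

lemma scaling_V0: "\<phi> \<in> V 0" "\<And>k::int. (shift k \<phi>) \<in> V 0"
  using sc by (auto simp: scaling_function_def orthonormal_basis_of_def op_powi_translation)

lemma scaling_L2: "\<phi> \<in> L2"
  by (rule mra_L2[OF mra scaling_V0(1)])

lemma scaling_orthonormal: "l2_inner (shift k \<phi>) (shift l \<phi>) = (if k = l then 1 else 0)"
  using sc by (simp add: scaling_function_def orthonormal_basis_of_def op_powi_translation)

lemma scaling_span: "l2_closed_span (range (\<lambda>(k::int) x. \<phi> (x - of_int k))) = V 0"
  using sc by (simp add: scaling_function_def orthonormal_basis_of_def op_powi_translation)

lemma V0_orthI:
  assumes "h \<in> L2" "\<And>k::int. l2_inner h (shift k \<phi>) = 0" "v \<in> V 0"
  shows "l2_inner h v = 0"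
  by (rule l2_closed_span_orth[of "range (\<lambda>(k::int) x. \<phi> (x - of_int k))"])
    (use assms scaling_span L2_shift[OF scaling_L2] in auto)

lemma V0_shift:
  assumes "v \<in> V 0"
  shows "(shift k v) \<in> V 0"
proof -
  have "(shift k v) \<in> l2_closed_span (range (\<lambda>(k::int) x. \<phi> (x - of_int k)))"
  proof (rule l2_closed_span_shift)
    fix a assume "a \<in> range (\<lambda>(k::int) x. \<phi> (x - of_int k))"
    then obtain j :: int where "a = (shift j \<phi>)" by blast
    then have "(shift k a) = (shift (k + j) \<phi>)"
      by (simp add: algebra_simps)
    then show "(shift k a) \<in> range (\<lambda>(k::int) x. \<phi> (x - of_int k))"
      by blast
  qed (use assms scaling_span L2_shift[OF scaling_L2] in auto)
  then show ?thesis by (simp only: scaling_span)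
qed

lemma dilation_in_V1: "v \<in> V 0 \<Longrightarrow> dilation v \<in> V 1"
  using mra_dilation[OF mra, of v 0 1] by (simp add: dilation_1)

lemma V1_shift:
  assumes "v \<in> V 1"
  shows "(shift k v) \<in> V 1"
proof -
  have "dilation ` V 0 = V (0 + 1)" using mra unfolding multiresolution_analysis_def by blast
  then obtain w where w: "w \<in> V 0" "v = dilation w" using assms by auto
  \<comment> \<open>Dilation turns translation by 2k into translation by k, so invariance of
    \<open>V 0\<close> carries over to \<open>V 1\<close>.\<close>
  have "(shift k v) = dilation (shift (2 * k) w)"
    by (simp add: w dilation_def algebra_simps)
  then show ?thesis using dilation_in_V1[OF V0_shift[OF w(1), of "2 * k"]] by simp
qed

abbreviation (input) "gen0 \<equiv> dilation \<phi>"

abbreviation (input) "gen1 \<equiv> dilation (translation \<phi>)"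

text \<open>The translates of the first generator are the dilates of the even translates of the
  scaling function, those of the second the dilates of the odd ones. Together they exhaust the
  dilated basis of \<open>V 0\<close>, which is why two generators are needed and why they are
  orthonormal.\<close>

lemma dilation_shift:
  "(shift k gen0) = dilation (shift (2 * k) \<phi>)"
  "(shift k gen1) = dilation (shift (2 * k + 1) \<phi>)"
  by (simp_all add: dilation_def translation_def algebra_simps)

lemma generators_V1: "dilation \<phi> \<in> V 1" "dilation (translation \<phi>) \<in> V 1"
  using dilation_in_V1[OF scaling_V0(1)] dilation_in_V1[OF scaling_V0(2)[of 1]]
  by (simp_all add: translation_def[abs_def])

lemma generators_orthonormal:
  "l2_inner gen0 (shift k gen0) = (if k = 0 then 1 else 0)"
  "l2_inner gen1 (shift k gen1) = (if k = 0 then 1 else 0)"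
  "l2_inner gen0 (shift k gen1) = 0"
proof -
  have D: "l2_inner (dilation f) (dilation g) = l2_inner f g" for f g
    using l2_inner_dilation[of 1 f g] by (simp add: dilation_1)
  note o = scaling_orthonormal
  show "l2_inner gen0 (shift k gen0) = (if k = 0 then 1 else 0)"
    unfolding dilation_shift D using o[of 0 "2 * k"] by simp
  show "l2_inner gen1 (shift k gen1) = (if k = 0 then 1 else 0)"
    unfolding dilation_shift D unfolding translation_def using o[of 1 "2 * k + 1"] by simp
  have "0 \<noteq> 2 * k + 1" by presburger
  then show "l2_inner gen0 (shift k gen1) = 0"
    unfolding dilation_shift D using o[of 0 "2 * k + 1"] by simp
qed

text \<open>Undoing one dilation moves the question to \<open>V 0\<close>, where the parity of a
  translate decides which of the two hypotheses applies.\<close>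

lemma V1_orthI:
  assumes h: "h \<in> L2" and a: "\<And>k::int. l2_inner h (shift k gen0) = 0"
    and b: "\<And>k::int. l2_inner h (shift k gen1) = 0" and v: "v \<in> V 1"
  shows "l2_inner h v = 0"
proof -
  have eq: "l2_inner (op_powi dilation (-1) h) f = l2_inner h (dilation f)" for f
    using l2_inner_dilation[of 1 "op_powi dilation (-1) h" f] by (simp add: dilation_add dilation_1)
  have "dilation ` V 0 = V (0 + 1)" using mra unfolding multiresolution_analysis_def by blast
  then obtain w where w: "w \<in> V 0" "v = dilation w" using v by auto
  have "l2_inner (op_powi dilation (-1) h) w = 0"
  proof (rule V0_orthI[OF L2_dilation[OF h] _ w(1)])
    fix k :: int
    show "l2_inner (op_powi dilation (-1) h) (shift k \<phi>) = 0"
    proof (cases "even k")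
      case True
      then obtain j where "k = 2 * j" by (elim evenE)
      then show ?thesis using a[of j] unfolding eq dilation_shift by simp
    next
      case False
      then obtain j where "k = 2 * j + 1" by (elim oddE)
      then show ?thesis using b[of j] unfolding eq dilation_shift by simp
    qed
  qed
  then show ?thesis by (simp only: eq w(2))
qed

abbreviation (input) "mra_complement \<equiv> orth_complement_in (V 1) (V 0)"

lemma mra_complement_subspace: "l2_closed_subspace mra_complement"
  using mra_L2[OF mra] by (intro l2_closed_subspace_orth_complement_in mra_closed_subspace[OF mra]) auto

lemma mra_complement_L2: "w \<in> mra_complement \<Longrightarrow> w \<in> L2"
  using l2_closed_subspaceD(1)[OF mra_complement_subspace] .

lemma mra_complement_shift:
  assumes w: "w \<in> mra_complement"
  shows "(shift k w) \<in> mra_complement"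
proof -
  have "l2_inner (shift k w) v = 0" if "v \<in> V 0" for v
  proof -
    have "l2_inner (shift k w) v = l2_inner w (shift (- k) v)"
      using l2_inner_shift[of w "of_int k" "\<lambda>x. v (x - of_int (- k))"] by simp
    then show ?thesis using w V0_shift[OF that, of "- k"] by (simp add: orth_complement_in_def)
  qed
  then show ?thesis using w V1_shift[of w k] by (simp add: orth_complement_in_def)
qed

text \<open>The truncation acts on a null set only; it makes the mask bounded everywhere.\<close>
definition "lowpass e \<xi> = (let t = bracket (fourier \<phi>) (fourier e) \<xi> in if cmod t \<le> 1 then t else 0)"

lemma lowpass:
  assumes e: "e \<in> L2"
  shows "lowpass e \<in> borel_measurable borel" "cmod (lowpass e \<xi>) \<le> 1" "lowpass e (\<xi> + of_int l) = lowpass e \<xi>"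
proof -
  have [measurable]: "fourier e \<in> borel_measurable borel" "fourier \<phi> \<in> borel_measurable borel"
    using e scaling_L2 by simp_all
  show "lowpass e \<in> borel_measurable borel" unfolding lowpass_def[abs_def] Let_def by measurable
qed (simp_all add: lowpass_def Let_def bracket_periodic)

lemma bracket_scaling: "AE \<xi> in lborel. bracket (fourier \<phi>) (fourier \<phi>) \<xi> = 1"
  using bracket_eq_1_iff[OF scaling_L2] scaling_orthonormal[of 0] by simp

text \<open>For almost every frequency both fibers are unit vectors, so Cauchy-Schwarz bounds the
  bracket by 1 and the truncation does not act.\<close>

lemma lowpass_eq:
  assumes e: "e \<in> L2" and "AE \<xi> in lborel. bracket (fourier e) (fourier e) \<xi> = 1"
  shows "AE \<xi> in lborel. lowpass e \<xi> = bracket (fourier \<phi>) (fourier e) \<xi>"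
  using AE_square_summable_fiber[OF e]
    AE_square_summable_fiber[OF scaling_L2] assms(2) bracket_scaling
proof eventually_elim
  fix \<xi>
  assume "square_summable (fiber (fourier e) \<xi>)" "square_summable (fiber (fourier \<phi>) \<xi>)"
    "bracket (fourier e) (fourier e) \<xi> = 1" "bracket (fourier \<phi>) (fourier \<phi>) \<xi> = 1"
  then have "cmod (bracket (fourier \<phi>) (fourier e) \<xi>) \<le> 1"
    unfolding bracket_fiber by (intro fiber_Cauchy_Schwarz)
  then show "lowpass e \<xi> = bracket (fourier \<phi>) (fourier e) \<xi>" by (simp add: lowpass_def Let_def)
qed

lemma bracket_generators:
  "AE \<xi> in lborel. bracket (fourier gen0) (fourier gen0) \<xi> = 1"
  "AE \<xi> in lborel. bracket (fourier gen1) (fourier gen1) \<xi> = 1"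
  "AE \<xi> in lborel. bracket (fourier gen0) (fourier gen1) \<xi> = 0"
  using bracket_eq_1_iff[of gen0] bracket_eq_1_iff[of gen1]
    bracket_eq_0[of gen0 gen1] generators_orthonormal
    mra_L2[OF mra generators_V1(1)] mra_L2[OF mra generators_V1(2)] by auto

text \<open>The right-hand side is the transform of some \<open>z\<close> in \<open>V 1\<close>,
  obtained from bounded periodic multipliers. The residual \<open>r\<close> of the scaling function
  lies in \<open>V 1\<close> and has vanishing bracket with both generators, so it is orthogonal to
  itself. No infinite series is summed.\<close>

lemma fourier_scaling_expansion:
  "AE \<xi> in lborel. fourier \<phi> \<xi> = lowpass gen0 \<xi> * fourier gen0 \<xi>
      + lowpass gen1 \<xi> * fourier gen1 \<xi>"
proof -
  define a b where "a = dilation \<phi>" and "b = dilation (translation \<phi>)"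
  have aV: "a \<in> V 1" "b \<in> V 1" using generators_V1 by (auto simp: a_def b_def)
  have L: "a \<in> L2" "b \<in> L2" "\<phi> \<in> L2" using mra_L2[OF mra] aV scaling_L2 by auto
  note br = bracket_generators[folded a_def b_def]
  note V1 = mra_closed_subspace[OF mra, of 1]
  obtain z0 where z0: "z0 \<in> V 1" "AE \<xi> in lborel. fourier z0 \<xi> = lowpass a \<xi> * fourier a \<xi>"
    using periodic_multiplier_exists[OF V1 V1_shift[OF aV(1)] lowpass[OF L(1)]] by blast
  obtain z1 where z1: "z1 \<in> V 1" "AE \<xi> in lborel. fourier z1 \<xi> = lowpass b \<xi> * fourier b \<xi>"
    using periodic_multiplier_exists[OF V1 V1_shift[OF aV(2)] lowpass[OF L(2)]] by blast
  define z where "z x = z0 x + z1 x" for x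
  have zV: "z \<in> V 1" unfolding z_def[abs_def] using l2_closed_subspaceD(3)[OF V1 z0(1) z1(1)] .
  have zL: "z \<in> L2" "z0 \<in> L2" "z1 \<in> L2" using mra_L2[OF mra] zV z0 z1 by auto
  have zF: "AE \<xi> in lborel. fourier z \<xi> = lowpass a \<xi> * fourier a \<xi> + lowpass b \<xi> * fourier b \<xi>"
    using fourier_add[OF zL(2,3)] z0(2) z1(2) unfolding z_def[abs_def] by eventually_elim simp
  define r where "r x = \<phi> x - z x" for x
  have "\<phi> \<in> V 1" using scaling_V0(1) mra_mono[OF mra, of 0 1] by auto
  then have rV: "r \<in> V 1" unfolding r_def[abs_def] by (rule l2_closed_subspace_diff[OF V1 _ zV])
  have rL: "r \<in> L2" using mra_L2[OF mra rV] .
  have rF: "AE \<xi> in lborel. fourier r \<xi> = fourier \<phi> \<xi> - (lowpass a \<xi> * fourier a \<xi> + lowpass b \<xi> * fourier b \<xi>)"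
    using fourier_diff[OF L(3) zL(1)] zF unfolding r_def[abs_def] by eventually_elim simp
  have "AE \<xi> in lborel. bracket (fourier r) (fourier a) \<xi> = 0 \<and> bracket (fourier r) (fourier b) \<xi> = 0"
    using AE_lborel_all_shifts[OF rF] lowpass_eq[OF L(1) br(1)] lowpass_eq[OF L(2) br(2)] br
      AE_square_summable_fiber[OF L(1)]
      AE_square_summable_fiber[OF L(2)]
      AE_square_summable_fiber[OF L(3)]
  proof eventually_elim
    case (elim \<xi>)
    let ?a = "fiber (fourier a) \<xi>" and ?b = "fiber (fourier b) \<xi>" and ?p = "fiber (fourier \<phi>) \<xi>"
    have fr: "fiber (fourier r) \<xi> = (\<lambda>l. ?p l - (lowpass a \<xi> * ?a l + lowpass b \<xi> * ?b l))"
      using elim(1) by (simp add: fun_eq_iff fiber_def lowpass L)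
    have "fiber_inner ?b ?a = 0" using elim(6) fiber_inner_cnj[of ?b ?a] by (simp add: bracket_fiber)
    then show ?case
      using elim unfolding bracket_fiber fr
      by (simp add: fiber_inner_diff fiber_inner_add fiber_inner_cmult square_integrable_add square_integrable_cmult)
  qed
  then have "AE \<xi> in lborel. bracket (fourier r) (fourier a) \<xi> = 0" "AE \<xi> in lborel. bracket (fourier r) (fourier b) \<xi> = 0"
    by auto
  then have "l2_inner r (shift k a) = 0" "l2_inner r (shift k b) = 0" for k
    using l2_inner_shift_eq_0[OF rL] L by auto
  then have "l2_inner r r = 0" unfolding a_def b_def by (intro V1_orthI[OF rL _ _ rV])
  from fourier_AE_0[OF rL l2_inner_self_eq_0[OF rL this]] rF
  show ?thesis unfolding a_def b_def by eventually_elim simp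
qed

text \<open>\<open>z\<close> is the expected component of \<open>e\<close> in \<open>V 0\<close>, so
  the claim is that \<open>r\<close>, which is \<open>e - q - z\<close>, vanishes. Its bracket with
  the scaling function is 0: the contributions of \<open>e\<close> and \<open>z\<close> cancel, and
  \<open>q\<close> is orthogonal to \<open>V 0\<close>.\<close>

lemma fourier_complement_projection:
  assumes e: "e \<in> V 1" and br: "AE \<xi> in lborel. bracket (fourier e) (fourier e) \<xi> = 1"
  shows "AE \<xi> in lborel. fourier (orth_proj mra_complement e) \<xi> = fourier e \<xi> - cnj (lowpass e \<xi>) * fourier \<phi> \<xi>"
proof -
  define q where "q = orth_proj mra_complement e"
  have eL: "e \<in> L2" using mra_L2[OF mra e] .
  have q: "q \<in> mra_complement" "\<And>w. w \<in> mra_complement \<Longrightarrow> l2_inner (\<lambda>x. e x - q x) w = 0"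
    using orth_proj[OF mra_complement_subspace eL] by (auto simp: q_def)
  have qL: "q \<in> L2" using mra_complement_L2[OF q(1)] .
  have "(\<lambda>\<xi>. cnj (lowpass e \<xi>)) \<in> borel_measurable borel" using lowpass(1)[OF eL] by measurable
  then obtain z where z: "z \<in> V 0" "AE \<xi> in lborel. fourier z \<xi> = cnj (lowpass e \<xi>) * fourier \<phi> \<xi>"
    using periodic_multiplier_exists[OF mra_closed_subspace[OF mra, of 0] scaling_V0(2), of "\<lambda>\<xi>. cnj (lowpass e \<xi>)" 1]
      lowpass(2,3)[OF eL] by auto
  have zL: "z \<in> L2" using mra_L2[OF mra z(1)] .
  have dL: "(\<lambda>x. e x - q x) \<in> L2" by (rule L2_diff[OF eL qL])
  define r where "r x = (e x - q x) - z x" for x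
  have rL: "r \<in> L2" unfolding r_def[abs_def] by (rule L2_diff[OF dL zL])
  note V1 = mra_closed_subspace[OF mra, of 1]
  have rV: "r \<in> V 1"
    unfolding r_def[abs_def]
    using e q(1) z(1) mra_mono[OF mra, of 0 1]
    by (intro l2_closed_subspace_diff[OF V1]) (auto simp: orth_complement_in_def)
  have rF: "AE \<xi> in lborel. fourier r \<xi> = fourier e \<xi> - fourier q \<xi> - cnj (lowpass e \<xi>) * fourier \<phi> \<xi>"
    using fourier_diff[OF dL zL] fourier_diff[OF eL qL] z(2) unfolding r_def[abs_def]
    by eventually_elim simp
  have q\<phi>: "AE \<xi> in lborel. bracket (fourier q) (fourier \<phi>) \<xi> = 0"
    using q(1) scaling_V0(2) by (intro bracket_eq_0 qL scaling_L2) (auto simp: orth_complement_in_def)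
  have "AE \<xi> in lborel. bracket (fourier r) (fourier \<phi>) \<xi> = 0"
    using AE_lborel_all_shifts[OF rF] lowpass_eq[OF eL br] q\<phi> bracket_scaling
      AE_square_summable_fiber[OF eL]
      AE_square_summable_fiber[OF qL]
      AE_square_summable_fiber[OF scaling_L2]
  proof eventually_elim
    case (elim \<xi>)
    let ?e = "fiber (fourier e) \<xi>" and ?q = "fiber (fourier q) \<xi>" and ?p = "fiber (fourier \<phi>) \<xi>"
    have fr: "fiber (fourier r) \<xi> = (\<lambda>l. ?e l - ?q l - cnj (lowpass e \<xi>) * ?p l)"
      using elim(1) by (simp add: fun_eq_iff fiber_def lowpass eL)
    have "fiber_inner ?e ?p = cnj (lowpass e \<xi>)"
      using elim(2) fiber_inner_cnj[of ?e ?p] by (simp add: bracket_fiber)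
    then show ?case
      using elim(3-7) unfolding bracket_fiber fr
      by (simp add: fiber_inner_diff fiber_inner_cmult square_integrable_diff square_integrable_cmult)
  qed
  then have orth: "l2_inner r v = 0" if "v \<in> V 0" for v
    using V0_orthI[OF rL l2_inner_shift_eq_0[OF rL scaling_L2] that] by blast
  \<comment> \<open>Now \<open>r\<close> is orthogonal to \<open>e - q\<close>, because it lies in
    the complement, and to \<open>z\<close>, because it is orthogonal to \<open>V 0\<close>; hence
    to their difference, which is \<open>r\<close> itself.\<close>
  then have "r \<in> mra_complement" using rV by (simp add: orth_complement_in_def)
  then have "l2_inner (\<lambda>x. e x - q x) r = 0" by (rule q(2))
  moreover have "l2_inner r z = 0" by (rule orth[OF z(1)])
  moreover have "l2_inner r r = l2_inner r (\<lambda>x. e x - q x) - l2_inner r z"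
    using l2_inner_diff_right[OF dL zL rL] by (simp add: r_def[abs_def])
  ultimately have "l2_inner r r = 0" by (simp add: l2_inner_eq_0_sym)
  from fourier_AE_0[OF rL l2_inner_self_eq_0[OF rL this]] rF
  show ?thesis unfolding q_def[symmetric] by eventually_elim algebra
qed

end

section \<open>The cutoff generator\<close>

text \<open>Since the two squares add up to 1, exactly one condition holds, so one summand survives,
  normalized to length 1; a tie goes to \<open>u0\<close>. The coefficient of the other vector in
  the linear relation is then nonzero, so orthogonality to the surviving vector forces orthogonality
  to both.\<close>

lemma fiber_cutoff:
  assumes m: "(cmod m0)\<^sup>2 + (cmod m1)\<^sup>2 = 1" and s: "square_summable u0" "square_summable u1"
    and u: "fiber_inner u0 u0 = of_real ((cmod m1)\<^sup>2)" "fiber_inner u1 u1 = of_real ((cmod m0)\<^sup>2)"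
    and rel: "\<And>l. m0 * u0 l + m1 * u1 l = 0"
    and y: "y = (\<lambda>l. of_real (if (cmod m1)\<^sup>2 \<ge> 1/2 then 1 / cmod m1 else 0) * u0 l
        + of_real (if (cmod m0)\<^sup>2 > 1/2 then 1 / cmod m0 else 0) * u1 l)"
  shows "fiber_inner y y = 1"
    and "square_summable v \<Longrightarrow> fiber_inner v y = 0 \<Longrightarrow> fiber_inner v u0 = 0 \<and> fiber_inner v u1 = 0"
proof -
  have rel': "cnj m0 * fiber_inner v u0 + cnj m1 * fiber_inner v u1 = 0" if "square_summable v" for v
  proof -
    have "fiber_inner v (\<lambda>l. m0 * u0 l + m1 * u1 l) = 0"
      unfolding rel by (simp add: fiber_inner_def)
    then show ?thesis
      using that s by (simp add: fiber_inner_add fiber_inner_cmult square_integrable_cmult)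
  qed
  have "fiber_inner y y = 1 \<and> (square_summable v \<longrightarrow> fiber_inner v y = 0 \<longrightarrow> fiber_inner v u0 = 0 \<and> fiber_inner v u1 = 0)"
  proof (cases "(cmod m1)\<^sup>2 \<ge> 1/2")
    case True
    then have y': "y = (\<lambda>l. of_real (1 / cmod m1) * u0 l)" using m by (simp add: y)
    have "m1 \<noteq> 0" using True by auto
    then show ?thesis
      using rel'[of v] unfolding y' fiber_inner_cmult u by (auto simp: power2_eq_square)
  next
    case False
    then have y': "y = (\<lambda>l. of_real (1 / cmod m0) * u1 l)" using m by (simp add: y)
    have "m0 \<noteq> 0" using False m by auto
    then show ?thesis
      using rel'[of v] unfolding y' fiber_inner_cmult u by (auto simp: power2_eq_square)
  qed
  then show "fiber_inner y y = 1"
    and "square_summable v \<Longrightarrow> fiber_inner v y = 0 \<Longrightarrow> fiber_inner v u0 = 0 \<and> fiber_inner v u1 = 0"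
    by blast+
qed

text \<open>\<open>fiber_frame\<close> applied at almost every frequency. A fiber involves all
  integer translates, so the almost-everywhere formulas are first made valid on all translates at
  once; periodicity of \<open>lowpass\<close> makes its values constant along the fiber.\<close>

lemma complement_fibers:
  assumes mra: "multiresolution_analysis V" and sc: "scaling_function V \<phi>"
    and a: "a = dilation \<phi>" and b: "b = dilation (translation \<phi>)"
    and W: "W = orth_complement_in (V 1) (V 0)"
    and u: "u0 = orth_proj W a" "u1 = orth_proj W b"
  shows "AE \<xi> in lborel. (cmod (lowpass \<phi> a \<xi>))\<^sup>2 + (cmod (lowpass \<phi> b \<xi>))\<^sup>2 = 1
      \<and> square_summable (fiber (fourier u0) \<xi>) \<and> square_summable (fiber (fourier u1) \<xi>)
      \<and> bracket (fourier u0) (fourier u0) \<xi> = of_real ((cmod (lowpass \<phi> b \<xi>))\<^sup>2)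
      \<and> bracket (fourier u1) (fourier u1) \<xi> = of_real ((cmod (lowpass \<phi> a \<xi>))\<^sup>2)
      \<and> (\<forall>l. lowpass \<phi> a \<xi> * fiber (fourier u0) \<xi> l + lowpass \<phi> b \<xi> * fiber (fourier u1) \<xi> l = 0)"
proof -
  note V1 = generators_V1[OF mra sc, folded a b]
  note br = bracket_generators[OF mra sc, folded a b]
  note \<phi>L = scaling_L2[OF mra sc]
  have L: "a \<in> L2" "b \<in> L2" using mra_L2[OF mra] V1 by auto
  note mp = lowpass[OF mra sc]
  show ?thesis
    using AE_lborel_all_shifts[OF fourier_scaling_expansion[OF mra sc, folded a b]]
      AE_lborel_all_shifts[OF fourier_complement_projection[OF mra sc V1(1) br(1), folded W u]]
      AE_lborel_all_shifts[OF fourier_complement_projection[OF mra sc V1(2) br(2), folded W u]]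
      lowpass_eq[OF mra sc L(1) br(1)] lowpass_eq[OF mra sc L(2) br(2)] br bracket_scaling[OF mra sc]
      AE_square_summable_fiber[OF L(1)]
      AE_square_summable_fiber[OF L(2)]
      AE_square_summable_fiber[OF \<phi>L]
  proof eventually_elim
    case (elim \<xi>)
    have "fiber (fourier \<phi>) \<xi> = (\<lambda>l. lowpass \<phi> a \<xi> * fiber (fourier a) \<xi> l + lowpass \<phi> b \<xi> * fiber (fourier b) \<xi> l)"
      "fiber (fourier u0) \<xi> = (\<lambda>l. fiber (fourier a) \<xi> l - cnj (lowpass \<phi> a \<xi>) * fiber (fourier \<phi>) \<xi> l)"
      "fiber (fourier u1) \<xi> = (\<lambda>l. fiber (fourier b) \<xi> l - cnj (lowpass \<phi> b \<xi>) * fiber (fourier \<phi>) \<xi> l)"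
      using elim(1-3) by (simp_all add: fun_eq_iff fiber_def mp L)
    note fr = fiber_frame[OF elim(10-12) elim(6-9)[unfolded bracket_fiber] elim(4,5)[unfolded bracket_fiber] this]
    show ?case
      unfolding bracket_fiber using fr by blast
  qed
qed

text \<open>Both cutoffs are periodic and bounded by sqrt 2, so each product is the transform of an
  element of the complement.\<close>

theorem cutoff_exists:
  assumes mra: "multiresolution_analysis V" and sc: "scaling_function V \<phi>"
    and W: "W = orth_complement_in (V 1) (V 0)"
    and uW: "u0 \<in> W" "u1 \<in> W"
    and f: "f = (\<lambda>\<xi>. indicator {\<xi>. fourier_vec_norm_sq u0 \<xi> \<ge> ennreal (1 / 2)} \<xi> / fourier_vec_norm u0 \<xi>)"
    and g: "g = (\<lambda>\<xi>. indicator {\<xi>. fourier_vec_norm_sq u1 \<xi> > ennreal (1 / 2)} \<xi> / fourier_vec_norm u1 \<xi>)"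
  shows "\<exists>z\<in>W. AE \<xi> in lborel. fourier z \<xi> = of_real (f \<xi>) * fourier u0 \<xi> + of_real (g \<xi>) * fourier u1 \<xi>"
proof -
  note Wsub = mra_complement_subspace[OF mra sc, folded W]
  note WL = mra_complement_L2[OF mra sc, folded W]
  note Wshift = mra_complement_shift[OF mra sc, folded W]
  note uL = WL[OF uW(1)] WL[OF uW(2)]
  have f_props: "f \<in> borel_measurable borel" "\<And>\<xi>. \<bar>f \<xi>\<bar> \<le> sqrt 2" "\<And>\<xi> l. f (\<xi> + of_int l) = f \<xi>"
    unfolding f by (rule normalized_cutoff[OF uL(1), of "\<lambda>t. t \<ge> ennreal (1 / 2)"]; simp)+
  have g_props: "g \<in> borel_measurable borel" "\<And>\<xi>. \<bar>g \<xi>\<bar> \<le> sqrt 2" "\<And>\<xi> l. g (\<xi> + of_int l) = g \<xi>"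
    unfolding g by (rule normalized_cutoff[OF uL(2), of "\<lambda>t. t > ennreal (1 / 2)"]; simp)+
  obtain z0 where z0: "z0 \<in> W" "AE \<xi> in lborel. fourier z0 \<xi> = of_real (f \<xi>) * fourier u0 \<xi>"
    by (rule periodic_multiplier_exists[OF Wsub Wshift[OF uW(1)], of "\<lambda>\<xi>. of_real (f \<xi>)" "sqrt 2"])
      (use f_props in auto)
  obtain z1 where z1: "z1 \<in> W" "AE \<xi> in lborel. fourier z1 \<xi> = of_real (g \<xi>) * fourier u1 \<xi>"
    by (rule periodic_multiplier_exists[OF Wsub Wshift[OF uW(2)], of "\<lambda>\<xi>. of_real (g \<xi>)" "sqrt 2"])
      (use g_props in auto)
  have "(\<lambda>x. z0 x + z1 x) \<in> W" using l2_closed_subspaceD(3)[OF Wsub z0(1) z1(1)] .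
  moreover have "AE \<xi> in lborel. fourier (\<lambda>x. z0 x + z1 x) \<xi> = of_real (f \<xi>) * fourier u0 \<xi> + of_real (g \<xi>) * fourier u1 \<xi>"
    using fourier_add[OF WL[OF z0(1)] WL[OF z1(1)]] z0(2) z1(2) by eventually_elim simp
  ultimately show ?thesis by blast
qed

theorem cutoff_wavelet:
  assumes mra: "multiresolution_analysis V" and sc: "scaling_function V \<phi>"
    and W: "W = orth_complement_in (V 1) (V 0)"
    and u: "u0 = orth_proj W (dilation \<phi>)" "u1 = orth_proj W (dilation (translation \<phi>))"
    and f: "f = (\<lambda>\<xi>. indicator {\<xi>. fourier_vec_norm_sq u0 \<xi> \<ge> ennreal (1 / 2)} \<xi> / fourier_vec_norm u0 \<xi>)"
    and g: "g = (\<lambda>\<xi>. indicator {\<xi>. fourier_vec_norm_sq u1 \<xi> > ennreal (1 / 2)} \<xi> / fourier_vec_norm u1 \<xi>)"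
    and \<psi>: "\<psi> \<in> L2" "AE \<xi> in lborel. fourier \<psi> \<xi> = of_real (f \<xi>) * fourier u0 \<xi> + of_real (g \<xi>) * fourier u1 \<xi>"
  shows "orthonormal_wavelet \<psi>" and "\<psi> \<in> W"
proof -
  define a b where a: "a = dilation \<phi>" and b: "b = dilation (translation \<phi>)"
  note V1 = generators_V1[OF mra sc, folded a b]
  note br = bracket_generators[OF mra sc, folded a b]
  note \<phi>L = scaling_L2[OF mra sc]
  note Wsub = mra_complement_subspace[OF mra sc, folded W]
  note WL = mra_complement_L2[OF mra sc, folded W]
  note Wshift = mra_complement_shift[OF mra sc, folded W]
  have L: "a \<in> L2" "b \<in> L2" using mra_L2[OF mra] V1 by auto
  have uW: "u0 \<in> W" "u1 \<in> W"
    unfolding u using orth_proj(1)[OF Wsub] L by (auto simp: a b)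
  note uL = WL[OF uW(1)] WL[OF uW(2)]
  obtain z where z: "z \<in> W" "AE \<xi> in lborel. fourier z \<xi> = of_real (f \<xi>) * fourier u0 \<xi> + of_real (g \<xi>) * fourier u1 \<xi>"
    using cutoff_exists[OF mra sc W uW f g] by blast
  \<comment> \<open>The given function shares its transform with an element of the complement;
    injectivity and saturation under almost-everywhere equality place it there too.\<close>
  have "AE \<xi> in lborel. fourier z \<xi> = fourier \<psi> \<xi>" using z(2) \<psi>(2) by eventually_elim simp
  then have "AE x in lborel. z x = \<psi> x" by (rule fourier_inj[OF WL[OF z(1)] \<psi>(1)])
  then show \<psi>W: "\<psi> \<in> W"
    using l2_closed_subspace_cong_AE[OF Wsub z(1) L2_measurable[OF \<psi>(1)]] by blast
  note fib = complement_fibers[OF mra sc a b W u[folded a b]]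
  \<comment> \<open>The squared fiber norm of \<open>u0\<close> is the squared modulus of the mask
    of \<open>b\<close>, and vice versa. This turns the thresholds defining the cutoffs into
    conditions on the masks and brings the fiber into the form of
    \<open>fiber_cutoff\<close>.\<close>
  have \<psi>fib: "AE \<xi> in lborel. fiber (fourier \<psi>) \<xi> = (\<lambda>l. of_real (if (cmod (lowpass \<phi> b \<xi>))\<^sup>2 \<ge> 1/2 then 1 / cmod (lowpass \<phi> b \<xi>) else 0) * fiber (fourier u0) \<xi> l
        + of_real (if (cmod (lowpass \<phi> a \<xi>))\<^sup>2 > 1/2 then 1 / cmod (lowpass \<phi> a \<xi>) else 0) * fiber (fourier u1) \<xi> l)"
    using fib AE_lborel_all_shifts[OF \<psi>(2)]
  proof eventually_elim
    case (elim \<xi>)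
    have n0: "fourier_vec_norm_sq u0 \<xi> = ennreal ((cmod (lowpass \<phi> b \<xi>))\<^sup>2)"
      and n1: "fourier_vec_norm_sq u1 \<xi> = ennreal ((cmod (lowpass \<phi> a \<xi>))\<^sup>2)"
      using elim(1) by (simp_all add: fourier_vec_norm_sq_fiber del: of_real_power)
    have "f \<xi> = (if (cmod (lowpass \<phi> b \<xi>))\<^sup>2 \<ge> 1/2 then 1 / cmod (lowpass \<phi> b \<xi>) else 0)"
    proof -
      have E: "fourier_vec_norm_sq u0 \<xi> \<ge> ennreal (1 / 2) \<longleftrightarrow> (cmod (lowpass \<phi> b \<xi>))\<^sup>2 \<ge> 1/2"
        unfolding n0 by (rule ennreal_le_iff) simp
      have N: "fourier_vec_norm u0 \<xi> = cmod (lowpass \<phi> b \<xi>)"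
        by (simp add: fourier_vec_norm_def n0)
      show ?thesis unfolding f indicator_def mem_Collect_eq E N by simp
    qed
    moreover have "g \<xi> = (if (cmod (lowpass \<phi> a \<xi>))\<^sup>2 > 1/2 then 1 / cmod (lowpass \<phi> a \<xi>) else 0)"
    proof -
      have E: "fourier_vec_norm_sq u1 \<xi> > ennreal (1 / 2) \<longleftrightarrow> (cmod (lowpass \<phi> a \<xi>))\<^sup>2 > 1/2"
        unfolding n1 by (rule ennreal_less_iff) simp
      have N: "fourier_vec_norm u1 \<xi> = cmod (lowpass \<phi> a \<xi>)"
        by (simp add: fourier_vec_norm_def n1)
      show ?thesis unfolding g indicator_def mem_Collect_eq E N by simp
    qed
    moreover have "f (\<xi> + of_int l) = f \<xi>" "g (\<xi> + of_int l) = g \<xi>" for l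
      by (simp_all add: f g fourier_vec_norm_def fourier_vec_norm_sq_periodic indicator_def)
    ultimately show ?case
      using elim(2) by (simp add: fun_eq_iff fiber_def)
  qed
  have "AE \<xi> in lborel. bracket (fourier \<psi>) (fourier \<psi>) \<xi> = 1"
    using fib \<psi>fib
  proof eventually_elim
    case (elim \<xi>)
    then show ?case
      unfolding bracket_fiber by (intro fiber_cutoff(1)[OF _ _ _ _ _ _ elim(2)]) auto
  qed
  then have on: "\<And>k::int. l2_inner \<psi> (shift k \<psi>) = (if k = 0 then 1 else 0)"
    using bracket_eq_1_iff[OF \<psi>(1)] by blast
  have compl: "AE x in lborel. w x = 0"
    if w: "w \<in> orth_complement_in (V 1) (V 0)" and orth: "\<And>k::int. l2_inner w (shift k \<psi>) = 0" for w
  proof -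
    have wL: "w \<in> L2" using WL w by (simp add: W)
    have w\<psi>: "AE \<xi> in lborel. bracket (fourier w) (fourier \<psi>) \<xi> = 0"
      by (rule bracket_eq_0[OF wL \<psi>(1) orth])
    have w\<phi>: "AE \<xi> in lborel. bracket (fourier w) (fourier \<phi>) \<xi> = 0"
      using w scaling_V0(2)[OF mra sc] by (intro bracket_eq_0[OF wL \<phi>L]) (auto simp: orth_complement_in_def)
    \<comment> \<open>Fiberwise, \<open>w\<close> is orthogonal to the cutoff generator, hence to
      \<open>u0\<close> and \<open>u1\<close>, and also to the scaling function. The generators
      \<open>a\<close> and \<open>b\<close> are \<open>u0\<close> and \<open>u1\<close> plus
      multiples of the scaling function, so \<open>w\<close> is orthogonal to all of
      \<open>V 1\<close>, including itself.\<close>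
    have "AE \<xi> in lborel. bracket (fourier w) (fourier a) \<xi> = 0 \<and> bracket (fourier w) (fourier b) \<xi> = 0"
      using fib \<psi>fib w\<psi> w\<phi> AE_square_summable_fiber[OF wL]
        AE_square_summable_fiber[OF \<phi>L]
        AE_lborel_all_shifts[OF fourier_complement_projection[OF mra sc V1(1) br(1), folded W, folded u[folded a b]]]
        AE_lborel_all_shifts[OF fourier_complement_projection[OF mra sc V1(2) br(2), folded W, folded u[folded a b]]]
    proof eventually_elim
      case (elim \<xi>)
      let ?w = "fiber (fourier w) \<xi>"
      have 0: "fiber_inner ?w (fiber (fourier u0) \<xi>) = 0 \<and> fiber_inner ?w (fiber (fourier u1) \<xi>) = 0"
        using elim(1,3,5) by (intro fiber_cutoff(2)[OF _ _ _ _ _ _ elim(2)]) (auto simp: bracket_fiber)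
      have "fiber (fourier a) \<xi> = (\<lambda>l. fiber (fourier u0) \<xi> l + cnj (lowpass \<phi> a \<xi>) * fiber (fourier \<phi>) \<xi> l)"
        "fiber (fourier b) \<xi> = (\<lambda>l. fiber (fourier u1) \<xi> l + cnj (lowpass \<phi> b \<xi>) * fiber (fourier \<phi>) \<xi> l)"
        using elim(7,8) by (simp_all add: fun_eq_iff fiber_def lowpass[OF mra sc] L)
      then show ?case
        using 0 elim(1,4,5,6)
        by (simp add: bracket_fiber fiber_inner_add fiber_inner_cmult square_integrable_cmult)
    qed
    then have "AE \<xi> in lborel. bracket (fourier w) (fourier a) \<xi> = 0" "AE \<xi> in lborel. bracket (fourier w) (fourier b) \<xi> = 0"
      by auto
    then have "l2_inner w (shift k a) = 0" "l2_inner w (shift k b) = 0" for k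
      using l2_inner_shift_eq_0[OF wL] L by auto
    moreover have "w \<in> V 1" using w by (simp add: orth_complement_in_def)
    ultimately have "l2_inner w w = 0"
      by (rule V1_orthI[OF mra sc wL, folded a b])
    then show ?thesis by (rule l2_inner_self_eq_0[OF wL])
  qed
  show "orthonormal_wavelet \<psi>"
    by (rule mra_orthonormal_wavelet[OF mra Wshift[OF \<psi>W, unfolded W] on compl])
qed

text \<open>Prescribing a transform determines a function only up to null sets. Existence is
  therefore asserted separately, so that the claim about every representative is not
  vacuous.\<close>

theorem theorem7:
  fixes V :: "int \<Rightarrow> (real \<Rightarrow> complex) set"
    and W0 :: "(real \<Rightarrow> complex) set"
    and \<phi> \<phi>0 \<phi>1 :: "real \<Rightarrow> complex"
    and E F :: "real set"
    and f g :: "real \<Rightarrow> real"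
  assumes "multiresolution_analysis V"
    and "scaling_function V \<phi>"
    and "W0 = orth_complement_in (V 1) (V 0)"
    and "\<phi>0 = orth_proj W0 (dilation \<phi>)"
    and "\<phi>1 = orth_proj W0 (dilation (translation \<phi>))"
    and "E = {\<xi>. fourier_vec_norm_sq \<phi>0 \<xi> \<ge> ennreal (1 / 2)}"
    and "F = {\<xi>. fourier_vec_norm_sq \<phi>1 \<xi> > ennreal (1 / 2)}"
    and "f = (\<lambda>\<xi>. indicator E \<xi> / fourier_vec_norm \<phi>0 \<xi>)"
    and "g = (\<lambda>\<xi>. indicator F \<xi> / fourier_vec_norm \<phi>1 \<xi>)"
  shows "(\<exists>\<psi>\<in>L2. AE \<xi> in lborel. fourier \<psi> \<xi> =
            of_real (f \<xi>) * fourier \<phi>0 \<xi> + of_real (g \<xi>) * fourier \<phi>1 \<xi>) \<and>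
         (\<forall>\<psi>\<in>L2. (AE \<xi> in lborel. fourier \<psi> \<xi> =
            of_real (f \<xi>) * fourier \<phi>0 \<xi> + of_real (g \<xi>) * fourier \<phi>1 \<xi>) \<longrightarrow>
            orthonormal_wavelet \<psi> \<and> \<psi> \<in> W0)"
proof -
  note V = assms(1) and sc = assms(2) and W = assms(3)
  note u = assms(4,5)
  note f = assms(8)[unfolded assms(6)] and g = assms(9)[unfolded assms(7)]
  have L: "dilation \<phi> \<in> L2" "dilation (translation \<phi>) \<in> L2"
    using mra_L2[OF V] generators_V1[OF V sc] by auto
  have "\<phi>0 \<in> W0" "\<phi>1 \<in> W0"
    unfolding u using orth_proj(1)[OF mra_complement_subspace[OF V sc, folded W]] L by auto
  from cutoff_exists[OF V sc W this f g] cutoff_wavelet[OF V sc W u f g]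
    mra_complement_L2[OF V sc, folded W]
  show ?thesis by blast
qed

end
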